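(* Let $\Gamma$ be a finitely generated nilpotent group and let $(X,\alpha)$ be an expansive algebraic action of $\Gamma$, i.e. $\alpha$ is an expansive action of $\Gamma$ on a compact metrizable abelian group $X$ by continuous automorphisms of $X$. Then the $\sigma$-algebra of $\alpha$-invariant Borel subsets of $X$, taken modulo null sets of the Haar measure on $X$, is finite. If $X$ is also connected, then $\alpha$ is ergodic with respect to the Haar measure on $X$.
   Context: An algebraic action $(X,\alpha)$ of a countable group $\Gamma$ is an action $\alpha$ of $\Gamma$ on a compact metrizable abelian group $X$ by continuous automorphisms of $X$; it preserves the normalized Haar measure $\lambda_X$ on $X$, and $(X,\alpha)$ is regarded as a measure preserving dynamical system with respect to $\lambda_X$. The action is expansive if there is a neighbourhood $U$ of $0$ in $X$ such that $\bigcap_{\gamma\in\Gamma}\alpha(\gamma)(U)=\{0\}$. A Borel set $E\subset X$ is $\alpha$-invariant if $\lambda_X(\alpha(\gamma)(E)\,\triangle\, E)=0$ for all $\gamma\in\Gamma$; sets differing by a $\lambda_X$-null set are identified. The action is ergodic if every $\alpha$-invariant Borel set has $\lambda_X$-measure $0$ or $1$. *)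

theory Defs
  imports "HOL-Analysis.Analysis" "HOL-Algebra.Group_Action" "HOL-Algebra.Generated_Groups"
begin

definition finitely_generated_group :: "('g, 'b) monoid_scheme \<Rightarrow> bool" where
  "finitely_generated_group G \<longleftrightarrow>
     group G \<and> (\<exists>S. finite S \<and> S \<subseteq> carrier G \<and> generate G S = carrier G)"

primrec lower_central_series :: "('g, 'b) monoid_scheme \<Rightarrow> nat \<Rightarrow> 'g set" where
  "lower_central_series G 0 = carrier G"
| "lower_central_series G (Suc n) =
     generate G (\<Union>g\<in>carrier G. \<Union>h\<in>lower_central_series G n.
       {g \<otimes>\<^bsub>G\<^esub> h \<otimes>\<^bsub>G\<^esub> inv\<^bsub>G\<^esub> g \<otimes>\<^bsub>G\<^esub> inv\<^bsub>G\<^esub> h})"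

definition nilpotent_group :: "('g, 'b) monoid_scheme \<Rightarrow> bool" where
  "nilpotent_group G \<longleftrightarrow> group G \<and> (\<exists>n. lower_central_series G n = {\<one>\<^bsub>G\<^esub>})"

text \<open>A compact metrizable abelian group is a type of sort
  \<open>{topological_ab_group_add, metric_space}\<close> whose universe is compact: the sort provides a metric
  inducing the topology, and no notion below depends on which one. Since \<open>carrier (BijGroup UNIV)\<close>
  consists of all bijections of the type, \<open>group_action G UNIV \<alpha>\<close> says that \<open>\<alpha>\<close> is a group
  homomorphism from \<open>G\<close> to the bijections. The inverse of each \<open>\<alpha> \<gamma>\<close> is \<open>\<alpha> (inv \<gamma>)\<close>, which is
  again continuous and additive, so every \<open>\<alpha> \<gamma>\<close> is an automorphism of the topological group.\<close>

definition algebraic_action ::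
  "('g, 'b) monoid_scheme \<Rightarrow> ('g \<Rightarrow> 'x \<Rightarrow> 'x::{topological_ab_group_add, metric_space}) \<Rightarrow> bool" where
  "algebraic_action G \<alpha> \<longleftrightarrow>
     compact (UNIV :: 'x set) \<and>
     group_action G UNIV \<alpha> \<and>
     (\<forall>\<gamma>\<in>carrier G. Modules.additive (\<alpha> \<gamma>) \<and> continuous_on UNIV (\<alpha> \<gamma>))"

definition expansive ::
  "('g, 'b) monoid_scheme \<Rightarrow> ('g \<Rightarrow> 'x \<Rightarrow> 'x::{topological_ab_group_add, metric_space}) \<Rightarrow> bool" where
  "expansive G \<alpha> \<longleftrightarrow> (\<exists>U. 0 \<in> interior U \<and> (\<Inter>\<gamma>\<in>carrier G. \<alpha> \<gamma> ` U) = {0})"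

text \<open>On a compact metrizable group exactly one measure satisfies the following predicate.\<close>

definition normalized_haar_measure ::
  "'x::{topological_ab_group_add, metric_space} measure \<Rightarrow> bool" where
  "normalized_haar_measure M \<longleftrightarrow>
     sets M = sets borel \<and> emeasure M UNIV = 1 \<and>
     (\<forall>a. \<forall>E\<in>sets borel. emeasure M ((\<lambda>x. a + x) ` E) = emeasure M E)"

definition invariant_sets ::
  "('g, 'b) monoid_scheme \<Rightarrow> ('g \<Rightarrow> 'x \<Rightarrow> 'x) \<Rightarrow> 'x measure \<Rightarrow> 'x set set" where
  "invariant_sets G \<alpha> M =
     {E \<in> sets M. \<forall>\<gamma>\<in>carrier G. sym_diff (\<alpha> \<gamma> ` E) E \<in> null_sets M}"

definition eq_mod_null :: "'x measure \<Rightarrow> ('x set \<times> 'x set) set" where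
  "eq_mod_null M = {(A, B). A \<in> sets M \<and> B \<in> sets M \<and> sym_diff A B \<in> null_sets M}"

lemma equiv_eq_mod_null: "equiv (sets M) (eq_mod_null M)"
proof (rule equivI)
  show "eq_mod_null M \<subseteq> sets M \<times> sets M"
    by (auto simp: eq_mod_null_def)
  show "refl_on (sets M) (eq_mod_null M)"
    by (auto simp: refl_on_def eq_mod_null_def)
  show "sym (eq_mod_null M)"
    by (auto simp: sym_def eq_mod_null_def Un_commute)
  show "trans (eq_mod_null M)"
  proof (rule transI)
    fix A B C
    assume "(A, B) \<in> eq_mod_null M" "(B, C) \<in> eq_mod_null M"
    then have *: "A \<in> sets M" "C \<in> sets M" "sym_diff A B \<union> sym_diff B C \<in> null_sets M"
      by (auto simp: eq_mod_null_def)
    have "sym_diff A C \<in> null_sets M"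
      by (rule null_sets_subset[OF *(3)]) (use * in auto)
    with * show "(A, C) \<in> eq_mod_null M"
      by (simp add: eq_mod_null_def)
  qed
qed

definition invariant_sets_mod_null ::
  "('g, 'b) monoid_scheme \<Rightarrow> ('g \<Rightarrow> 'x \<Rightarrow> 'x) \<Rightarrow> 'x measure \<Rightarrow> 'x set set set" where
  "invariant_sets_mod_null G \<alpha> M =
     (\<lambda>E. eq_mod_null M `` {E}) ` invariant_sets G \<alpha> M"

definition ergodic_action ::
  "('g, 'b) monoid_scheme \<Rightarrow> ('g \<Rightarrow> 'x \<Rightarrow> 'x) \<Rightarrow> 'x measure \<Rightarrow> bool" where
  "ergodic_action G \<alpha> M \<longleftrightarrow>
     (\<forall>E\<in>invariant_sets G \<alpha> M. emeasure M E = 0 \<or> emeasure M E = 1)"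

end

theory Submission
  imports Defs
begin

text \<open>Let \<open>M\<close> be a finitely generated submodule of the dual of \<open>X\<close> separating points; it exists by expansiveness
  because characters separate the points of \<open>X\<close>. By Bessel's inequality the Fourier coefficients of an
  invariant set vanish at characters with infinite orbit, so it suffices that the group \<open>B\<close> of
  characters in \<open>M\<close> with finite orbit is finite: then an invariant set is, up to null sets, a union of
  fibres of the finitely many possible restrictions to \<open>B\<close>, and these are constant if \<open>X\<close> is connected.

  \<open>M\<close> is Noetherian since the acting group is polycyclic. If \<open>B\<close> were infinite, choose a submodule
  \<open>J\<close> maximal among those for which \<open>M / J\<close> has infinitely many elements of finite orbit. Along a
  central series, some power of each group element acts as an endomorphism of \<open>M / J\<close> fixing the
  elements of finite orbit, and maximality of \<open>J\<close> forces it to act trivially on \<open>M / J\<close>. Hence the group acts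
  through a finite quotient on the infinite module \<open>M / J\<close>, that is, on the infinite closed
  subgroup of \<open>X\<close> annihilated by \<open>J\<close>, which contradicts expansiveness.\<close>

text \<open>The Fourier argument uses only a separating group of characters: trigonometric
  polynomials with spectrum in it are uniformly dense, so a finite Borel measure is determined by
  its coefficients on \<open>M\<close>.

  Nilpotence serves beyond the Noetherian property. The next generator t of the central chain has
  its commutators in the step N below. Once N acts on M / J through finitely many maps, the
  pigeonhole principle makes a power of t commute with every group element modulo J. A further power
  minus the identity is then an endomorphism of M / J that kills the elements of finite orbit.

  Quotients are never formed. Statements about M / J are congruences \<open>a - b \<in> J\<close> in
  one ambient group, so J can vary freely in the maximality argument.

  The existence of enough characters is derived from Haar measure: a convolution operator has a top
  eigenspace, and a minimal convolution idempotent in it is a scalar multiple of a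
  character.\<close>

section \<open>Modules over nilpotent groups\<close>

subsection \<open>Central series\<close>

text \<open>Each step adds one generator that is central modulo the previous step. This refines the
  lower central series into cyclic steps, so that later inductions meet one new generator at a
  time.\<close>

inductive polycentral :: "('g, 'b) monoid_scheme \<Rightarrow> 'g set \<Rightarrow> bool" for G (structure) where
  polycentral_one: "polycentral G {\<one>}"
| polycentral_insert: "polycentral G N \<Longrightarrow> t \<in> carrier G \<Longrightarrow>
    (\<And>g. g \<in> carrier G \<Longrightarrow> g \<otimes> t \<otimes> inv g \<otimes> inv t \<in> N) \<Longrightarrow>
    polycentral G (generate G (insert t N))"

context group
begin

lemma mult_inv_cancel [simp]:
  assumes "x \<in> carrier G" "y \<in> carrier G"
  shows "x \<otimes> (inv x \<otimes> y) = y" "inv x \<otimes> (x \<otimes> y) = y"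
  using assms by (simp_all flip: m_assoc)

text \<open>This set is the preimage of the centre of G / D, so centrality modulo \<open>D\<close>
  can be checked on generators.\<close>

lemma commutator_right_subgroup:
  assumes "D \<lhd> G"
  shows "subgroup {h \<in> carrier G. \<forall>g\<in>carrier G. g \<otimes> h \<otimes> inv g \<otimes> inv h \<in> D} G"
proof -
  interpret D: normal D G by fact
  have conj: "x \<otimes> d \<otimes> inv x \<in> D" if "x \<in> carrier G" "d \<in> D" for x d
    using that assms by (simp add: normal_inv_iff)
  show ?thesis
  proof (rule subgroupI)
    show "{h \<in> carrier G. \<forall>g\<in>carrier G. g \<otimes> h \<otimes> inv g \<otimes> inv h \<in> D} \<noteq> {}"
      by (auto intro!: exI[of _ \<one>])
  next
    fix h assume h: "h \<in> {h \<in> carrier G. \<forall>g\<in>carrier G. g \<otimes> h \<otimes> inv g \<otimes> inv h \<in> D}"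
    have "g \<otimes> inv h \<otimes> inv g \<otimes> inv (inv h) \<in> D" if g: "g \<in> carrier G" for g
    proof -
      have "inv h \<otimes> inv (g \<otimes> h \<otimes> inv g \<otimes> inv h) \<otimes> inv (inv h) \<in> D"
        using h g by (intro conj D.m_inv_closed) auto
      also have "inv h \<otimes> inv (g \<otimes> h \<otimes> inv g \<otimes> inv h) \<otimes> inv (inv h) = g \<otimes> inv h \<otimes> inv g \<otimes> inv (inv h)"
        using h g by (simp add: inv_mult_group m_assoc)
      finally show ?thesis .
    qed
    with h show "inv h \<in> {h \<in> carrier G. \<forall>g\<in>carrier G. g \<otimes> h \<otimes> inv g \<otimes> inv h \<in> D}"
      by auto
  next
    fix h h' assume h: "h \<in> {h \<in> carrier G. \<forall>g\<in>carrier G. g \<otimes> h \<otimes> inv g \<otimes> inv h \<in> D}"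
      "h' \<in> {h \<in> carrier G. \<forall>g\<in>carrier G. g \<otimes> h \<otimes> inv g \<otimes> inv h \<in> D}"
    have "g \<otimes> (h \<otimes> h') \<otimes> inv g \<otimes> inv (h \<otimes> h') \<in> D" if g: "g \<in> carrier G" for g
    proof -
      have "(g \<otimes> h \<otimes> inv g \<otimes> inv h) \<otimes> (h \<otimes> (g \<otimes> h' \<otimes> inv g \<otimes> inv h') \<otimes> inv h) \<in> D"
        by (rule D.m_closed[OF _ conj]) (use h g in auto)
      also have "(g \<otimes> h \<otimes> inv g \<otimes> inv h) \<otimes> (h \<otimes> (g \<otimes> h' \<otimes> inv g \<otimes> inv h') \<otimes> inv h)
          = g \<otimes> (h \<otimes> h') \<otimes> inv g \<otimes> inv (h \<otimes> h')"
        using h g by (simp add: inv_mult_group m_assoc)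
      finally show ?thesis .
    qed
    with h show "h \<otimes> h' \<in> {h \<in> carrier G. \<forall>g\<in>carrier G. g \<otimes> h \<otimes> inv g \<otimes> inv h \<in> D}"
      by auto
  qed auto
qed

text \<open>The preimage of the centralizer of \<open>h\<close> in G / D; with \<open>h\<close>
  fixed, generators in the other argument suffice.\<close>

lemma commutator_left_subgroup:
  assumes "D \<lhd> G" and h: "h \<in> carrier G"
  shows "subgroup {g \<in> carrier G. g \<otimes> h \<otimes> inv g \<otimes> inv h \<in> D} G"
proof -
  interpret D: normal D G by fact
  have conj: "x \<otimes> d \<otimes> inv x \<in> D" if "x \<in> carrier G" "d \<in> D" for x d
    using that assms by (simp add: normal_inv_iff)
  show ?thesis
  proof (rule subgroupI)
    show "{g \<in> carrier G. g \<otimes> h \<otimes> inv g \<otimes> inv h \<in> D} \<noteq> {}"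
      using h by (auto intro!: exI[of _ \<one>])
  next
    fix g assume g: "g \<in> {g \<in> carrier G. g \<otimes> h \<otimes> inv g \<otimes> inv h \<in> D}"
    have "inv g \<otimes> inv (g \<otimes> h \<otimes> inv g \<otimes> inv h) \<otimes> inv (inv g) \<in> D"
      using h g by (intro conj D.m_inv_closed) auto
    also have "inv g \<otimes> inv (g \<otimes> h \<otimes> inv g \<otimes> inv h) \<otimes> inv (inv g) = inv g \<otimes> h \<otimes> inv (inv g) \<otimes> inv h"
      using h g by (simp add: inv_mult_group m_assoc)
    finally show "inv g \<in> {g \<in> carrier G. g \<otimes> h \<otimes> inv g \<otimes> inv h \<in> D}"
      using g by auto
  next
    fix g g' assume g: "g \<in> {g \<in> carrier G. g \<otimes> h \<otimes> inv g \<otimes> inv h \<in> D}"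
      "g' \<in> {g \<in> carrier G. g \<otimes> h \<otimes> inv g \<otimes> inv h \<in> D}"
    have "(g \<otimes> (g' \<otimes> h \<otimes> inv g' \<otimes> inv h) \<otimes> inv g) \<otimes> (g \<otimes> h \<otimes> inv g \<otimes> inv h) \<in> D"
      by (rule D.m_closed[OF conj]) (use h g in auto)
    also have "(g \<otimes> (g' \<otimes> h \<otimes> inv g' \<otimes> inv h) \<otimes> inv g) \<otimes> (g \<otimes> h \<otimes> inv g \<otimes> inv h)
        = (g \<otimes> g') \<otimes> h \<otimes> inv (g \<otimes> g') \<otimes> inv h"
      using h g by (simp add: inv_mult_group m_assoc)
    finally show "g \<otimes> g' \<in> {g \<in> carrier G. g \<otimes> h \<otimes> inv g \<otimes> inv h \<in> D}"
      using g by auto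
  qed auto
qed

lemma normal_if_commutators:
  assumes "subgroup D G" and "\<And>g d. g \<in> carrier G \<Longrightarrow> d \<in> D \<Longrightarrow> g \<otimes> d \<otimes> inv g \<otimes> inv d \<in> D"
  shows "D \<lhd> G"
  unfolding normal_inv_iff
proof (intro conjI ballI)
  interpret D: subgroup D G by fact
  fix g d assume gd: "g \<in> carrier G" "d \<in> D"
  have "(g \<otimes> d \<otimes> inv g \<otimes> inv d) \<otimes> d \<in> D"
    using gd assms(2) by blast
  then show "g \<otimes> d \<otimes> inv g \<in> D"
    using gd by (simp add: m_assoc)
qed fact

lemma normal_commutator:
  assumes "D \<lhd> G" "g \<in> carrier G" "d \<in> D"
  shows "g \<otimes> d \<otimes> inv g \<otimes> inv d \<in> D"
proof -
  interpret D: normal D G by fact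
  have "g \<otimes> d \<otimes> inv g \<in> D"
    using assms by (simp add: normal_inv_iff)
  then show ?thesis
    by (rule D.m_closed[OF _ D.m_inv_closed]) (use assms in auto)
qed

text \<open>Every element of the enlarged subgroup is central modulo \<open>N\<close>, so its
  commutators lie in \<open>N\<close> and hence in the subgroup itself.\<close>

lemma polycentral_normal: "polycentral G N \<Longrightarrow> N \<lhd> G"
proof (induction rule: polycentral.induct)
  case polycentral_one
  then show ?case by (rule one_is_normal)
next
  case (polycentral_insert N t)
  interpret N: normal N G by (rule polycentral_insert.IH)
  let ?C = "{h \<in> carrier G. \<forall>g\<in>carrier G. g \<otimes> h \<otimes> inv g \<otimes> inv h \<in> N}"
  have sub: "insert t N \<subseteq> carrier G"
    using polycentral_insert.hyps N.subset by auto
  have "insert t N \<subseteq> ?C"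
    using polycentral_insert.hyps N.subset normal_commutator[OF polycentral_insert.IH] by auto
  then have "generate G (insert t N) \<subseteq> ?C"
    using generate_subgroup_incl commutator_right_subgroup[OF polycentral_insert.IH] by blast
  then show ?case
    by (intro normal_if_commutators generate_is_subgroup sub) (auto intro: generate.incl)
qed

lemma polycentral_generate_Un:
  assumes "finite W" "polycentral G D" "W \<subseteq> carrier G"
    and "\<And>g w. g \<in> carrier G \<Longrightarrow> w \<in> W \<Longrightarrow> g \<otimes> w \<otimes> inv g \<otimes> inv w \<in> D"
  shows "polycentral G (generate G (W \<union> D))"
  using assms
proof (induction W)
  case empty
  have "generate G D = D"
    using polycentral_normal[OF empty(1)] generateI[of D D] by (auto simp: normal_def)
  then show ?case using empty by simp
next
  case (insert w W)
  have D: "D \<subseteq> carrier G"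
    using polycentral_normal[OF insert.prems(1)] by (simp add: normal_imp_subgroup subgroup.subset)
  have sub: "W \<union> D \<subseteq> carrier G" using D insert by auto
  have "polycentral G (generate G (insert w (generate G (W \<union> D))))"
  proof (rule polycentral_insert)
    show "polycentral G (generate G (W \<union> D))" using insert by auto
    show "g \<otimes> w \<otimes> inv g \<otimes> inv w \<in> generate G (W \<union> D)" if "g \<in> carrier G" for g
      using that insert.prems by (intro generate.incl) auto
  qed (use insert in auto)
  also have "generate G (insert w (generate G (W \<union> D))) = generate G (insert w W \<union> D)"
  proof (rule antisym)
    have sub': "insert w W \<union> D \<subseteq> carrier G" using sub insert by auto
    have "generate G (W \<union> D) \<subseteq> generate G (insert w W \<union> D)"
      by (rule mono_generate) auto
    then show "generate G (insert w (generate G (W \<union> D))) \<subseteq> generate G (insert w W \<union> D)"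
      by (intro generate_subgroup_incl generate_is_subgroup sub') (auto intro: generate.incl)
    show "generate G (insert w W \<union> D) \<subseteq> generate G (insert w (generate G (W \<union> D)))"
      by (intro mono_generate) (auto intro: generate.incl)
  qed
  finally show ?case .
qed

lemma lower_central_series_normal: "lower_central_series G n \<lhd> G"
  and lower_central_series_commutator:
    "g \<in> carrier G \<Longrightarrow> h \<in> lower_central_series G n \<Longrightarrow>
      g \<otimes> h \<otimes> inv g \<otimes> inv h \<in> lower_central_series G (Suc n)"
  and lower_central_series_Suc_subset: "lower_central_series G (Suc n) \<subseteq> lower_central_series G n"
proof -
  have comm: "g \<otimes> h \<otimes> inv g \<otimes> inv h \<in> lower_central_series G (Suc n)"
    if "g \<in> carrier G" "h \<in> lower_central_series G n" for g h n
    using that by (auto intro!: generate.incl)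
  have *: "lower_central_series G n \<lhd> G \<and> lower_central_series G (Suc n) \<subseteq> lower_central_series G n" for n
  proof (induction n)
    case 0
    have "(\<Union>g\<in>carrier G. \<Union>h\<in>carrier G. {g \<otimes> h \<otimes> inv g \<otimes> inv h}) \<subseteq> carrier G"
      by auto
    then show ?case
      using generate_incl by (simp add: normal_self)
  next
    case (Suc n)
    interpret N: normal "lower_central_series G n" G using Suc by blast
    have sub: "(\<Union>g\<in>carrier G. \<Union>h\<in>lower_central_series G n. {g \<otimes> h \<otimes> inv g \<otimes> inv h}) \<subseteq> carrier G"
      by auto
    have "subgroup (lower_central_series G (Suc n)) G"
      using generate_is_subgroup[OF sub] by simp
    then have nrm: "lower_central_series G (Suc n) \<lhd> G"
      by (rule normal_if_commutators) (use Suc comm in blast)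
    have "lower_central_series G (Suc (Suc n)) \<subseteq> lower_central_series G (Suc n)"
      unfolding lower_central_series.simps(2)[of G "Suc n"]
      by (rule generate_subgroup_incl) 
         (use normal_commutator[OF nrm] normal_imp_subgroup[OF nrm] in auto)
    with nrm show ?case by blast
  qed
  show "lower_central_series G n \<lhd> G" "lower_central_series G (Suc n) \<subseteq> lower_central_series G n"
    using *[of n] by blast+
  show "g \<in> carrier G \<Longrightarrow> h \<in> lower_central_series G n \<Longrightarrow>
      g \<otimes> h \<otimes> inv g \<otimes> inv h \<in> lower_central_series G (Suc n)"
    by (rule comm)
qed

declare lower_central_series.simps(2) [simp del]

text \<open>Modulo the term after next the commutator map is bilinear, so commutators of generators
  of G with generators of one term generate the next term modulo the one after it. Instead of
  bilinearity, the proof uses the two commutator subgroups above, one for each argument.\<close>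

lemma lower_central_series_generators:
  assumes "finite S" "S \<subseteq> carrier G" "generate G S = carrier G"
  shows "\<exists>W. finite W \<and> W \<subseteq> lower_central_series G n \<and>
    generate G (W \<union> lower_central_series G (Suc n)) = lower_central_series G n"
proof (induction n)
  case 0
  have "generate G (S \<union> lower_central_series G (Suc 0)) = carrier G"
  proof (rule antisym)
    have "S \<union> lower_central_series G (Suc 0) \<subseteq> carrier G"
      using assms(2) lower_central_series_Suc_subset[of 0] by simp
    then show "generate G (S \<union> lower_central_series G (Suc 0)) \<subseteq> carrier G"
      by (rule generate_incl)
    show "carrier G \<subseteq> generate G (S \<union> lower_central_series G (Suc 0))"
      using mono_generate[of S "S \<union> lower_central_series G (Suc 0)"] assms(3) by simp
  qed
  with assms(1,2) show ?case by (intro exI[of _ S]) simp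
next
  case (Suc n)
  let ?L = "lower_central_series G"
  obtain W where W: "finite W" "W \<subseteq> ?L n" "generate G (W \<union> ?L (Suc n)) = ?L n"
    using Suc by blast
  define V where "V = (\<lambda>(s, w). s \<otimes> w \<otimes> inv s \<otimes> inv w) ` (S \<times> W)"
  define D where "D = generate G (V \<union> ?L (Suc (Suc n)))"
  interpret L: normal "?L n" G by (rule lower_central_series_normal)
  interpret L1: normal "?L (Suc n)" G by (rule lower_central_series_normal)
  interpret L2: normal "?L (Suc (Suc n))" G by (rule lower_central_series_normal)
  have V: "finite V" "V \<subseteq> ?L (Suc n)"
  proof -
    show "finite V" unfolding V_def using W(1) assms(1) by simp
    have "s \<otimes> w \<otimes> inv s \<otimes> inv w \<in> ?L (Suc n)" if "s \<in> S" "w \<in> W" for s w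
      by (rule lower_central_series_commutator) (use that W assms in blast)+
    then show "V \<subseteq> ?L (Suc n)" unfolding V_def by (auto)
  qed
  have sub: "V \<union> ?L (Suc (Suc n)) \<subseteq> ?L (Suc n)"
    using V lower_central_series_Suc_subset[of "Suc n"] by blast
  have D1: "D \<subseteq> ?L (Suc n)"
    unfolding D_def by (rule generate_subgroup_incl[OF sub L1.is_subgroup])
  have D2: "?L (Suc (Suc n)) \<subseteq> D"
    unfolding D_def by (blast intro: generate.incl)
  have Dsub: "subgroup D G"
    unfolding D_def using sub L1.subset by (intro generate_is_subgroup) blast
  \<comment> \<open>\<open>D\<close> lies between two consecutive terms, and commutators with the
    larger one fall into the smaller one.\<close>
  have Dn: "D \<lhd> G"
    by (rule normal_if_commutators[OF Dsub]) (use D1 D2 lower_central_series_commutator in blast)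
  \<comment> \<open>First the left argument runs over all of G while \<open>w\<close> is a fixed
    generator; then \<open>?C\<close> lets the right argument run over the whole term.\<close>
  have W_comm: "carrier G \<subseteq> {g \<in> carrier G. g \<otimes> w \<otimes> inv g \<otimes> inv w \<in> D}" if w: "w \<in> W" for w
  proof -
    have "w \<in> carrier G" using w W L.subset by blast
    have "generate G S \<subseteq> {g \<in> carrier G. g \<otimes> w \<otimes> inv g \<otimes> inv w \<in> D}"
    proof (rule generate_subgroup_incl)
      show "S \<subseteq> {g \<in> carrier G. g \<otimes> w \<otimes> inv g \<otimes> inv w \<in> D}"
      proof
        fix s assume s: "s \<in> S"
        then have "s \<otimes> w \<otimes> inv s \<otimes> inv w \<in> V" unfolding V_def using w by force
        then show "s \<in> {g \<in> carrier G. g \<otimes> w \<otimes> inv g \<otimes> inv w \<in> D}"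
          using s assms(2) unfolding D_def by (blast intro: generate.incl)
      qed
    qed (rule commutator_left_subgroup[OF Dn \<open>w \<in> carrier G\<close>])
    then show ?thesis using assms by simp
  qed
  let ?C = "{h \<in> carrier G. \<forall>g\<in>carrier G. g \<otimes> h \<otimes> inv g \<otimes> inv h \<in> D}"
  have "W \<subseteq> ?C"
    using W_comm W(2) L.subset by blast
  moreover have "?L (Suc n) \<subseteq> ?C"
    using L1.subset D2 lower_central_series_commutator[of _ _ "Suc n"] by blast
  ultimately have "generate G (W \<union> ?L (Suc n)) \<subseteq> ?C"
    by (intro generate_subgroup_incl commutator_right_subgroup[OF Dn]) blast
  then have "?L n \<subseteq> ?C" unfolding W(3) .
  then have "?L (Suc n) \<subseteq> D"
    unfolding lower_central_series.simps(2)[of G n]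
    by (intro generate_subgroup_incl[OF _ Dsub]) auto
  with D1 have "D = ?L (Suc n)" by (rule antisym)
  with V show ?case unfolding D_def by (intro exI[of _ V]) simp
qed

lemma nilpotent_imp_polycentral:
  assumes "finitely_generated_group G" "nilpotent_group G"
  shows "polycentral G (carrier G)"
proof -
  obtain S where S: "finite S" "S \<subseteq> carrier G" "generate G S = carrier G"
    using assms unfolding finitely_generated_group_def by blast
  obtain n where n: "lower_central_series G n = {\<one>}"
    using assms unfolding nilpotent_group_def by blast
  \<comment> \<open>The index counts down from the trivial term; truncated subtraction makes the
    claim constant once \<open>k\<close> reaches \<open>n\<close>.\<close>
  have "polycentral G (lower_central_series G (n - k))" for k
  proof (induction k)
    case 0
    then show ?case by (simp add: n polycentral_one)
  next
    case (Suc k)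
    show ?case
    proof (cases "k < n")
      case True
      then obtain m where m: "n - Suc k = m" "n - k = Suc m" by (metis Suc_diff_Suc)
      obtain W where W: "finite W" "W \<subseteq> lower_central_series G m"
        "generate G (W \<union> lower_central_series G (Suc m)) = lower_central_series G m"
        using lower_central_series_generators[OF S] by blast
      have "polycentral G (generate G (W \<union> lower_central_series G (Suc m)))"
      proof (rule polycentral_generate_Un)
        show "W \<subseteq> carrier G"
          using W(2) lower_central_series_normal[of m] normal_imp_subgroup subgroup.subset by blast
        show "g \<otimes> w \<otimes> inv g \<otimes> inv w \<in> lower_central_series G (Suc m)"
          if "g \<in> carrier G" "w \<in> W" for g w
          using that W(2) by (intro lower_central_series_commutator) auto
      qed (use W Suc m in \<open>simp_all\<close>)
      then show ?thesis using W m by simp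
    qed (use Suc in simp)
  qed
  from this[of n] show ?thesis by simp
qed

lemma generate_insert_normal:
  assumes "N \<lhd> G" "t \<in> carrier G" "x \<in> generate G (insert t N)"
  shows "\<exists>n\<in>N. \<exists>j::int. x = n \<otimes> t [^] j"
proof -
  interpret N: normal N G by fact
  note t = assms(2)
  have triv: "\<exists>n\<in>N. \<exists>j::int. a = n \<otimes> t [^] j" if "a \<in> N" for a
    using that t by (intro bexI[of _ a] exI[of _ 0]) auto
  from assms(3) show ?thesis
  proof (induction rule: generate.induct)
    case one
    show ?case by (rule triv[OF N.one_closed])
  next
    case (incl h)
    have "t = \<one> \<otimes> t [^] (1::int)" using t by (simp add: int_pow_1)
    with incl triv show ?case using N.one_closed by blast
  next
    case (inv h)
    have "inv t = \<one> \<otimes> t [^] (- 1::int)" using t by (simp add: int_pow_neg int_pow_1)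
    with inv triv show ?case using N.one_closed N.m_inv_closed by blast
  next
    case (eng h1 h2)
    then obtain n1 n2 and j1 j2 :: int where n: "n1 \<in> N" "n2 \<in> N" "h1 = n1 \<otimes> t [^] j1" "h2 = n2 \<otimes> t [^] j2"
      by blast
    have c: "n1 \<in> carrier G" "n2 \<in> carrier G" using n N.subset by auto
    have "t [^] j1 \<otimes> n2 \<otimes> inv (t [^] j1) \<in> N"
      using n t assms(1) by (simp add: normal_inv_iff)
    moreover have "h1 \<otimes> h2 = (n1 \<otimes> (t [^] j1 \<otimes> n2 \<otimes> inv (t [^] j1))) \<otimes> t [^] (j1 + j2)"
      using n c t by (simp add: m_assoc int_pow_mult)
    ultimately show ?case using n by blast
  qed
qed

end

subsection \<open>Noetherian modules\<close>

locale group_module = group G for G :: "('g, 'b) monoid_scheme" (structure) +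
  fixes \<rho> :: "'g \<Rightarrow> 'm \<Rightarrow> 'm::ab_group_add"
  assumes act_add: "g \<in> carrier G \<Longrightarrow> \<rho> g (a + b) = \<rho> g a + \<rho> g b"
    and act_mult: "g \<in> carrier G \<Longrightarrow> h \<in> carrier G \<Longrightarrow> \<rho> (g \<otimes> h) a = \<rho> g (\<rho> h a)"
    and act_one [simp]: "\<rho> \<one> a = a"
begin

lemma act_zero [simp]: "g \<in> carrier G \<Longrightarrow> \<rho> g 0 = 0"
  using act_add[of g 0 0] by simp

lemma act_minus: "g \<in> carrier G \<Longrightarrow> \<rho> g (- a) = - \<rho> g a"
  using act_add[of g a "- a"] by (simp add: eq_neg_iff_add_eq_0 add.commute)

lemma act_diff: "g \<in> carrier G \<Longrightarrow> \<rho> g (a - b) = \<rho> g a - \<rho> g b"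
  using act_add[of g a "- b"] by (simp add: act_minus)

lemma act_inv [simp]:
  "g \<in> carrier G \<Longrightarrow> \<rho> g (\<rho> (inv g) a) = a" "g \<in> carrier G \<Longrightarrow> \<rho> (inv g) (\<rho> g a) = a"
  by (simp_all flip: act_mult)

text \<open>\<open>N\<close> may be any set of group elements: \<open>{\<one>}\<close> gives plain
  subgroups, a step of the central chain gives the modules of the Noetherian induction, and
  \<open>submod_generate\<close> passes from a generating set to the group it generates.\<close>

definition submod :: "'g set \<Rightarrow> 'm set \<Rightarrow> bool" where
  "submod N J \<longleftrightarrow> 0 \<in> J \<and> (\<forall>a\<in>J. \<forall>b\<in>J. a + b \<in> J) \<and> (\<forall>a\<in>J. - a \<in> J) \<and> (\<forall>g\<in>N. \<forall>a\<in>J. \<rho> g a \<in> J)"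

lemma submodI:
  assumes "0 \<in> J" "\<And>a b. a \<in> J \<Longrightarrow> b \<in> J \<Longrightarrow> a + b \<in> J" "\<And>a. a \<in> J \<Longrightarrow> - a \<in> J"
    "\<And>g a. g \<in> N \<Longrightarrow> a \<in> J \<Longrightarrow> \<rho> g a \<in> J"
  shows "submod N J"
  using assms unfolding submod_def by blast

lemma submodD:
  assumes "submod N J"
  shows "0 \<in> J" "a \<in> J \<Longrightarrow> b \<in> J \<Longrightarrow> a + b \<in> J" "a \<in> J \<Longrightarrow> - a \<in> J" "a \<in> J \<Longrightarrow> b \<in> J \<Longrightarrow> a - b \<in> J"
    "g \<in> N \<Longrightarrow> a \<in> J \<Longrightarrow> \<rho> g a \<in> J"
  using assms unfolding submod_def by (auto simp: diff_conv_add_uminus simp del: add_uminus_conv_diff)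

lemma submod_diff_commute: "submod N J \<Longrightarrow> a - b \<in> J \<longleftrightarrow> b - a \<in> J"
  using submodD(3)[of N J "a - b"] submodD(3)[of N J "b - a"] by auto

lemma submod_diff_trans: "submod N J \<Longrightarrow> a - b \<in> J \<Longrightarrow> b - c \<in> J \<Longrightarrow> a - c \<in> J"
  using submodD(2)[of N J "a - b" "b - c"] by simp

lemma submod_Int: "submod N J \<Longrightarrow> submod N K \<Longrightarrow> submod N (J \<inter> K)"
  unfolding submod_def by blast

lemma submod_mono: "N' \<subseteq> N \<Longrightarrow> submod N J \<Longrightarrow> submod N' J"
  unfolding submod_def by blast

lemma submod_generate:
  assumes "submod N J" "N \<subseteq> carrier G" "\<And>g a. g \<in> N \<Longrightarrow> a \<in> J \<Longrightarrow> \<rho> (inv g) a \<in> J"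
  shows "submod (generate G N) J"
proof -
  have "\<rho> g a \<in> J" if "g \<in> generate G N" "a \<in> J" for g a
    using that
  proof (induction arbitrary: a rule: generate.induct)
    case (eng h1 h2)
    then show ?case using generate_in_carrier[OF assms(2)] by (simp add: act_mult)
  qed (use assms in \<open>auto dest: submodD\<close>)
  with assms(1) show ?thesis unfolding submod_def by blast
qed

definition span :: "'g set \<Rightarrow> 'm set \<Rightarrow> 'm set" where
  "span N F = \<Inter>{J. submod N J \<and> F \<subseteq> J}"

lemma span_submod: "submod N (span N F)"
  unfolding span_def submod_def by blast

lemma span_superset: "F \<subseteq> span N F"
  unfolding span_def by blast

lemma span_minimal: "submod N J \<Longrightarrow> F \<subseteq> J \<Longrightarrow> span N F \<subseteq> J"
  unfolding span_def by blast

definition noeth :: "'g set \<Rightarrow> 'm set \<Rightarrow> bool" where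
  "noeth N A \<longleftrightarrow> (\<forall>J::nat \<Rightarrow> 'm set. (\<forall>i. submod N (J i) \<and> J i \<subseteq> A \<and> J i \<subseteq> J (Suc i)) \<longrightarrow>
    (\<exists>n. \<forall>i\<ge>n. J i = J n))"

lemma noethI:
  assumes "\<And>J :: nat \<Rightarrow> 'm set. \<lbrakk>\<And>i. submod N (J i); \<And>i. J i \<subseteq> A; \<And>i j. i \<le> j \<Longrightarrow> J i \<subseteq> J j\<rbrakk> \<Longrightarrow>
    \<exists>n. \<forall>i\<ge>n. J i = J n"
  shows "noeth N A"
  unfolding noeth_def
proof (intro allI impI)
  fix J :: "nat \<Rightarrow> 'm set"
  assume *: "\<forall>i. submod N (J i) \<and> J i \<subseteq> A \<and> J i \<subseteq> J (Suc i)"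
  then have "J i \<subseteq> J j" if "i \<le> j" for i j
    using lift_Suc_mono_le[of J, OF _ that] by blast
  with * show "\<exists>n. \<forall>i\<ge>n. J i = J n" by (intro assms) blast+
qed

lemma noethD:
  assumes "noeth N A" "\<And>i. submod N (J i)" "\<And>i. J i \<subseteq> A" "\<And>i. J i \<subseteq> J (Suc i)"
  obtains n where "\<And>i. i \<ge> n \<Longrightarrow> J i = J (n::nat)"
  using assms unfolding noeth_def by blast

lemma noeth_subset: "noeth N B \<Longrightarrow> A \<subseteq> B \<Longrightarrow> noeth N A"
  unfolding noeth_def by (meson order_trans)

definition sumset :: "'m set \<Rightarrow> 'm set \<Rightarrow> 'm set" where
  "sumset A B = {a + b | a b. a \<in> A \<and> b \<in> B}"

lemma sumset_submod:
  assumes "submod N A" "submod N B" "N \<subseteq> carrier G"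
  shows "submod N (sumset A B)"
proof (rule submodI)
  show "0 \<in> sumset A B"
    unfolding sumset_def mem_Collect_eq
    by (intro exI[of _ 0] conjI submodD(1)[OF assms(1)] submodD(1)[OF assms(2)]) simp
next
  fix x y assume "x \<in> sumset A B" "y \<in> sumset A B"
  then obtain a b c d where *: "x = a + b" "y = c + d" "a \<in> A" "b \<in> B" "c \<in> A" "d \<in> B"
    unfolding sumset_def by blast
  have "x + y = (a + c) + (b + d)" using * by (simp add: algebra_simps)
  then show "x + y \<in> sumset A B"
    unfolding sumset_def using * submodD(2)[OF assms(1)] submodD(2)[OF assms(2)] by blast
next
  fix x assume "x \<in> sumset A B"
  then obtain a b where *: "x = a + b" "a \<in> A" "b \<in> B"
    unfolding sumset_def by blast
  have "- x = (- a) + (- b)" using * by simp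
  then show "- x \<in> sumset A B"
    unfolding sumset_def using * submodD(3)[OF assms(1)] submodD(3)[OF assms(2)] by blast
next
  fix g x assume g: "g \<in> N" and "x \<in> sumset A B"
  then obtain a b where *: "x = a + b" "a \<in> A" "b \<in> B"
    unfolding sumset_def by blast
  have "\<rho> g x = \<rho> g a + \<rho> g b" using * g assms(3) by (auto simp: act_add)
  then show "\<rho> g x \<in> sumset A B"
    unfolding sumset_def using * g submodD(5)[OF assms(1)] submodD(5)[OF assms(2)] by blast
qed

lemma sumset_superset: "submod N A \<Longrightarrow> submod N B \<Longrightarrow> A \<subseteq> sumset A B \<and> B \<subseteq> sumset A B"
  unfolding sumset_def using submodD(1) by force

text \<open>A chain inside A + B becomes constant as soon as two chains do: its intersections with
  \<open>B\<close>, and the sets \<open>P i\<close> of possible \<open>A\<close>-components. These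
  play the roles of kernel and image of a projection along \<open>B\<close>.\<close>

lemma noeth_sumset:
  assumes "noeth N A" "noeth N B" "submod N A" "submod N B" "N \<subseteq> carrier G"
  shows "noeth N (sumset A B)"
proof (rule noethI)
  fix J :: "nat \<Rightarrow> 'm set"
  assume J: "\<And>i. submod N (J i)" "\<And>i. J i \<subseteq> sumset A B" "\<And>i j. i \<le> j \<Longrightarrow> J i \<subseteq> J j"
  define P where "P i = {a \<in> A. \<exists>b\<in>B. a + b \<in> J i}" for i
  have PA: "P i = A \<inter> sumset (J i) B" for i
  proof (intro equalityI subsetI)
    fix a assume "a \<in> P i"
    then obtain b where "a \<in> A" "b \<in> B" "a + b \<in> J i" unfolding P_def by blast
    moreover have "a = (a + b) + (- b)" by simp
    ultimately show "a \<in> A \<inter> sumset (J i) B"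
      unfolding sumset_def using submodD(3)[OF assms(4)] by blast
  next
    fix a assume "a \<in> A \<inter> sumset (J i) B"
    then obtain x b where *: "a \<in> A" "x \<in> J i" "b \<in> B" "a = x + b" unfolding sumset_def by blast
    then have "a + (- b) \<in> J i" by simp
    then show "a \<in> P i" unfolding P_def using * submodD(3)[OF assms(4)] by blast
  qed
  have "submod N (P i)" for i
    unfolding PA by (intro submod_Int sumset_submod assms J)
  moreover have "P i \<subseteq> A" "P i \<subseteq> P (Suc i)" for i
    unfolding P_def using J(3)[of i "Suc i"] by auto
  ultimately obtain n1 where n1: "\<And>i. i \<ge> n1 \<Longrightarrow> P i = P n1"
    using noethD[OF assms(1)] by metis
  have "submod N (J i \<inter> B)" "J i \<inter> B \<subseteq> B" "J i \<inter> B \<subseteq> J (Suc i) \<inter> B" for i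
    using J(3)[of i "Suc i"] by (auto intro: submod_Int assms J)
  then obtain n2 where n2: "\<And>i. i \<ge> n2 \<Longrightarrow> J i \<inter> B = J n2 \<inter> B"
    using noethD[OF assms(2), of "\<lambda>i. J i \<inter> B"] by metis
  define n where "n = max n1 n2"
  have "J i \<subseteq> J n" if i: "i \<ge> n" for i
  proof
    fix x assume x: "x \<in> J i"
    then obtain a b where ab: "x = a + b" "a \<in> A" "b \<in> B" using J(2) unfolding sumset_def by blast
    then have "a \<in> P i" unfolding P_def using x by blast
    then have "a \<in> P n" using n1[of i] n1[of n] i unfolding n_def by simp
    then obtain b' where b': "b' \<in> B" "a + b' \<in> J n" unfolding P_def by blast
    have "x - (a + b') \<in> J i" using x b' J(3)[OF i] submodD(4)[OF J(1)] by blast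
    then have "b - b' \<in> J i \<inter> B" using ab b' submodD(4)[OF assms(4)] by (simp add: algebra_simps)
    then have "b - b' \<in> J n" using n2[of i] n2[of n] i unfolding n_def by auto
    then have "(b - b') + (a + b') \<in> J n" using b' submodD(2)[OF J(1)] by blast
    then show "x \<in> J n" using ab by (simp add: algebra_simps)
  qed
  then show "\<exists>n. \<forall>i\<ge>n. J i = J n" using J(3) by (intro exI[of _ n]) blast
qed

section \<open>Hilbert's basis theorem for a normal subgroup and one further element\<close>

definition tpow :: "'g \<Rightarrow> nat \<Rightarrow> 'm \<Rightarrow> 'm" where
  "tpow t n = \<rho> t ^^ n"

context
  fixes N t
  assumes N: "N \<lhd> G" and t: "t \<in> carrier G"
begin

lemma tpow_simps [simp]: "tpow t 0 a = a" "tpow t (Suc n) a = \<rho> t (tpow t n a)"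
  by (simp_all add: tpow_def)

lemma tpow_shift: "tpow t n (\<rho> t a) = \<rho> t (tpow t n a)"
  by (simp add: tpow_def funpow_swap1)

lemma tpow_compose: "tpow t m (tpow t n a) = tpow t (m + n) a"
  by (simp add: tpow_def funpow_add)

lemma tpow_add: "tpow t n (a + b) = tpow t n a + tpow t n b"
  using t by (induction n) (auto simp: act_add)

lemma tpow_minus: "tpow t n (- a) = - tpow t n a"
  using t by (induction n) (auto simp: act_minus)

lemma tpow_zero [simp]: "tpow t n 0 = 0"
  using t by (induction n) auto

lemma N_carrier: "N \<subseteq> carrier G"
  using N by (simp add: normal_imp_subgroup subgroup.subset)

text \<open>As \<open>t\<close> normalises \<open>N\<close>, acting by a power of \<open>t\<close>
  is \<open>N\<close>-linear up to an automorphism of \<open>N\<close>. This is why images and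
  preimages of \<open>N\<close>-submodules under it are again \<open>N\<close>-submodules.\<close>

lemma tpow_twist_out:
  assumes "g \<in> N"
  shows "\<exists>g'\<in>N. \<forall>a. \<rho> g (tpow t n a) = tpow t n (\<rho> g' a)"
  using assms
proof (induction n arbitrary: g)
  case (Suc n)
  have "inv t \<otimes> g \<otimes> inv (inv t) \<in> N"
    using N t Suc.prems unfolding normal_inv_iff by blast
  then obtain g' where g': "g' \<in> N" "\<And>a. \<rho> (inv t \<otimes> g \<otimes> t) (tpow t n a) = tpow t n (\<rho> g' a)"
    using Suc.IH t by auto
  have "\<rho> g (tpow t (Suc n) a) = tpow t (Suc n) (\<rho> g' a)" for a
  proof -
    have "\<rho> t (\<rho> (inv t \<otimes> g \<otimes> t) (tpow t n a)) = \<rho> g (\<rho> t (tpow t n a))"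
      using t Suc.prems N_carrier by (auto simp: act_mult)
    then show ?thesis using g' by simp
  qed
  then show ?case using g' by blast
qed auto

lemma tpow_twist_in:
  assumes "g \<in> N"
  shows "\<exists>g'\<in>N. \<forall>a. tpow t n (\<rho> g a) = \<rho> g' (tpow t n a)"
  using assms
proof (induction n arbitrary: g)
  case (Suc n)
  then obtain g' where g': "g' \<in> N" "\<And>a. tpow t n (\<rho> g a) = \<rho> g' (tpow t n a)" by blast
  have "t \<otimes> g' \<otimes> inv t \<in> N"
    using N t g' unfolding normal_inv_iff by blast
  moreover have "tpow t (Suc n) (\<rho> g a) = \<rho> (t \<otimes> g' \<otimes> inv t) (tpow t (Suc n) a)" for a
    using t g' N_carrier by (auto simp: act_mult)
  ultimately show ?case by blast
qed auto

lemma tpow_image_submod: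
  assumes "submod N A"
  shows "submod N (tpow t n ` A)"
proof (rule submodI)
  show "0 \<in> tpow t n ` A" using submodD(1)[OF assms] by force
next
  fix a b assume "a \<in> tpow t n ` A" "b \<in> tpow t n ` A"
  then show "a + b \<in> tpow t n ` A" using submodD(2)[OF assms] by (auto simp flip: tpow_add)
next
  fix a assume "a \<in> tpow t n ` A"
  then show "- a \<in> tpow t n ` A" using submodD(3)[OF assms] by (auto simp flip: tpow_minus)
next
  fix g a assume "g \<in> N" "a \<in> tpow t n ` A"
  then show "\<rho> g a \<in> tpow t n ` A" using tpow_twist_out submodD(5)[OF assms] by fastforce
qed

lemma tpow_vimage_submod:
  assumes "submod N A"
  shows "submod N (tpow t n -` A)"
proof (rule submodI)
  fix g a assume "g \<in> N" "a \<in> tpow t n -` A"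
  then show "\<rho> g a \<in> tpow t n -` A"
    using tpow_twist_in[of g n] submodD(5)[OF assms] by auto
qed (auto simp: tpow_add tpow_minus submodD[OF assms])

lemma tpow_inj: "inj (tpow t n)"
proof (induction n)
  case (Suc n)
  have "inj (\<rho> t)" using t by (intro inj_on_inverseI[of _ "\<rho> (inv t)"]) simp
  moreover have "tpow t (Suc n) = \<rho> t \<circ> tpow t n" by (auto simp: tpow_def)
  ultimately show ?case using inj_compose Suc by metis
qed (simp add: tpow_def)

lemma noeth_tpow_image:
  assumes "noeth N A"
  shows "noeth N (tpow t n ` A)"
proof (rule noethI)
  fix J :: "nat \<Rightarrow> 'm set"
  assume J: "\<And>i. submod N (J i)" "\<And>i. J i \<subseteq> tpow t n ` A" "\<And>i j. i \<le> j \<Longrightarrow> J i \<subseteq> J j"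
  have "submod N (tpow t n -` J i)" "tpow t n -` J i \<subseteq> A" "tpow t n -` J i \<subseteq> tpow t n -` J (Suc i)" for i
    using J(2)[of i] J(3)[of i "Suc i"] injD[OF tpow_inj[of n]] tpow_vimage_submod[OF J(1)] by auto
  then obtain k where k: "\<And>i. i \<ge> k \<Longrightarrow> tpow t n -` J i = tpow t n -` J k"
    using noethD[OF assms, of "\<lambda>i. tpow t n -` J i"] by metis
  have "tpow t n ` (tpow t n -` J i) = J i" for i using J(2)[of i] by auto
  then show "\<exists>k. \<forall>i\<ge>k. J i = J k" using k by metis
qed

text \<open>\<open>filt A n\<close> is A + tA + ... + t^n A, the analogue of polynomials of degree
  at most n with coefficients in \<open>A\<close>.\<close>

primrec filt :: "'m set \<Rightarrow> nat \<Rightarrow> 'm set" where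
  "filt A 0 = A"
| "filt A (Suc n) = sumset (filt A n) (tpow t (Suc n) ` A)"

lemma filt_submod: "submod N A \<Longrightarrow> submod N (filt A n)"
  by (induction n) (auto intro!: sumset_submod tpow_image_submod N_carrier simp del: tpow_simps)

lemma filt_noeth:
  assumes "submod N A" "noeth N A"
  shows "noeth N (filt A n)"
  using assms
  by (induction n)
    (auto intro!: noeth_sumset noeth_tpow_image tpow_image_submod filt_submod N_carrier simp del: tpow_simps)

lemma filt_mono: 
  assumes "submod N A" "m \<le> n"
  shows "filt A m \<subseteq> filt A n"
  using assms(2)
proof (rule lift_Suc_mono_le[rotated])
  show "filt A n \<subseteq> filt A (Suc n)" for n
    using sumset_superset[OF filt_submod tpow_image_submod] assms(1) by (simp del: tpow_simps)
qed

lemma filt_shift: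
  assumes "submod N A" "a \<in> filt A n"
  shows "\<rho> t a \<in> filt A (Suc n)"
  using assms(2)
proof (induction n arbitrary: a)
  case 0
  have "\<rho> t a = 0 + tpow t (Suc 0) a" by simp
  then show ?case
    unfolding filt.simps sumset_def using 0 submodD(1)[OF assms(1)] by force
next
  case (Suc n)
  then obtain b c where *: "a = b + tpow t (Suc n) c" "b \<in> filt A n" "c \<in> A"
    unfolding filt.simps sumset_def by blast
  then have "\<rho> t a = \<rho> t b + tpow t (Suc (Suc n)) c" using t by (simp add: act_add)
  then show ?case
    unfolding filt.simps(2)[of A "Suc n"] using Suc.IH * by (auto simp: sumset_def simp del: tpow_simps filt.simps)
qed

text \<open>The leading coefficients of elements of \<open>J\<close> of degree n + 1, not n: the
  remainder \<open>u\<close> has degree at most n. Coefficients stand to the right of the power of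
  \<open>t\<close>.\<close>

definition lead :: "'m set \<Rightarrow> 'm set \<Rightarrow> nat \<Rightarrow> 'm set" where
  "lead A J n = {a \<in> A. \<exists>u\<in>filt A n. tpow t (Suc n) a + u \<in> J}"

lemma lead_submod:
  assumes A: "submod N A" and J: "submod N J"
  shows "submod N (lead A J n)"
proof (rule submodI)
  note F = filt_submod[OF A, of n]
  show "0 \<in> lead A J n"
    unfolding lead_def using submodD(1)[OF A] submodD(1)[OF F] submodD(1)[OF J] t
    by (auto intro!: bexI[of _ 0])
next
  note F = filt_submod[OF A, of n]
  fix a b assume "a \<in> lead A J n" "b \<in> lead A J n"
  then obtain u v where *: "a \<in> A" "b \<in> A" "u \<in> filt A n" "v \<in> filt A n"
    "tpow t (Suc n) a + u \<in> J" "tpow t (Suc n) b + v \<in> J"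
    unfolding lead_def by blast
  have "tpow t (Suc n) (a + b) + (u + v) = (tpow t (Suc n) a + u) + (tpow t (Suc n) b + v)"
    unfolding tpow_add by (simp add: algebra_simps)
  also have "\<dots> \<in> J" using * submodD(2)[OF J] by blast
  finally show "a + b \<in> lead A J n"
    unfolding lead_def using * submodD(2)[OF A] submodD(2)[OF F] by blast
next
  note F = filt_submod[OF A, of n]
  fix a assume "a \<in> lead A J n"
  then obtain u where *: "a \<in> A" "u \<in> filt A n" "tpow t (Suc n) a + u \<in> J"
    unfolding lead_def by blast
  have "tpow t (Suc n) (- a) + (- u) = - (tpow t (Suc n) a + u)"
    unfolding tpow_minus by (simp add: algebra_simps)
  also have "\<dots> \<in> J" using * submodD(3)[OF J] by blast
  finally show "- a \<in> lead A J n"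
    unfolding lead_def using * submodD(3)[OF A] submodD(3)[OF F] by blast
next
  note F = filt_submod[OF A, of n]
  fix g a assume g: "g \<in> N" and "a \<in> lead A J n"
  then obtain u where *: "a \<in> A" "u \<in> filt A n" "tpow t (Suc n) a + u \<in> J"
    unfolding lead_def by blast
  obtain g' where g': "g' \<in> N" "\<And>a. tpow t (Suc n) (\<rho> g a) = \<rho> g' (tpow t (Suc n) a)"
    using tpow_twist_in[OF g] by blast
  have "tpow t (Suc n) (\<rho> g a) + \<rho> g' u = \<rho> g' (tpow t (Suc n) a + u)"
    using g' N_carrier by (auto simp: act_add simp del: tpow_simps)
  also have "\<dots> \<in> J" using * g' submodD(5)[OF J] by blast
  finally show "\<rho> g a \<in> lead A J n"
    unfolding lead_def using * g g' submodD(5)[OF A] submodD(5)[OF F] by blast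
qed

text \<open>Multiplication by \<open>t\<close> raises the degree by one and keeps the leading
  coefficient.\<close>

lemma lead_mono_right: 
  assumes "submod N A" "\<And>a. a \<in> J \<Longrightarrow> \<rho> t a \<in> J" "m \<le> n"
  shows "lead A J m \<subseteq> lead A J n"
  using assms(3)
proof (rule lift_Suc_mono_le[rotated])
  show "lead A J n \<subseteq> lead A J (Suc n)" for n
  proof
    fix a assume "a \<in> lead A J n"
    then obtain u where *: "a \<in> A" "u \<in> filt A n" "tpow t (Suc n) a + u \<in> J"
      unfolding lead_def by blast
    have "tpow t (Suc (Suc n)) a + \<rho> t u = \<rho> t (tpow t (Suc n) a + u)"
      using t by (simp add: act_add)
    also have "\<dots> \<in> J" using * assms by blast
    finally show "a \<in> lead A J (Suc n)"
      unfolding lead_def using * filt_shift[OF assms(1)] by blast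
  qed
qed

lemma lead_mono_left: "J \<subseteq> J' \<Longrightarrow> lead A J n \<subseteq> lead A J' n"
  unfolding lead_def by blast

text \<open>The argument of Hilbert's basis theorem for a skew Laurent extension, with leading
  coefficients taken along the powers of \<open>t\<close>.\<close>

lemma noeth_generate_insert:
  assumes A: "submod N A" "noeth N A" and F: "F \<subseteq> A"
  shows "noeth (generate G (insert t N)) (span (generate G (insert t N)) F)"
proof (rule noethI)
  let ?N' = "generate G (insert t N)"
  fix J :: "nat \<Rightarrow> 'm set"
  assume J: "\<And>i. submod ?N' (J i)" "\<And>i. J i \<subseteq> span ?N' F" "\<And>i j. i \<le> j \<Longrightarrow> J i \<subseteq> J j"
  have sub: "N \<subseteq> ?N'" "t \<in> ?N'" "inv t \<in> ?N'" by (auto intro: generate.intros)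
  note JN = submod_mono[OF sub(1) J(1)]
  have Jt: "\<rho> t a \<in> J i" if "a \<in> J i" for a i using that submodD(5)[OF J(1)] sub by blast
  have Jt': "\<rho> (inv t) a \<in> J i" if "a \<in> J i" for a i using that submodD(5)[OF J(1)] sub by blast
  define L where "L i n = lead A (J i) n" for i n
  have L_mono: "L i n \<subseteq> L i' n'" if "i \<le> i'" "n \<le> n'" for i i' n n'
    using lead_mono_left[OF J(3)[OF that(1)]] lead_mono_right[OF A(1) Jt that(2)] unfolding L_def by blast
  have "submod N (L i i)" "L i i \<subseteq> A" "L i i \<subseteq> L (Suc i) (Suc i)" for i
    using L_mono[of i "Suc i" i "Suc i"] lead_submod[OF A(1) JN] by (auto simp: L_def lead_def)
  then obtain n0 where n0: "\<And>i. i \<ge> n0 \<Longrightarrow> L i i = L n0 n0"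
    using noethD[OF A(2), of "\<lambda>i. L i i"] by metis
  \<comment> \<open>\<open>L\<close> is monotone in both indices, so constancy along the diagonal
    from \<open>n0\<close> on forces constancy on the whole quadrant.\<close>
  have L_eq: "L i n = L n0 n0" if "i \<ge> n0" "n \<ge> n0" for i n
    using L_mono[of n0 i n0 n] L_mono[of i "max i n" n "max i n"] n0[of "max i n"] that by auto
  have "submod N (J i \<inter> filt A n0)" "J i \<inter> filt A n0 \<subseteq> filt A n0"
    "J i \<inter> filt A n0 \<subseteq> J (Suc i) \<inter> filt A n0" for i
    using J(3)[of i "Suc i"] submod_Int[OF JN filt_submod[OF A(1)]] by auto
  then obtain n2 where n2: "\<And>i. i \<ge> n2 \<Longrightarrow> J i \<inter> filt A n0 = J n2 \<inter> filt A n0"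
    using noethD[OF filt_noeth[OF A], of "\<lambda>i. J i \<inter> filt A n0"] by metis
  \<comment> \<open>From \<open>n1\<close> on, the leading coefficients in degrees above
    \<open>n0\<close> are constant, and so are the elements of degree at most
    \<open>n0\<close>.\<close>
  define n1 where "n1 = max n0 n2"
  have filt_case: "x \<in> J n1" if "x \<in> J i" "x \<in> filt A n" "i \<ge> n1" for x i n
    using that
  proof (induction n arbitrary: x)
    case 0
    then have "x \<in> filt A n0" using filt_mono[OF A(1), of 0 n0] by blast
    then show ?case using n2[of i] n2[of n1] 0 unfolding n1_def by auto
  next
    case (Suc n)
    show ?case
    proof (cases "Suc n \<le> n0")
      case True
      then have "x \<in> filt A n0" using filt_mono[OF A(1), of "Suc n" n0] Suc.prems by blast
      then show ?thesis using n2[of i] n2[of n1] Suc.prems unfolding n1_def by auto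
    next
      case False
      from Suc.prems(2) obtain u a where u: "x = tpow t (Suc n) a + u" "u \<in> filt A n" "a \<in> A"
        unfolding filt.simps sumset_def by (auto simp: add.commute)
      then have "a \<in> L i n" unfolding L_def lead_def using Suc.prems by blast
      then have "a \<in> L n1 n" using L_eq[of i n] L_eq[of n1 n] Suc.prems False unfolding n1_def by auto
      then obtain v where v: "v \<in> filt A n" "tpow t (Suc n) a + v \<in> J n1"
        unfolding L_def lead_def by blast
      \<comment> \<open>Both elements have leading term \<open>tpow t (Suc n) a\<close>, so the
        difference drops to degree at most n and the induction hypothesis applies.\<close>
      have "x - (tpow t (Suc n) a + v) \<in> J i"
        using v J(3)[OF Suc.prems(3)] Suc.prems submodD(4)[OF JN] by blast
      moreover have "x - (tpow t (Suc n) a + v) = u - v" using u by (simp add: algebra_simps)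
      moreover have "u - v \<in> filt A n" using u v submodD(4)[OF filt_submod[OF A(1)]] by blast
      ultimately have "u - v \<in> J n1" using Suc.IH[of "u - v"] Suc.prems(3) by metis
      then have "(u - v) + (tpow t (Suc n) a + v) \<in> J n1" using v submodD(2)[OF JN] by blast
      then show ?thesis using u by (simp add: algebra_simps)
    qed
  qed
  \<comment> \<open>The elements that some power of \<open>t\<close> carries into a
    \<open>filt A n\<close>, as a Laurent polynomial becomes a polynomial once negative powers are
    cleared. Since \<open>T\<close> is also stable under the inverse of \<open>t\<close>, it
    contains the whole span.\<close>
  define T where "T = {m. \<exists>k n. tpow t k m \<in> filt A n}"
  have tpow_filt: "tpow t k a \<in> filt A (n + k)" if "a \<in> filt A n" for k n a
    using that by (induction k) (auto intro: filt_shift[OF A(1)] simp del: filt.simps)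
  have "submod (insert t N) T"
  proof (rule submodI)
    show "0 \<in> T" unfolding T_def using submodD(1)[OF A(1)] by (auto intro!: exI[of _ 0])
  next
    fix a b assume "a \<in> T" "b \<in> T"
    then obtain k n l m where "tpow t k a \<in> filt A n" "tpow t l b \<in> filt A m"
      unfolding T_def by blast
    then have "tpow t (k + l) a \<in> filt A (n + l)" "tpow t (k + l) b \<in> filt A (m + k)"
      using tpow_filt[of "tpow t k a" n l] tpow_filt[of "tpow t l b" m k]
      by (simp_all add: tpow_compose add.commute)
    then have "tpow t (k + l) (a + b) \<in> filt A (max (n + l) (m + k))"
      unfolding tpow_add
      using filt_mono[OF A(1), of _ "max (n + l) (m + k)"] submodD(2)[OF filt_submod[OF A(1)]]
      by (meson max.cobounded1 max.cobounded2 subsetD)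
    then show "a + b \<in> T" unfolding T_def by blast
  next
    fix a assume "a \<in> T"
    then show "- a \<in> T" unfolding T_def
      using submodD(3)[OF filt_submod[OF A(1)]] by (auto simp: tpow_minus)
  next
    fix g a assume g: "g \<in> insert t N" and "a \<in> T"
    then obtain k n where kn: "tpow t k a \<in> filt A n" unfolding T_def by blast
    show "\<rho> g a \<in> T"
    proof (cases "g = t")
      case True
      have "tpow t k (\<rho> t a) \<in> filt A (Suc n)"
        unfolding tpow_shift by (rule filt_shift[OF A(1) kn])
      then show ?thesis unfolding T_def True by blast
    next
      case False
      with g have "g \<in> N" by simp
      then obtain g' where "g' \<in> N" "tpow t k (\<rho> g a) = \<rho> g' (tpow t k a)"
        using tpow_twist_in by blast
      then have "tpow t k (\<rho> g a) \<in> filt A n" using kn submodD(5)[OF filt_submod[OF A(1)]] by metis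
      then show ?thesis unfolding T_def by blast
    qed
  qed
  moreover have "\<rho> (inv g) a \<in> T" if g: "g \<in> insert t N" and a: "a \<in> T" for g a
  proof (cases "g = t")
    case True
    from a obtain k n where kn: "tpow t k a \<in> filt A n" unfolding T_def by blast
    have "tpow t (Suc k) (\<rho> (inv t) a) = tpow t k a"
      using t by (simp flip: tpow_shift)
    then show ?thesis unfolding T_def True using kn by (metis (mono_tags) mem_Collect_eq)
  next
    case False
    then have "inv g \<in> N" using g N by (simp add: normal_imp_subgroup subgroup.m_inv_closed)
    then show ?thesis using submodD(5)[OF \<open>submod (insert t N) T\<close>] a by blast
  qed
  ultimately have "submod ?N' T"
    using t N_carrier by (intro submod_generate) auto
  moreover have "F \<subseteq> T"
    unfolding T_def using F by (auto intro!: exI[of _ 0])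
  ultimately have span_T: "span ?N' F \<subseteq> T" by (rule span_minimal)
  have "J i \<subseteq> J n1" if i: "i \<ge> n1" for i
  proof
    fix x assume x: "x \<in> J i"
    then obtain k n where kn: "tpow t k x \<in> filt A n" using J(2) span_T unfolding T_def by blast
    \<comment> \<open>Compare after clearing negative powers, then return to \<open>x\<close> by
      applying the inverse of \<open>t\<close> k times.\<close>
    have "tpow t k x \<in> J i" using x Jt by (induction k) auto
    then have "tpow t k x \<in> J n1" using filt_case kn i by blast
    then show "x \<in> J n1"
    proof (induction k)
      case (Suc k)
      then show ?case using Jt'[of "\<rho> t (tpow t k x)" n1] t by auto
    qed simp
  qed
  then show "\<exists>n. \<forall>i\<ge>n. J i = J n" using J(3) by (intro exI[of _ n1]) blast
qed

end

end

section \<open>Natural multiples and finitely generated abelian groups\<close>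

definition nmult :: "nat \<Rightarrow> 'a \<Rightarrow> 'a::ab_group_add" where
  "nmult n m = ((+) m ^^ n) 0"

lemma nmult_simps [simp]: "nmult 0 m = 0" "nmult (Suc n) m = m + nmult n m"
  by (simp_all add: nmult_def)

lemma nmult_add: "nmult (a + b) m = nmult a m + nmult b m"
  by (induction a) (auto simp: add.assoc)

lemma nmult_diff: "b \<le> a \<Longrightarrow> nmult (a - b) m = nmult a m - nmult b m"
  using nmult_add[of "a - b" b m] by (simp add: algebra_simps)

lemma nmult_nmult: "nmult a (nmult b m) = nmult (a * b) m"
  by (induction a) (auto simp: nmult_add)

lemma nmult_torsion:
  assumes "finite S" "\<And>n. nmult n x \<in> S"
  obtains n where "n > 0" "nmult n x = 0"
proof -
  have "\<not> inj (\<lambda>n. nmult n x)"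
    using assms range_inj_infinite finite_subset by (metis image_subsetI)
  then obtain i j where "nmult i x = nmult j x" "i < j"
    unfolding inj_def by (metis linorder_neqE_nat)
  then show ?thesis using that[of "j - i"] nmult_diff[of i j x] by simp
qed

context group_module
begin

lemma nmult_mem: "submod N J \<Longrightarrow> m \<in> J \<Longrightarrow> nmult n m \<in> J"
  by (induction n) (auto intro: submodD)

lemma span_one_singleton: "span {\<one>} {m} \<subseteq> {nmult n m | n. True} \<union> {- nmult n m | n. True}"
proof (rule span_minimal)
  let ?S = "{nmult n m | n. True} \<union> {- nmult n m | n. True}"
  have diff: "nmult a m - nmult b m \<in> ?S" for a b
  proof (cases "b \<le> a")
    case True
    then show ?thesis using nmult_diff[OF True, of m] by (metis (mono_tags, lifting) UnI1 mem_Collect_eq)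
  next
    case False
    then have "nmult a m - nmult b m = - nmult (b - a) m" by (simp add: nmult_diff)
    then show ?thesis by blast
  qed
  show "submod {\<one>} ?S"
  proof (rule submodI)
    show "0 \<in> ?S" using nmult_simps(1) by (metis (mono_tags, lifting) UnI1 mem_Collect_eq)
    fix a assume a: "a \<in> ?S"
    then show "- a \<in> ?S" by auto
    fix b assume b: "b \<in> ?S"
    from a b consider (pp) p q where "a = nmult p m" "b = nmult q m"
      | (pn) p q where "a = nmult p m" "b = - nmult q m"
      | (np) p q where "a = - nmult p m" "b = nmult q m"
      | (nn) p q where "a = - nmult p m" "b = - nmult q m"
      by blast
    then show "a + b \<in> ?S"
    proof cases
      case pp
      then have "a + b = nmult (p + q) m" by (simp add: nmult_add)
      then show ?thesis by blast
    next
      case pn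
      then show ?thesis using diff[of p q] by simp
    next
      case np
      then show ?thesis using diff[of q p] by simp
    next
      case nn
      then have "a + b = - nmult (p + q) m" by (simp add: nmult_add)
      then show ?thesis by blast
    qed
  qed auto
  have "m = nmult (Suc 0) m" by simp
  then show "{m} \<subseteq> ?S" by blast
qed

text \<open>\<open>J i\<close> is determined by the set \<open>S i\<close> of natural multiples of
  \<open>m\<close> that it contains. Once some d > 0 lies in \<open>S k\<close>, every later
  \<open>S i\<close> is a union of residue classes modulo d, and only finitely many residues can
  still enter.\<close>

lemma noeth_one_singleton: "noeth {\<one>} (span {\<one>} {m})"
proof (rule noethI)
  fix J :: "nat \<Rightarrow> 'm set"
  assume J: "\<And>i. submod {\<one>} (J i)" "\<And>i. J i \<subseteq> span {\<one>} {m}" "\<And>i j. i \<le> j \<Longrightarrow> J i \<subseteq> J j"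
  define S where "S i = {n. nmult n m \<in> J i}" for i
  have J_le: "J i \<subseteq> J j" if "S i \<subseteq> S j" for i j
  proof
    fix x assume x: "x \<in> J i"
    then obtain n where "x = nmult n m \<or> x = - nmult n m" using J(2) span_one_singleton by blast
    moreover from this have "n \<in> S i"
      unfolding S_def using x submodD(3)[OF J(1), of x i] by auto
    ultimately show "x \<in> J j" using that submodD(3)[OF J(1)] unfolding S_def by blast
  qed
  have S_mono: "S i \<subseteq> S j" if "i \<le> j" for i j
    using J(3)[OF that] unfolding S_def by blast
  show "\<exists>n. \<forall>i\<ge>n. J i = J n"
  proof (cases "\<forall>i. S i \<subseteq> {0}")
    case True
    have "J i \<subseteq> J 0" for i
    proof (rule J_le, rule subsetI)
      fix n assume "n \<in> S i"
      then have "n = 0" using True by blast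
      then show "n \<in> S 0" unfolding S_def using submodD(1)[OF J(1)] by simp
    qed
    then show ?thesis using J(3)[of 0] by (intro exI[of _ 0]) blast
  next
    case False
    then obtain k d where d: "d \<in> S k" "d > 0" by auto
    have mod: "n \<in> S i \<longleftrightarrow> n mod d \<in> S i" if "i \<ge> k" for n i
    proof -
      have "d \<in> S i" using S_mono[OF that] d by blast
      then have q: "nmult ((n div d) * d) m \<in> J i"
        unfolding S_def nmult_nmult[symmetric] using nmult_mem[OF J(1)] by blast
      have "nmult n m = nmult ((n div d) * d) m + nmult (n mod d) m"
        by (simp flip: nmult_add)
      then have eq: "nmult n m - nmult ((n div d) * d) m = nmult (n mod d) m"
        "nmult n m = nmult ((n div d) * d) m + nmult (n mod d) m"
        by auto
      show ?thesis
        unfolding S_def mem_Collect_eq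
        using submodD(2)[OF J(1) q, of "nmult (n mod d) m"] submodD(4)[OF J(1) _ q, of "nmult n m"] eq
        by metis
    qed
    define U where "U = (\<Union>i. S i) \<inter> {..<d}"
    have "\<forall>n\<in>U. \<exists>i. n \<in> S i" unfolding U_def by blast
    then obtain h where h: "\<And>n. n \<in> U \<Longrightarrow> n \<in> S (h n)" by metis
    \<comment> \<open>By index \<open>l\<close> every residue below d that ever occurs has
      occurred.\<close>
    define l where "l = Max (insert k (h ` U))"
    have fin: "finite (insert k (h ` U))" unfolding U_def by simp
    have "k \<le> l" unfolding l_def using fin by simp
    have "J i \<subseteq> J l" if "i \<ge> l" for i
    proof (rule J_le, rule subsetI)
      fix n assume "n \<in> S i"
      then have "n mod d \<in> S i" using mod[of i n] that \<open>k \<le> l\<close> by simp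
      then have U: "n mod d \<in> U" unfolding U_def using d by auto
      then have "h (n mod d) \<le> l" unfolding l_def using fin by simp
      then have "n mod d \<in> S l" using h[OF U] S_mono by blast
      then show "n \<in> S l" using mod[OF \<open>k \<le> l\<close>] by simp
    qed
    then show ?thesis using J(3) by (intro exI[of _ l]) blast
  qed
qed

lemma noeth_one_span:
  assumes "finite F"
  shows "noeth {\<one>} (span {\<one>} F)"
  using assms
proof (induction F)
  case empty
  have "submod {\<one>} {0}" by (rule submodI) auto
  then have "span {\<one>} {} \<subseteq> {0}" by (rule span_minimal) simp
  then have *: "J = {0}" if "submod {\<one>} J" "J \<subseteq> span {\<one>} {}" for J
    using that submodD(1) by blast
  then show ?case unfolding noeth_def by metis
next
  case (insert m F)
  have c: "{\<one>} \<subseteq> carrier G" by simp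
  note sub = span_submod[of "{\<one>}" "{m}"] span_submod[of "{\<one>}" F]
  have "insert m F \<subseteq> sumset (span {\<one>} {m}) (span {\<one>} F)"
    using sumset_superset[OF sub] span_superset[of "{m}" "{\<one>}"] span_superset[of F "{\<one>}"] by blast
  then have "span {\<one>} (insert m F) \<subseteq> sumset (span {\<one>} {m}) (span {\<one>} F)"
    by (intro span_minimal sumset_submod sub c)
  then show ?case
    using noeth_sumset[OF noeth_one_singleton insert.IH sub c] noeth_subset by blast
qed

text \<open>Hall's theorem on group rings of polycyclic groups, for the chains at hand: the span
  over the previous step is the coefficient module \<open>A\<close> of the basis theorem.\<close>

lemma noeth_polycentral_span:
  assumes "polycentral G N" "finite F"
  shows "noeth N (span N F)"
  using assms(1)
proof (induction rule: polycentral.induct)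
  case polycentral_one
  show ?case by (rule noeth_one_span[OF assms(2)])
next
  case (polycentral_insert N t)
  show ?case
    using polycentral_insert
    by (intro noeth_generate_insert[OF polycentral_normal _ span_submod _ span_superset])
qed

subsection \<open>Elements with finite orbit\<close>

text \<open>Finiteness of the image of \<open>A\<close> in the quotient by \<open>J\<close>.
  Representatives may lie outside \<open>A\<close>, so the notion passes to subsets at once.\<close>

definition finite_mod :: "'m set \<Rightarrow> 'm set \<Rightarrow> bool" where
  "finite_mod A J \<longleftrightarrow> (\<exists>R. finite R \<and> (\<forall>a\<in>A. \<exists>r\<in>R. a - r \<in> J))"

lemma finite_mod_subset: "finite_mod A J \<Longrightarrow> B \<subseteq> A \<Longrightarrow> finite_mod B J"
  unfolding finite_mod_def by blast

text \<open>The class modulo \<open>J\<close> of a partner of b determines the class of b modulo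
  \<open>J'\<close>, so there are at most as many classes of the second kind. A relation in place of
  a map allows partners under a non-injective endomorphism.\<close>

lemma finite_mod_rel:
  assumes "finite_mod A J" "submod N J"
    and ex: "\<And>b. b \<in> B \<Longrightarrow> \<exists>a\<in>A. P a b"
    and cong: "\<And>a b a' b'. b \<in> B \<Longrightarrow> b' \<in> B \<Longrightarrow> P a b \<Longrightarrow> P a' b' \<Longrightarrow> a - a' \<in> J \<Longrightarrow> b - b' \<in> J'"
  shows "finite_mod B J'"
proof -
  obtain R where R: "finite R" "\<And>a. a \<in> A \<Longrightarrow> \<exists>r\<in>R. a - r \<in> J"
    using assms(1) unfolding finite_mod_def by blast
  define Q where "Q r b \<longleftrightarrow> b \<in> B \<and> (\<exists>a. P a b \<and> a - r \<in> J)" for r b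
  define s where "s r = (SOME b. Q r b)" for r
  have "\<exists>r\<in>s ` R. b - r \<in> J'" if b: "b \<in> B" for b
  proof -
    obtain a where a: "a \<in> A" "P a b" using ex[OF b] by blast
    obtain r where r: "r \<in> R" "a - r \<in> J" using R(2)[OF a(1)] by blast
    have "Q r b" unfolding Q_def using a r b by blast
    then have "Q r (s r)" unfolding s_def by (rule someI)
    then obtain a' where a': "s r \<in> B" "P a' (s r)" "a' - r \<in> J" unfolding Q_def by blast
    have "a - a' \<in> J"
      using submod_diff_trans[OF assms(2) r(2)] a'(3) submod_diff_commute[OF assms(2)] by blast
    then have "b - s r \<in> J'" using cong[OF b a'(1) a(2) a'(2)] by blast
    then show ?thesis using r by blast
  qed
  then show ?thesis unfolding finite_mod_def using R(1) by blast
qed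

lemma finite_mod_representatives:
  assumes "finite_mod A J" "submod N J"
  obtains R where "finite R" "R \<subseteq> A" "\<And>a. a \<in> A \<Longrightarrow> \<exists>r\<in>R. a - r \<in> J"
proof -
  obtain R where R: "finite R" "\<And>a. a \<in> A \<Longrightarrow> \<exists>r\<in>R. a - r \<in> J"
    using assms(1) unfolding finite_mod_def by blast
  define s where "s r = (SOME b. b \<in> A \<and> b - r \<in> J)" for r
  have s: "s r \<in> A \<and> s r - r \<in> J" if "a \<in> A" "a - r \<in> J" for a r
    unfolding s_def by (rule someI[of _ a]) (use that in blast)
  define R' where "R' = s ` {r \<in> R. \<exists>a\<in>A. a - r \<in> J}"
  have "\<exists>r\<in>R'. a - r \<in> J" if a: "a \<in> A" for a
  proof -
    obtain r where r: "r \<in> R" "a - r \<in> J" using R(2)[OF a] by blast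
    have "a - s r \<in> J"
      using submod_diff_trans[OF assms(2) r(2)] s[OF a r(2)] submod_diff_commute[OF assms(2)] by blast
    then show ?thesis unfolding R'_def using a r by blast
  qed
  moreover have "R' \<subseteq> A" unfolding R'_def using s by blast
  ultimately show ?thesis using that[of R'] R(1) unfolding R'_def by simp
qed

definition orbit_of :: "'m \<Rightarrow> 'm set" where
  "orbit_of m = (\<lambda>g. \<rho> g m) ` carrier G"

text \<open>The elements of \<open>M\<close> whose image in M / J has a finite orbit; for
  \<open>J = {0}\<close> these are the elements with a finite orbit.\<close>

definition finite_orbits :: "'m set \<Rightarrow> 'm set \<Rightarrow> 'm set" where
  "finite_orbits M J = {m \<in> M. finite_mod (orbit_of m) J}"

lemma submod_finite_orbits:
  assumes "submod (carrier G) M" "submod (carrier G) J"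
  shows "submod (carrier G) (finite_orbits M J)"
proof (rule submodI)
  have "finite_mod (orbit_of 0) J"
    unfolding finite_mod_def orbit_of_def using submodD(1)[OF assms(2)] by (intro exI[of _ "{0}"]) auto
  then show "0 \<in> finite_orbits M J"
    unfolding finite_orbits_def using submodD(1)[OF assms(1)] by blast
next
  fix a b assume "a \<in> finite_orbits M J" "b \<in> finite_orbits M J"
  then obtain R S where *: "a \<in> M" "b \<in> M" "finite R" "finite S"
      "\<And>g. g \<in> carrier G \<Longrightarrow> \<exists>r\<in>R. \<rho> g a - r \<in> J" "\<And>g. g \<in> carrier G \<Longrightarrow> \<exists>r\<in>S. \<rho> g b - r \<in> J"
    unfolding finite_orbits_def finite_mod_def orbit_of_def by blast
  have "\<exists>r\<in>(\<lambda>(r, s). r + s) ` (R \<times> S). \<rho> g (a + b) - r \<in> J" if g: "g \<in> carrier G" for g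
  proof -
    obtain r s where rs: "r \<in> R" "s \<in> S" "\<rho> g a - r \<in> J" "\<rho> g b - s \<in> J" using * g by blast
    have "\<rho> g (a + b) - (r + s) = (\<rho> g a - r) + (\<rho> g b - s)" using g by (simp add: act_add algebra_simps)
    also have "\<dots> \<in> J" using rs submodD(2)[OF assms(2)] by blast
    finally show ?thesis using rs by force
  qed
  then have "finite_mod (orbit_of (a + b)) J"
    unfolding finite_mod_def orbit_of_def using *(3,4) 
    by (intro exI[of _ "(\<lambda>(r, s). r + s) ` (R \<times> S)"]) blast
  then show "a + b \<in> finite_orbits M J"
    unfolding finite_orbits_def using * submodD(2)[OF assms(1)] by blast
next
  fix a assume a: "a \<in> finite_orbits M J"
  then have "finite_mod (orbit_of a) J" unfolding finite_orbits_def by blast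
  then have "finite_mod (orbit_of (- a)) J"
  proof (rule finite_mod_rel[OF _ assms(2), where P = "\<lambda>x y. y = - x"])
    show "\<exists>x\<in>orbit_of a. b = - x" if "b \<in> orbit_of (- a)" for b
      using that unfolding orbit_of_def by (auto simp: act_minus)
    show "b - b' \<in> J" if "b = - x" "b' = - x'" "x - x' \<in> J" for b b' x x'
      using that submod_diff_commute[OF assms(2), of x x'] by simp
  qed
  then show "- a \<in> finite_orbits M J"
    using a submodD(3)[OF assms(1)] unfolding finite_orbits_def by blast
next
  fix g a assume g: "g \<in> carrier G" and a: "a \<in> finite_orbits M J"
  have "orbit_of (\<rho> g a) \<subseteq> orbit_of a"
    unfolding orbit_of_def using g by (auto simp flip: act_mult)
  then show "\<rho> g a \<in> finite_orbits M J"
    using g a submodD(5)[OF assms(1)] finite_mod_subset unfolding finite_orbits_def by blast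
qed

lemma finite_orbits_superset:
  assumes "submod (carrier G) J" "J \<subseteq> M"
  shows "J \<subseteq> finite_orbits M J"
proof
  fix a assume a: "a \<in> J"
  have "finite_mod (orbit_of a) J"
    unfolding finite_mod_def orbit_of_def using a submodD(5)[OF assms(1)]
    by (intro exI[of _ "{0}"]) auto
  then show "a \<in> finite_orbits M J" unfolding finite_orbits_def using a assms by blast
qed

lemma noeth_maximal:
  assumes "noeth N M" "P J0" "\<And>J. P J \<Longrightarrow> submod N J \<and> J \<subseteq> M"
  shows "\<exists>J. P J \<and> (\<forall>J'. P J' \<longrightarrow> J \<subseteq> J' \<longrightarrow> J' = J)"
proof (rule ccontr)
  assume "\<not> ?thesis"
  then have step: "\<exists>J'. P J' \<and> J \<subset> J'" if "P J" for J
    using that by blast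
  obtain s where s: "\<And>J. P J \<Longrightarrow> P (s J) \<and> J \<subset> s J"
    using step by metis
  define f where "f i = (s ^^ i) J0" for i
  have P: "P (f i)" for i
  proof (induction i)
    case (Suc i)
    then show ?case using s[OF Suc] by (simp add: f_def)
  qed (simp add: f_def assms(2))
  have f: "f i \<subset> f (Suc i)" for i using s[OF P[of i]] unfolding f_def by simp
  have "submod N (f i) \<and> f i \<subseteq> M \<and> f i \<subseteq> f (Suc i)" for i
    using assms(3)[OF P[of i]] f[of i] by (simp add: psubset_imp_subset)
  then obtain n where n: "\<And>i. i \<ge> n \<Longrightarrow> f i = f n"
    using noethD[OF assms(1), of f] by metis
  have "f (Suc n) = f n" by (rule n) simp
  then show False using f[of n] by simp
qed

text \<open>Let \<open>f\<close> be an endomorphism of \<open>M / J\<close>. The kernels \<open>K i\<close> of its powers stabilise, hence some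
  \<open>f\<^sup>i M\<close> contains infinitely many elements of finite orbit but \<open>f\<^sup>i\<^sup>+\<^sup>1 M\<close> only finitely many. Now
  \<open>f\<^sup>i M / f\<^sup>i\<^sup>+\<^sup>1 M\<close> is a quotient of \<open>M / (f M + J)\<close>, so maximality of \<open>J\<close> forces \<open>f M \<subseteq> J\<close>.\<close>

lemma endomorphism_trivial_on_maximal:
  assumes M: "submod (carrier G) M" "noeth (carrier G) M" and J: "submod (carrier G) J" "J \<subseteq> M"
    and inf: "\<not> finite_mod (finite_orbits M J) J"
    and max: "\<And>J'. submod (carrier G) J' \<Longrightarrow> J' \<subseteq> M \<Longrightarrow> J \<subseteq> J' \<Longrightarrow>
      \<not> finite_mod (finite_orbits M J') J' \<Longrightarrow> J' = J"
    and f_add: "\<And>a b. f (a + b) = f a + f b"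
    and f_M: "\<And>a. a \<in> M \<Longrightarrow> f a \<in> M" and f_J: "\<And>a. a \<in> J \<Longrightarrow> f a \<in> J"
    and f_comm: "\<And>g a. g \<in> carrier G \<Longrightarrow> a \<in> M \<Longrightarrow> f (\<rho> g a) - \<rho> g (f a) \<in> J"
    and f_kills: "\<And>a. a \<in> finite_orbits M J \<Longrightarrow> f a \<in> J"
    and m: "m \<in> M"
  shows "f m \<in> J"
proof -
  note JD = submodD[OF J(1)] and MD = submodD[OF M(1)]
  have f_zero: "f 0 = 0" using f_add[of 0 0] by simp
  have f_minus: "f (- a) = - f a" for a
    using f_add[of a "- a"] f_zero by (simp add: eq_neg_iff_add_eq_0 add.commute)
  have F_add: "(f ^^ i) (a + b) = (f ^^ i) a + (f ^^ i) b" for i a b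
    by (induction i) (auto simp: f_add)
  have F_zero: "(f ^^ i) 0 = 0" for i by (induction i) (auto simp: f_zero)
  have F_minus: "(f ^^ i) (- a) = - (f ^^ i) a" for i a
    by (induction i) (auto simp: f_minus)
  have F_diff: "(f ^^ i) (a - b) = (f ^^ i) a - (f ^^ i) b" for i a b
    using F_add[of i a "- b"] by (simp add: F_minus)
  have F_M: "(f ^^ i) a \<in> M" if "a \<in> M" for i a using that by (induction i) (auto intro: f_M)
  have F_J: "(f ^^ i) a \<in> J" if "a \<in> J" for i a using that by (induction i) (auto intro: f_J)
  have F_comm: "(f ^^ i) (\<rho> g a) - \<rho> g ((f ^^ i) a) \<in> J" if g: "g \<in> carrier G" and a: "a \<in> M" for i g a
  proof (induction i)
    case 0
    then show ?case using JD(1) by simp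
  next
    case (Suc i)
    have "f ((f ^^ i) (\<rho> g a) - \<rho> g ((f ^^ i) a)) \<in> J" by (rule f_J[OF Suc])
    then have "f ((f ^^ i) (\<rho> g a)) - f (\<rho> g ((f ^^ i) a)) \<in> J"
      using F_diff[of 1] by simp
    then show ?case
      using submod_diff_trans[OF J(1) _ f_comm[OF g F_M[OF a]]] by simp
  qed
  define K where "K i = {a \<in> M. (f ^^ i) a \<in> J}" for i
  have "submod (carrier G) (K i)" for i
  proof (rule submodI)
    fix g a assume g: "g \<in> carrier G" and a: "a \<in> K i"
    then have "\<rho> g ((f ^^ i) a) \<in> J" unfolding K_def using JD(5) by blast
    then have "((f ^^ i) (\<rho> g a) - \<rho> g ((f ^^ i) a)) + \<rho> g ((f ^^ i) a) \<in> J"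
      using F_comm[OF g, of a i] a JD(2) unfolding K_def by blast
    then show "\<rho> g a \<in> K i" using g a MD(5) unfolding K_def by auto
  qed (use JD MD F_add F_minus F_J[of 0] in \<open>auto simp: K_def\<close>)
  moreover have "K i \<subseteq> M" "K i \<subseteq> K (Suc i)" for i unfolding K_def using f_J by auto
  ultimately obtain n where n: "\<And>i. i \<ge> n \<Longrightarrow> K i = K n"
    using noethD[OF M(2), of K] by metis
  define D where "D i = finite_orbits M J \<inter> (f ^^ i) ` M" for i
  have "D 0 = finite_orbits M J" unfolding D_def finite_orbits_def by auto
  then have D0: "\<not> finite_mod (D 0) J" using inf by simp
  \<comment> \<open>If b = f^(n+1) a has finite orbit, then \<open>f b\<close> lies in
    \<open>J\<close>, so a lies in \<open>K (n + 2)\<close>. This equals \<open>K (n + 1)\<close>,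
    and b is already in \<open>J\<close>.\<close>
  have "D (Suc n) \<subseteq> J"
  proof
    fix b assume b: "b \<in> D (Suc n)"
    then obtain a where a: "a \<in> M" "b = (f ^^ Suc n) a" unfolding D_def by blast
    have "f b \<in> J" using b f_kills unfolding D_def by blast
    then have "a \<in> K (Suc (Suc n))" unfolding K_def using a by simp
    then have "a \<in> K (Suc n)" using n[of "Suc n"] n[of "Suc (Suc n)"] by simp
    then show "b \<in> J" unfolding K_def using a by simp
  qed
  then have "finite_mod (D (Suc n)) J"
    unfolding finite_mod_def by (intro exI[of _ "{0}"]) auto
  then obtain i where i: "\<not> finite_mod (D i) J" "finite_mod (D (Suc i)) J"
    using D0 nat_induct[of "\<lambda>i. \<not> finite_mod (D i) J" "Suc n"] by blast
  \<comment> \<open>The preimage of f^(i+1) M + J under f^i. Hence f^i embeds M / J' into the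
    quotient by f^(i+1) M + J, and \<open>J'\<close> contains f M by construction.\<close>
  define J' where "J' = {a \<in> M. \<exists>c\<in>M. (f ^^ i) a - (f ^^ Suc i) c \<in> J}"
  have J': "submod (carrier G) J'"
  proof (rule submodI)
    have "(f ^^ i) 0 - (f ^^ Suc i) 0 \<in> J" by (rule JD(4)[OF F_J F_J]) (rule JD(1))+
    then show "0 \<in> J'" unfolding J'_def using MD(1) by blast
  next
    fix a b assume "a \<in> J'" "b \<in> J'"
    then obtain c d where *: "a \<in> M" "b \<in> M" "c \<in> M" "d \<in> M"
      "(f ^^ i) a - (f ^^ Suc i) c \<in> J" "(f ^^ i) b - (f ^^ Suc i) d \<in> J" unfolding J'_def by blast
    have "(f ^^ i) (a + b) - (f ^^ Suc i) (c + d)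
        = ((f ^^ i) a - (f ^^ Suc i) c) + ((f ^^ i) b - (f ^^ Suc i) d)"
      unfolding F_add by (simp add: algebra_simps)
    also have "\<dots> \<in> J" using * JD(2) by blast
    finally show "a + b \<in> J'" unfolding J'_def using * MD(2) by blast
  next
    fix a assume "a \<in> J'"
    then obtain c where *: "a \<in> M" "c \<in> M" "(f ^^ i) a - (f ^^ Suc i) c \<in> J" unfolding J'_def by blast
    have "(f ^^ i) (- a) - (f ^^ Suc i) (- c) = - ((f ^^ i) a - (f ^^ Suc i) c)"
      unfolding F_minus by (simp add: algebra_simps)
    also have "\<dots> \<in> J" using * JD(3) by blast
    finally show "- a \<in> J'" unfolding J'_def using * MD(3) by blast
  next
    fix g a assume g: "g \<in> carrier G" and "a \<in> J'"
    then obtain c where *: "a \<in> M" "c \<in> M" "(f ^^ i) a - (f ^^ Suc i) c \<in> J" unfolding J'_def by blast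
    have "(f ^^ i) (\<rho> g a) - (f ^^ Suc i) (\<rho> g c)
      = (((f ^^ i) (\<rho> g a) - \<rho> g ((f ^^ i) a)) - ((f ^^ Suc i) (\<rho> g c) - \<rho> g ((f ^^ Suc i) c)))
        + \<rho> g ((f ^^ i) a - (f ^^ Suc i) c)"
      using g by (simp add: act_diff)
    also have "\<dots> \<in> J"
      by (rule JD(2)[OF JD(4)[OF F_comm[OF g *(1)] F_comm[OF g *(2)]] JD(5)[OF g *(3)]])
    finally show "\<rho> g a \<in> J'" unfolding J'_def using * MD(5)[OF g] by blast
  qed
  have "J \<subseteq> J'"
  proof
    fix a assume a: "a \<in> J"
    then have "(f ^^ i) a - (f ^^ Suc i) 0 \<in> J" using F_J[of a i] F_minus[of "Suc i" 0] JD(1)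
      by (metis JD(4) F_J)
    then show "a \<in> J'" unfolding J'_def using a J MD(1) by blast
  qed
  have "J' \<subseteq> M" unfolding J'_def by blast
  note FO = submodD[OF submod_finite_orbits[OF M(1) J(1)]]
  have "\<not> finite_mod (finite_orbits M J') J'"
  proof
    assume fin: "finite_mod (finite_orbits M J') J'"
    define S where "S = {a \<in> M. (f ^^ i) a \<in> finite_orbits M J}"
    have "S \<subseteq> finite_orbits M J'"
    proof
      fix a assume a: "a \<in> S"
      then have "finite_mod (orbit_of ((f ^^ i) a)) J" unfolding S_def finite_orbits_def by blast
      then have "finite_mod (orbit_of a) J'"
      proof (rule finite_mod_rel[OF _ J(1), where P = "\<lambda>x y. y \<in> M \<and> (f ^^ i) y - x \<in> J"])
        fix b assume "b \<in> orbit_of a"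
        then obtain g where g: "g \<in> carrier G" "b = \<rho> g a" unfolding orbit_of_def by blast
        then show "\<exists>x\<in>orbit_of ((f ^^ i) a). b \<in> M \<and> (f ^^ i) b - x \<in> J"
          using F_comm[of g a i] a MD(5) unfolding orbit_of_def S_def by blast
      next
        fix x b x' b' assume *: "b \<in> M \<and> (f ^^ i) b - x \<in> J" "b' \<in> M \<and> (f ^^ i) b' - x' \<in> J" "x - x' \<in> J"
        have "(f ^^ i) (b - b') - (f ^^ Suc i) 0 = (((f ^^ i) b - x) - ((f ^^ i) b' - x')) + (x - x')"
          unfolding F_diff by (simp add: F_zero f_zero)
        also have "\<dots> \<in> J" using * JD(2,4) by blast
        finally show "b - b' \<in> J'" unfolding J'_def using * MD(1,4) by blast
      qed
      then show "a \<in> finite_orbits M J'" using a unfolding S_def finite_orbits_def by blast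
    qed
    then obtain R where R: "finite R" "R \<subseteq> S" "\<And>a. a \<in> S \<Longrightarrow> \<exists>r\<in>R. a - r \<in> J'"
      using finite_mod_representatives[OF finite_mod_subset[OF fin] J'] by metis
    obtain Q where Q: "finite Q" "\<And>d. d \<in> D (Suc i) \<Longrightarrow> \<exists>q\<in>Q. d - q \<in> J"
      using i(2) unfolding finite_mod_def by blast
    \<comment> \<open>After subtracting \<open>(f ^^ i) r\<close>, the rest of d lies in f^(i+1) M
      up to an element of \<open>J\<close>. It still has finite orbit because r was chosen in
      \<open>S\<close>, so it is covered by the finite set \<open>Q\<close>.\<close>
    have "\<exists>r\<in>(\<lambda>(r, q). (f ^^ i) r + q) ` (R \<times> Q). d - r \<in> J" if d: "d \<in> D i" for d
    proof -
      obtain a where a: "a \<in> M" "d = (f ^^ i) a" "d \<in> finite_orbits M J" using d unfolding D_def by blast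
      then have "a \<in> S" unfolding S_def by blast
      then obtain r where r: "r \<in> R" "a - r \<in> J'" using R(3) by blast
      then obtain c where c: "c \<in> M" "(f ^^ i) (a - r) - (f ^^ Suc i) c \<in> J" unfolding J'_def by blast
      define j where "j = (f ^^ i) (a - r) - (f ^^ Suc i) c"
      have j: "j \<in> finite_orbits M J"
        using c finite_orbits_superset[OF J] unfolding j_def by blast
      have eq: "(f ^^ Suc i) c = (d - (f ^^ i) r) - j"
        unfolding j_def F_diff a(2) by simp
      also have "\<dots> \<in> finite_orbits M J"
        using a(3) j R(2) r(1) FO(4) unfolding S_def by blast
      finally have "(f ^^ Suc i) c \<in> D (Suc i)" unfolding D_def using c by blast
      then obtain q where q: "q \<in> Q" "(f ^^ Suc i) c - q \<in> J" using Q by blast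
      have "d - ((f ^^ i) r + q) = ((f ^^ Suc i) c - q) + j"
        unfolding eq by (simp add: algebra_simps)
      also have "\<dots> \<in> J" using q c(2) JD(2) unfolding j_def by blast
      finally show ?thesis using r q by force
    qed
    then have "finite_mod (D i) J"
      unfolding finite_mod_def using R(1) Q(1)
      by (intro exI[of _ "(\<lambda>(r, q). (f ^^ i) r + q) ` (R \<times> Q)"]) blast
    with i(1) show False ..
  qed
  then have "J' = J" by (intro max J' \<open>J' \<subseteq> M\<close> \<open>J \<subseteq> J'\<close>)
  moreover have "f m \<in> J'"
  proof -
    have "(f ^^ i) (f m) - (f ^^ Suc i) m = 0" by (simp add: funpow_swap1)
    then show ?thesis unfolding J'_def using m f_M JD(1) by force
  qed
  ultimately show ?thesis by simp
qed

end

section \<open>Group elements compared through their action on a quotient module\<close>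

context group_module
begin

definition act_cong :: "'m set \<Rightarrow> 'm set \<Rightarrow> 'g \<Rightarrow> 'g \<Rightarrow> bool" where
  "act_cong M J g h \<longleftrightarrow> (\<forall>m\<in>M. \<rho> g m - \<rho> h m \<in> J)"

context
  fixes M J
  assumes M: "submod (carrier G) M" and J: "submod (carrier G) J" "J \<subseteq> M"
begin

abbreviation cong_MJ (infix "\<triangleq>" 50) where "g \<triangleq> h \<equiv> act_cong M J g h"

lemma cong_refl: "g \<triangleq> g"
  unfolding act_cong_def using submodD(1)[OF J(1)] by simp

lemma cong_sym: "g \<triangleq> h \<Longrightarrow> h \<triangleq> g"
  unfolding act_cong_def using submod_diff_commute[OF J(1)] by blast

lemma cong_trans: "g \<triangleq> h \<Longrightarrow> h \<triangleq> k \<Longrightarrow> g \<triangleq> k"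
  unfolding act_cong_def using submod_diff_trans[OF J(1)] by blast

lemma cong_left:
  assumes "g \<triangleq> h" "g \<in> carrier G" "h \<in> carrier G" "k \<in> carrier G"
  shows "k \<otimes> g \<triangleq> k \<otimes> h"
  using assms submodD(5)[OF J(1) assms(4)] unfolding act_cong_def
  by (simp add: act_mult flip: act_diff)

lemma cong_right:
  assumes "g \<triangleq> h" "g \<in> carrier G" "h \<in> carrier G" "k \<in> carrier G"
  shows "g \<otimes> k \<triangleq> h \<otimes> k"
  using assms submodD(5)[OF M assms(4)] unfolding act_cong_def
  by (simp add: act_mult)

lemma cong_one_subgroup: "subgroup {g \<in> carrier G. g \<triangleq> \<one>} G"
proof (rule subgroupI)
  fix a assume a: "a \<in> {g \<in> carrier G. g \<triangleq> \<one>}"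
  then have "inv a \<otimes> a \<triangleq> inv a \<otimes> \<one>" by (intro cong_left) auto
  then show "inv a \<in> {g \<in> carrier G. g \<triangleq> \<one>}" using a cong_sym by simp
  fix b assume b: "b \<in> {g \<in> carrier G. g \<triangleq> \<one>}"
  have "a \<otimes> b \<triangleq> a \<otimes> \<one>" by (rule cong_left) (use a b in auto)
  then show "a \<otimes> b \<in> {g \<in> carrier G. g \<triangleq> \<one>}" using a b cong_trans by force
qed (auto intro!: exI[of _ \<one>] cong_refl)

lemma cong_commute_pow:
  assumes "t \<otimes> g \<triangleq> g \<otimes> t" "t \<in> carrier G" "g \<in> carrier G"
  shows "t [^] (c::nat) \<otimes> g \<triangleq> g \<otimes> t [^] c"
proof (induction c)
  case 0
  then show ?case using assms cong_refl by simp
next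
  case (Suc c)
  have "t [^] c \<otimes> (t \<otimes> g) \<triangleq> t [^] c \<otimes> (g \<otimes> t)" using assms by (intro cong_left) auto
  moreover have "(t [^] c \<otimes> g) \<otimes> t \<triangleq> (g \<otimes> t [^] c) \<otimes> t" using assms Suc by (intro cong_right) auto
  ultimately show ?case using assms cong_trans by (simp add: m_assoc)
qed

text \<open>The commutator of a power of \<open>t\<close> with \<open>g\<close> lies in
  \<open>N\<close>, so modulo \<open>J\<close> the conjugates of \<open>g\<close> by powers of
  \<open>t\<close> take at most \<open>card R\<close> values. Two of the first
  \<open>card R + 1\<close> agree, hence some t^d with d at most \<open>card R\<close> commutes with
  \<open>g\<close>. The factorial is a common multiple of all such d and removes the dependence on
  \<open>g\<close>.\<close>

lemma power_central_mod:
  assumes N: "N \<lhd> G" and t: "t \<in> carrier G"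
    and comm: "\<And>g. g \<in> carrier G \<Longrightarrow> g \<otimes> t \<otimes> inv g \<otimes> inv t \<in> N"
    and R: "finite R" "R \<subseteq> carrier G" "\<And>g. g \<in> N \<Longrightarrow> \<exists>r\<in>R. g \<triangleq> r"
    and g: "g \<in> carrier G"
  shows "t [^] (fact (card R) :: nat) \<otimes> g \<triangleq> g \<otimes> t [^] (fact (card R) :: nat)"
proof -
  interpret N: normal N G by fact
  have conj: "\<exists>r\<in>R. t [^] i \<otimes> g \<otimes> inv (t [^] i) \<triangleq> r \<otimes> g" for i :: nat
  proof -
    have "t \<in> {h \<in> carrier G. \<forall>g\<in>carrier G. g \<otimes> h \<otimes> inv g \<otimes> inv h \<in> N}"
      using t comm by blast
    then have "t [^] int i \<in> {h \<in> carrier G. \<forall>g\<in>carrier G. g \<otimes> h \<otimes> inv g \<otimes> inv h \<in> N}"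
      by (rule subgroup_int_pow_closed[OF commutator_right_subgroup[OF N]])
    then have "g \<otimes> t [^] i \<otimes> inv g \<otimes> inv (t [^] i) \<in> N" using g unfolding int_pow_int by blast
    then have "inv (g \<otimes> t [^] i \<otimes> inv g \<otimes> inv (t [^] i)) \<in> N" by (rule N.m_inv_closed)
    then obtain r where r: "r \<in> R" "inv (g \<otimes> t [^] i \<otimes> inv g \<otimes> inv (t [^] i)) \<triangleq> r" using R(3) by blast
    have "inv (g \<otimes> t [^] i \<otimes> inv g \<otimes> inv (t [^] i)) \<otimes> g \<triangleq> r \<otimes> g"
      by (rule cong_right[OF r(2)]) (use t g r R(2) in auto)
    then show ?thesis using r t g by (auto simp: inv_mult_group m_assoc)
  qed
  then obtain h where h: "\<And>i::nat. h i \<in> R" "\<And>i. t [^] i \<otimes> g \<otimes> inv (t [^] i) \<triangleq> h i \<otimes> g"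
    by metis
  have "\<not> inj_on h {..card R}"
  proof
    assume "inj_on h {..card R}"
    then have "card {..card R} \<le> card R" using h(1) R(1) by (intro card_inj_on_le) auto
    then show False by simp
  qed
  then obtain i j where ij: "i < j" "j \<le> card R" "h i = h j"
    unfolding inj_on_def by (metis atMost_iff linorder_neqE_nat)
  define d where "d = j - i"
  have d: "0 < d" "d \<le> card R" and j: "j = i + d" using ij by (auto simp: d_def)
  have "t [^] i \<otimes> g \<otimes> inv (t [^] i) \<triangleq> t [^] j \<otimes> g \<otimes> inv (t [^] j)"
    using h(2)[of i] h(2)[of j] ij(3) cong_sym cong_trans by metis
  then have "inv (t [^] i) \<otimes> (t [^] i \<otimes> g \<otimes> inv (t [^] i)) \<triangleq> inv (t [^] i) \<otimes> (t [^] j \<otimes> g \<otimes> inv (t [^] j))"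
    by (rule cong_left) (use t g in auto)
  then have "(inv (t [^] i) \<otimes> (t [^] i \<otimes> g \<otimes> inv (t [^] i))) \<otimes> t [^] j \<triangleq> (inv (t [^] i) \<otimes> (t [^] j \<otimes> g \<otimes> inv (t [^] j))) \<otimes> t [^] j"
    by (rule cong_right) (use t g in auto)
  moreover have "(inv (t [^] i) \<otimes> (t [^] i \<otimes> g \<otimes> inv (t [^] i))) \<otimes> t [^] j = g \<otimes> t [^] d"
    using t g by (simp add: j m_assoc flip: nat_pow_mult)
  moreover have "(inv (t [^] i) \<otimes> (t [^] j \<otimes> g \<otimes> inv (t [^] j))) \<otimes> t [^] j = t [^] d \<otimes> g"
    using t g by (simp add: j m_assoc flip: nat_pow_mult)
  ultimately have "t [^] d \<otimes> g \<triangleq> g \<otimes> t [^] d" using cong_sym by simp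
  moreover obtain c where "fact (card R) = d * c"
    using dvd_fact[of d "card R"] d by (auto simp: dvd_def)
  ultimately show ?thesis
    using cong_commute_pow[of "t [^] d" g c] t g by (simp add: nat_pow_pow)
qed

lemma finite_orbit_power:
  assumes m: "m \<in> finite_orbits M J" and t: "t \<in> carrier G"
  shows "\<exists>d>0. \<rho> (t [^] (d::nat)) m - m \<in> J"
proof -
  obtain R where R: "finite R" "\<And>g. g \<in> carrier G \<Longrightarrow> \<exists>r\<in>R. \<rho> g m - r \<in> J"
    using m unfolding finite_orbits_def finite_mod_def orbit_of_def by blast
  have "\<exists>r\<in>R. \<rho> (t [^] i) m - r \<in> J" for i :: nat using R(2) t by simp
  then obtain h where h: "\<And>i::nat. h i \<in> R" "\<And>i. \<rho> (t [^] i) m - h i \<in> J" by metis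
  have "\<not> inj_on h {..card R}"
  proof
    assume "inj_on h {..card R}"
    then have "card {..card R} \<le> card R" using h(1) R(1) by (intro card_inj_on_le) auto
    then show False by simp
  qed
  then obtain i j where ij: "i < j" "h i = h j"
    unfolding inj_on_def by (metis linorder_neqE_nat)
  have "\<rho> (t [^] j) m - \<rho> (t [^] i) m \<in> J"
    using submod_diff_trans[OF J(1) h(2)[of j]] h(2)[of i] ij(2) submod_diff_commute[OF J(1)] by metis
  then have "\<rho> (inv (t [^] i)) (\<rho> (t [^] j) m - \<rho> (t [^] i) m) \<in> J"
    using submodD(5)[OF J(1)] t by simp
  moreover have "t [^] j = t [^] i \<otimes> t [^] (j - i)" using t ij by (simp add: nat_pow_mult)
  ultimately have "\<rho> (t [^] (j - i)) m - m \<in> J" using t by (simp add: act_diff act_mult)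
  then show ?thesis using ij by (intro exI[of _ "j - i"]) simp
qed

lemma fixed_pow:
  assumes "\<rho> t m - m \<in> J" "t \<in> carrier G"
  shows "\<rho> (t [^] (c::nat)) m - m \<in> J"
proof (induction c)
  case 0
  then show ?case using submodD(1)[OF J(1)] by simp
next
  case (Suc c)
  have "\<rho> (t [^] c) (\<rho> t m - m) \<in> J" using assms submodD(5)[OF J(1)] by simp
  then show ?case
    using Suc submod_diff_trans[OF J(1)] assms by (simp add: act_diff act_mult)
qed

text \<open>Each element of finite orbit is fixed modulo \<open>J\<close> by some power of
  \<open>t\<close>, with an exponent depending on the element. The Noetherian condition supplies a
  common exponent. For it, acting and subtracting the identity is an endomorphism that kills the
  elements of finite orbit, hence is zero modulo \<open>J\<close>.\<close>

lemma finite_image_step: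
  assumes noeth: "noeth (carrier G) M"
    and inf: "\<not> finite_mod (finite_orbits M J) J"
    and max: "\<And>J'. submod (carrier G) J' \<Longrightarrow> J' \<subseteq> M \<Longrightarrow> J \<subseteq> J' \<Longrightarrow>
      \<not> finite_mod (finite_orbits M J') J' \<Longrightarrow> J' = J"
    and N: "N \<lhd> G" and t: "t \<in> carrier G"
    and comm: "\<And>g. g \<in> carrier G \<Longrightarrow> g \<otimes> t \<otimes> inv g \<otimes> inv t \<in> N"
    and R: "finite R" "R \<subseteq> carrier G" "\<And>g. g \<in> N \<Longrightarrow> \<exists>r\<in>R. g \<triangleq> r"
  shows "\<exists>K::nat. K > 0 \<and> t [^] K \<triangleq> \<one>"
proof -
  define k :: nat where "k = fact (card R)"
  have k: "k > 0" "\<And>g. g \<in> carrier G \<Longrightarrow> t [^] k \<otimes> g \<triangleq> g \<otimes> t [^] k"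
    using power_central_mod[OF N t comm R] by (auto simp: k_def)
  \<comment> \<open>\<open>k\<close> makes the powers commute with the whole group modulo
    \<open>J\<close>; the factorials make each exponent divide the next, so that the fixed
    submodules \<open>C n\<close> increase.\<close>
  define s where "s n = t [^] (k * fact n)" for n :: nat
  have s: "s n \<in> carrier G" for n using t by (simp add: s_def)
  have s_comm: "s n \<otimes> g \<triangleq> g \<otimes> s n" if "g \<in> carrier G" for n g
    using cong_commute_pow[OF k(2)[OF that], of "fact n"] t that by (simp add: nat_pow_pow s_def)
  define FO where "FO = finite_orbits M J"
  have FO: "submod (carrier G) FO" "FO \<subseteq> M"
    unfolding FO_def using submod_finite_orbits[OF M J(1)] by (auto simp: finite_orbits_def)
  define C where "C n = {m \<in> FO. \<rho> (s n) m - m \<in> J}" for n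
  have C_sub: "submod (carrier G) (C n)" for n
  proof (rule submodI)
    show "0 \<in> C n" unfolding C_def using submodD(1)[OF FO(1)] submodD(1)[OF J(1)] s by simp
  next
    fix a b assume ab: "a \<in> C n" "b \<in> C n"
    have "\<rho> (s n) (a + b) - (a + b) = (\<rho> (s n) a - a) + (\<rho> (s n) b - b)"
      using s by (simp add: act_add)
    also have "\<dots> \<in> J" using ab submodD(2)[OF J(1)] unfolding C_def by blast
    finally show "a + b \<in> C n"
      using ab submodD(2)[OF FO(1)] unfolding C_def by blast
  next
    fix a assume a: "a \<in> C n"
    have "\<rho> (s n) (- a) - (- a) = - (\<rho> (s n) a - a)"
      using s by (simp add: act_minus)
    also have "\<dots> \<in> J" using a submodD(3)[OF J(1)] unfolding C_def by blast
    finally show "- a \<in> C n"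
      using a submodD(3)[OF FO(1)] unfolding C_def by blast
  next
    fix g a assume g: "g \<in> carrier G" and a: "a \<in> C n"
    have "\<rho> (s n \<otimes> g) a - \<rho> (g \<otimes> s n) a \<in> J"
      using s_comm[OF g, of n] a FO(2) unfolding act_cong_def C_def by blast
    moreover have "\<rho> g (\<rho> (s n) a - a) \<in> J" using a g submodD(5)[OF J(1)] unfolding C_def by blast
    ultimately have "\<rho> (s n) (\<rho> g a) - \<rho> g a \<in> J"
      using submod_diff_trans[OF J(1)] g s by (simp add: act_mult act_diff)
    then show "\<rho> g a \<in> C n" using a g submodD(5)[OF FO(1)] unfolding C_def by simp
  qed
  have C_mono: "C n \<subseteq> C (Suc n)" for n
  proof -
    have "k * fact (Suc n) = k * fact n * Suc n" by (simp add: algebra_simps)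
    then have "s (Suc n) = s n [^] Suc n"
      unfolding s_def using nat_pow_pow[OF t, of "k * fact n" "Suc n"] by simp
    then have "\<rho> (s (Suc n)) m - m \<in> J" if "\<rho> (s n) m - m \<in> J" for m
      using fixed_pow[OF that s, of "Suc n"] by simp
    then show ?thesis unfolding C_def by blast
  qed
  have "C n \<subseteq> M" for n unfolding C_def using FO by blast
  then obtain n where n: "\<And>i. i \<ge> n \<Longrightarrow> C i = C n"
    using noethD[OF noeth, of C] C_sub C_mono by metis
  have FO_C: "FO \<subseteq> C n"
  proof
    fix m assume m: "m \<in> FO"
    then obtain d where d: "d > 0" "\<rho> ((t [^] k) [^] (d::nat)) m - m \<in> J"
      using finite_orbit_power[of m "t [^] k"] t unfolding FO_def by auto
    obtain c where c: "fact d = d * c" using dvd_fact[of d d] d by (auto simp: dvd_def)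
    have "\<rho> (s d) m - m \<in> J"
      using fixed_pow[OF d(2), of c] t by (simp add: s_def c nat_pow_pow mult.assoc)
    then have "m \<in> C d" unfolding C_def using m by blast
    then show "m \<in> C n"
      using lift_Suc_mono_le[of C d "max d n"] C_mono n[of "max d n"] by auto
  qed
  have "s n \<triangleq> \<one>"
    unfolding act_cong_def act_one
  proof
    fix m assume m: "m \<in> M"
    show "\<rho> (s n) m - m \<in> J"
    proof (rule endomorphism_trivial_on_maximal[OF M noeth J inf max, where f = "\<lambda>m. \<rho> (s n) m - m"])
      show "\<rho> (s n) (a + b) - (a + b) = \<rho> (s n) a - a + (\<rho> (s n) b - b)" for a b
        using s by (simp add: act_add)
      show "\<rho> (s n) a - a \<in> M" if "a \<in> M" for a using that submodD(4,5)[OF M] s by blast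
      show "\<rho> (s n) a - a \<in> J" if "a \<in> J" for a using that submodD(4,5)[OF J(1)] s by blast
      show "\<rho> (s n) a - a \<in> J" if "a \<in> finite_orbits M J" for a
        using that FO_C unfolding C_def FO_def by blast
      show "\<rho> (s n) (\<rho> g a) - \<rho> g a - \<rho> g (\<rho> (s n) a - a) \<in> J" if "g \<in> carrier G" "a \<in> M" for g a
        using s_comm[OF that(1), of n] that s unfolding act_cong_def by (simp add: act_mult act_diff)
    qed (use m in auto)
  qed
  then show ?thesis using k(1) unfolding s_def by (intro exI[of _ "k * fact n"]) simp
qed

lemma finite_image_polycentral:
  assumes noeth: "noeth (carrier G) M"
    and inf: "\<not> finite_mod (finite_orbits M J) J"
    and max: "\<And>J'. submod (carrier G) J' \<Longrightarrow> J' \<subseteq> M \<Longrightarrow> J \<subseteq> J' \<Longrightarrow>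
      \<not> finite_mod (finite_orbits M J') J' \<Longrightarrow> J' = J"
    and "polycentral G N"
  shows "\<exists>R. finite R \<and> R \<subseteq> carrier G \<and> (\<forall>g\<in>N. \<exists>r\<in>R. g \<triangleq> r)"
  using assms(4)
proof (induction rule: polycentral.induct)
  case polycentral_one
  show ?case by (intro exI[of _ "{\<one>}"]) (simp add: cong_refl)
next
  case (polycentral_insert N t)
  obtain R where R: "finite R" "R \<subseteq> carrier G" "\<And>g. g \<in> N \<Longrightarrow> \<exists>r\<in>R. g \<triangleq> r"
    using polycentral_insert.IH by blast
  note t = polycentral_insert.hyps(2)
  note N = polycentral_normal[OF polycentral_insert.hyps(1)]
  then have N_sub: "N \<subseteq> carrier G" by (simp add: normal_imp_subgroup subgroup.subset)
  have "\<exists>K::nat. K > 0 \<and> t [^] K \<triangleq> \<one>"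
    using noeth inf max N t polycentral_insert.hyps(3) R by (rule finite_image_step)
  then obtain K :: nat where K: "K > 0" "t [^] K \<triangleq> \<one>" by blast
  \<comment> \<open>Modulo \<open>J\<close> the action of \<open>t\<close> has order dividing
    \<open>K\<close>, so exponents below \<open>K\<close> suffice next to the representatives of
    \<open>N\<close>.\<close>
  define R' where "R' = (\<lambda>(r, i). r \<otimes> t [^] (i::nat)) ` (R \<times> {..<K})"
  have "\<exists>r\<in>R'. x \<triangleq> r" if x: "x \<in> generate G (insert t N)" for x
  proof -
    obtain n and j :: int where n: "n \<in> N" "x = n \<otimes> t [^] j"
      using generate_insert_normal[OF N t x] by blast
    obtain r where r: "r \<in> R" "n \<triangleq> r" using R(3) n by blast
    define i where "i = nat (j mod int K)"
    have i: "i < K" "j = int i + int K * (j div int K)"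
      using K(1) by (auto simp: i_def nat_less_iff)
    have tK: "(t [^] K) [^] (j div int K) \<triangleq> \<one>"
      using subgroup_int_pow_closed[OF cong_one_subgroup, of "t [^] K"] K(2) t by auto
    have "t [^] j = t [^] i \<otimes> (t [^] K) [^] (j div int K)"
      using t by (subst i(2)) (simp add: int_pow_mult int_pow_pow flip: int_pow_int)
    then have "t [^] j \<triangleq> t [^] i \<otimes> \<one>"
      using cong_left[OF tK, of "t [^] i"] t by simp
    then have "n \<otimes> t [^] j \<triangleq> n \<otimes> t [^] i"
      using cong_left[of "t [^] j" "t [^] i" n] t n N_sub by auto
    moreover have "n \<otimes> t [^] i \<triangleq> r \<otimes> t [^] i"
      by (rule cong_right[OF r(2)]) (use t n N_sub r R in auto)
    ultimately have "x \<triangleq> r \<otimes> t [^] i" using cong_trans n by blast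
    then show ?thesis unfolding R'_def using r i by force
  qed
  moreover have "finite R'" "R' \<subseteq> carrier G" unfolding R'_def using R t by auto
  ultimately show ?case by blast
qed

end

theorem infinite_quotient_with_finite_action:
  assumes poly: "polycentral G (carrier G)" and F: "finite F" and M: "M = span (carrier G) F"
    and inf: "infinite (finite_orbits M {0})"
  obtains J R where "submod (carrier G) J" "J \<subseteq> M" "\<not> finite_mod M J"
    "finite R" "R \<subseteq> carrier G" "\<And>g. g \<in> carrier G \<Longrightarrow> \<exists>r\<in>R. \<forall>m\<in>M. \<rho> g m - \<rho> r m \<in> J"
proof -
  have subM: "submod (carrier G) M" and noeth: "noeth (carrier G) M"
    unfolding M using span_submod noeth_polycentral_span[OF poly F] by auto
  define P where "P J \<longleftrightarrow> submod (carrier G) J \<and> J \<subseteq> M \<and> \<not> finite_mod (finite_orbits M J) J" for J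
  have "submod (carrier G) {0}" by (rule submodI) auto
  moreover have "\<not> finite_mod (finite_orbits M {0}) {0}"
  proof
    assume "finite_mod (finite_orbits M {0}) {0}"
    then obtain R where R: "finite R" "\<forall>a\<in>finite_orbits M {0}. \<exists>r\<in>R. a - r \<in> {0}"
      unfolding finite_mod_def by blast
    then have "finite_orbits M {0} \<subseteq> R" by fastforce
    then show False using inf R(1) finite_subset by blast
  qed
  ultimately have "P {0}" unfolding P_def using submodD(1)[OF subM] by simp
  then obtain J where J: "P J" "\<And>J'. P J' \<Longrightarrow> J \<subseteq> J' \<Longrightarrow> J' = J"
    using noeth_maximal[OF noeth, of P "{0}"] unfolding P_def by blast
  have J': "submod (carrier G) J" "J \<subseteq> M" "\<not> finite_mod (finite_orbits M J) J"
    using J(1) unfolding P_def by blast+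
  have max: "K = J" if "submod (carrier G) K" "K \<subseteq> M" "J \<subseteq> K" "\<not> finite_mod (finite_orbits M K) K" for K
    using that J(2)[of K] unfolding P_def by simp
  have "\<exists>R. finite R \<and> R \<subseteq> carrier G \<and> (\<forall>g\<in>carrier G. \<exists>r\<in>R. act_cong M J g r)"
    using subM J'(1,2) noeth J'(3) max poly by (rule finite_image_polycentral)
  then obtain R where "finite R" "R \<subseteq> carrier G" "\<forall>g\<in>carrier G. \<exists>r\<in>R. act_cong M J g r"
    by blast
  moreover have "\<not> finite_mod M J"
    using J'(3) finite_mod_subset[of M J "finite_orbits M J"] unfolding finite_orbits_def by blast
  ultimately show ?thesis using that[of J R] J' unfolding act_cong_def by blast
qed

end

section \<open>Harmonic analysis on compact metrizable abelian groups\<close>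

text \<open>For products of functions of one variable the two iterated integrals visibly agree.
  Their sums form an algebra that separates points, so by Stone-Weierstrass the agreement extends to
  all continuous functions.\<close>

inductive tensor_sum :: "('x::topological_space \<times> 'x \<Rightarrow> real) \<Rightarrow> bool" where
  tensor_sum_base: "continuous_on UNIV f \<Longrightarrow> continuous_on UNIV g \<Longrightarrow> tensor_sum (\<lambda>p. f (fst p) * g (snd p))"
| tensor_sum_add: "tensor_sum F \<Longrightarrow> tensor_sum G \<Longrightarrow> tensor_sum (\<lambda>p. F p + G p)"

lemma tensor_sum_mult:
  assumes "tensor_sum F" "tensor_sum G"
  shows "tensor_sum (\<lambda>p. F p * G p)"
  using assms(1)
proof (induction rule: tensor_sum.induct)
  case (tensor_sum_base f g)
  from assms(2) show ?case
  proof (induction rule: tensor_sum.induct)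
    case (tensor_sum_base f' g')
    have "tensor_sum (\<lambda>p. (f (fst p) * f' (fst p)) * (g (snd p) * g' (snd p)))"
      using \<open>continuous_on UNIV f\<close> \<open>continuous_on UNIV g\<close> tensor_sum_base
      by (intro tensor_sum.tensor_sum_base[of "\<lambda>x. f x * f' x" "\<lambda>x. g x * g' x"] continuous_on_mult)
    then show ?case by (simp add: ac_simps)
  next
    case (tensor_sum_add F G)
    then show ?case using tensor_sum.tensor_sum_add by (fastforce simp: distrib_left)
  qed
next
  case (tensor_sum_add F G')
  then show ?case using tensor_sum.tensor_sum_add by (fastforce simp: distrib_right)
qed

lemma tensor_sum_continuous: "tensor_sum F \<Longrightarrow> continuous_on UNIV F"
proof (induction rule: tensor_sum.induct)
  case (tensor_sum_base f g)
  show ?case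
    by (intro continuous_on_mult continuous_on_compose2[OF tensor_sum_base(1)]
        continuous_on_compose2[OF tensor_sum_base(2)] continuous_intros) auto
qed (intro continuous_on_add)

lemma tensor_sum_dense:
  fixes F :: "'x::metric_space \<times> 'x \<Rightarrow> real"
  assumes "compact (UNIV :: 'x set)" "continuous_on UNIV F" "e > 0"
  shows "\<exists>G. tensor_sum G \<and> (\<forall>p. \<bar>F p - G p\<bar> < e)"
proof -
  have "compact (UNIV :: ('x \<times> 'x) set)"
    using compact_Times[OF assms(1) assms(1)] by simp
  then have "\<exists>G. tensor_sum G \<and> (\<forall>p\<in>UNIV. \<bar>F p - G p\<bar> < e)"
  proof (rule Stone_Weierstrass_HOL)
    show "tensor_sum (\<lambda>p :: 'x \<times> 'x. c)" for c
      using tensor_sum_base[of "\<lambda>x::'x. c" "\<lambda>x. 1"] by simp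
    show "\<exists>f. tensor_sum f \<and> f p \<noteq> f q" if "p \<in> UNIV \<and> q \<in> UNIV \<and> p \<noteq> q" for p q :: "'x \<times> 'x"
    proof (cases "fst p = fst q")
      case False
      have "tensor_sum (\<lambda>r. dist (fst r) (fst q) * 1)"
        by (rule tensor_sum_base[of "\<lambda>x. dist x (fst q)"]) (auto intro!: continuous_intros)
      then show ?thesis using False by (intro exI[of _ "\<lambda>r. dist (fst r) (fst q)"]) simp
    next
      case True
      then have "snd p \<noteq> snd q" using that by (auto simp: prod_eq_iff)
      moreover have "tensor_sum (\<lambda>r. 1 * dist (snd r) (snd q))"
        by (rule tensor_sum_base[of _ "\<lambda>x. dist x (snd q)"]) (auto intro!: continuous_intros)
      ultimately show ?thesis by (intro exI[of _ "\<lambda>r. dist (snd r) (snd q)"]) simp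
    qed
  qed (use assms in \<open>auto intro: tensor_sum_continuous tensor_sum_add tensor_sum_mult\<close>)
  then show ?thesis by simp
qed

section \<open>Integration against Haar measure\<close>

locale haar_group =
  fixes \<mu> :: "'x::{topological_ab_group_add, metric_space} measure"
  assumes compact_UNIV: "compact (UNIV :: 'x set)" and haar: "normalized_haar_measure \<mu>"
begin

lemma sets_haar [measurable_cong, simp]: "sets \<mu> = sets borel"
  using haar by (simp add: normalized_haar_measure_def)

lemma space_haar [simp]: "space \<mu> = UNIV"
  using sets_eq_imp_space_eq[OF sets_haar] by simp

lemma emeasure_UNIV [simp]: "emeasure \<mu> UNIV = 1"
  using haar by (simp add: normalized_haar_measure_def)

sublocale finite_measure \<mu>
  by standard simp

lemma measure_UNIV [simp]: "measure \<mu> UNIV = 1"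
  by (simp add: measure_def)

lemma measurable_continuous:
  fixes f :: "'x \<Rightarrow> 'b::topological_space"
  shows "continuous_on UNIV f \<Longrightarrow> f \<in> borel_measurable \<mu>"
  using borel_measurable_continuous_onI[of f] by (simp cong: measurable_cong_sets)

lemma bounded_range:
  fixes f :: "'x \<Rightarrow> 'b::metric_space"
  shows "continuous_on UNIV f \<Longrightarrow> bounded (range f)"
  using compact_UNIV compact_continuous_image compact_imp_bounded by blast

lemma integrable_continuous:
  fixes f :: "'x \<Rightarrow> 'b::{banach, second_countable_topology}"
  assumes "continuous_on UNIV f"
  shows "integrable \<mu> f"
proof -
  obtain B where "\<And>x. norm (f x) \<le> B"
    using bounded_range[OF assms] by (auto simp: bounded_iff)
  then show ?thesis
    by (intro integrable_const_bound[of _ B] measurable_continuous assms) auto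
qed

lemma norm_integral_le:
  fixes f :: "'x \<Rightarrow> 'b::{banach, second_countable_topology}"
  assumes "continuous_on UNIV f" "\<And>x. norm (f x) \<le> B"
  shows "norm (\<integral>x. f x \<partial>\<mu>) \<le> B"
proof -
  have "norm (\<integral>x. f x \<partial>\<mu>) \<le> (\<integral>x. norm (f x) \<partial>\<mu>)" by simp
  also have "\<dots> \<le> (\<integral>x. B \<partial>\<mu>)"
    using assms by (intro integral_mono integrable_continuous continuous_on_norm) auto
  finally show ?thesis by simp
qed

lemma continuous_translate: "continuous_on UNIV (\<lambda>x::'x. x + a)"
  by (intro continuous_intros)

lemma distr_translate: "distr \<mu> \<mu> (\<lambda>x. x + a) = \<mu>"
proof (rule measure_eqI)
  have meas: "(\<lambda>x. x + a) \<in> measurable \<mu> \<mu>"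
    using measurable_continuous[OF continuous_translate[of a]] by (simp cong: measurable_cong_sets)
  fix E assume "E \<in> sets (distr \<mu> \<mu> (\<lambda>x. x + a))"
  then have E: "E \<in> sets borel" by simp
  have "(\<lambda>x. x + a) -` E = (\<lambda>x. - a + x) ` E"
    by (auto simp: image_iff algebra_simps intro!: bexI[where x = "_ + a"])
  moreover have "emeasure \<mu> ((\<lambda>x. - a + x) ` E) = emeasure \<mu> E"
    using haar E unfolding normalized_haar_measure_def by blast
  ultimately show "emeasure (distr \<mu> \<mu> (\<lambda>x. x + a)) E = emeasure \<mu> E"
    using E meas by (simp add: emeasure_distr)
qed simp

lemma integral_translate:
  fixes f :: "'x \<Rightarrow> 'b::{banach, second_countable_topology}"
  assumes "f \<in> borel_measurable \<mu>"
  shows "(\<integral>x. f (x + a) \<partial>\<mu>) = (\<integral>x. f x \<partial>\<mu>)"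
proof -
  have meas: "(\<lambda>x. x + a) \<in> measurable \<mu> \<mu>"
    using measurable_continuous[OF continuous_translate[of a]] by (simp cong: measurable_cong_sets)
  show ?thesis
    using integral_distr[OF meas assms] by (simp add: distr_translate)
qed

lemma continuous_section:
  fixes F :: "'x \<Rightarrow> 'x \<Rightarrow> 'b::topological_space"
  assumes "continuous_on UNIV (\<lambda>p. F (fst p) (snd p))"
  shows "continuous_on UNIV (F x)" "continuous_on UNIV (\<lambda>x. F x y)"
proof -
  have c: "continuous_on UNIV (\<lambda>y. (x, y))" "continuous_on UNIV (\<lambda>x. (x, y))"
    by (intro continuous_intros)+
  show "continuous_on UNIV (F x)" "continuous_on UNIV (\<lambda>x. F x y)"
    using continuous_on_compose2[OF assms c(1)] continuous_on_compose2[OF assms c(2)] by auto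
qed

lemma continuous_on_integral:
  fixes F :: "'x \<Rightarrow> 'x \<Rightarrow> 'b::{banach, second_countable_topology}"
  assumes F: "continuous_on UNIV (\<lambda>p. F (fst p) (snd p))"
  shows "continuous_on UNIV (\<lambda>x. \<integral>y. F x y \<partial>\<mu>)"
proof (rule continuous_on_sequentiallyI)
  fix u and a :: 'x assume u: "u \<longlonglongrightarrow> a"
  have "compact (UNIV :: ('x \<times> 'x) set)"
    using compact_Times[OF compact_UNIV compact_UNIV] by simp
  then have "bounded (range (\<lambda>p. F (fst p) (snd p)))"
    using F compact_continuous_image compact_imp_bounded by blast
  then obtain B where "\<And>p. norm (F (fst p) (snd p)) \<le> B" unfolding bounded_iff by blast
  then have B: "norm (F x y) \<le> B" for x y by (metis fst_conv snd_conv)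
  show "(\<lambda>n. \<integral>y. F (u n) y \<partial>\<mu>) \<longlonglongrightarrow> (\<integral>y. F a y \<partial>\<mu>)"
  proof (rule integral_dominated_convergence[where w = "\<lambda>_. B"])
    show "AE y in \<mu>. (\<lambda>n. F (u n) y) \<longlonglongrightarrow> F a y"
    proof (rule AE_I2)
      fix y
      have "isCont (\<lambda>x. F x y) a"
        using continuous_section(2)[OF F] by (simp add: continuous_on_eq_continuous_at)
      then show "(\<lambda>n. F (u n) y) \<longlonglongrightarrow> F a y" using u by (rule isCont_tendsto_compose)
    qed
  qed (use B in \<open>auto intro!: measurable_continuous continuous_section[OF F]\<close>)
qed

lemma continuous_swap:
  fixes F :: "'x \<Rightarrow> 'x \<Rightarrow> 'b::topological_space"
  assumes "continuous_on UNIV (\<lambda>p. F (fst p) (snd p))"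
  shows "continuous_on UNIV (\<lambda>p. F (snd p) (fst p))"
proof -
  have "continuous_on UNIV (\<lambda>p :: 'x \<times> 'x. (snd p, fst p))"
    by (intro continuous_intros)
  from continuous_on_compose2[OF assms this] show ?thesis by simp
qed

lemma integral_swap_tensor_sum:
  "tensor_sum F \<Longrightarrow> (\<integral>x. \<integral>y. F (x, y) \<partial>\<mu> \<partial>\<mu>) = (\<integral>y. \<integral>x. F (x, y) \<partial>\<mu> \<partial>\<mu>)"
proof (induction rule: tensor_sum.induct)
  case (tensor_sum_base f g)
  then show ?case by simp
next
  case (tensor_sum_add F G)
  have c: "continuous_on UNIV (\<lambda>p. F (fst p, snd p))" "continuous_on UNIV (\<lambda>p. G (fst p, snd p))"
    using tensor_sum_add.hyps tensor_sum_continuous by auto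
  note s = continuous_section[of "\<lambda>x y. F (x, y)", OF c(1)] continuous_section[of "\<lambda>x y. G (x, y)", OF c(2)]
  note i = continuous_on_integral[of "\<lambda>x y. F (x, y)", OF c(1)]
    continuous_on_integral[of "\<lambda>x y. G (x, y)", OF c(2)]
    continuous_on_integral[of "\<lambda>y x. F (x, y)", OF continuous_swap[of "\<lambda>x y. F (x, y)", OF c(1)]]
    continuous_on_integral[of "\<lambda>y x. G (x, y)", OF continuous_swap[of "\<lambda>x y. G (x, y)", OF c(2)]]
  show ?case
    using tensor_sum_add.IH by (simp add: s i integrable_continuous)
qed

text \<open>The type class of \<open>'x\<close> does not provide a countable base, so the Borel sets of the product are not
  known to be the product of the Borel sets, and Fubini's theorem from the library does not apply.\<close>

lemma integral_swap_real:
  fixes F :: "'x \<Rightarrow> 'x \<Rightarrow> real"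
  assumes F: "continuous_on UNIV (\<lambda>p. F (fst p) (snd p))"
  shows "(\<integral>x. \<integral>y. F x y \<partial>\<mu> \<partial>\<mu>) = (\<integral>y. \<integral>x. F x y \<partial>\<mu> \<partial>\<mu>)"
proof -
  have "\<bar>(\<integral>x. \<integral>y. F x y \<partial>\<mu> \<partial>\<mu>) - (\<integral>y. \<integral>x. F x y \<partial>\<mu> \<partial>\<mu>)\<bar> \<le> e" if e: "e > 0" for e :: real
  proof -
    obtain G where G: "tensor_sum G" "\<And>p. \<bar>F (fst p) (snd p) - G p\<bar> < e / 2"
      using tensor_sum_dense[OF compact_UNIV F, of "e / 2"] e by auto
    have FG: "\<bar>F x y - G (x, y)\<bar> \<le> e / 2" for x y using G(2)[of "(x, y)"] by simp
    have c: "continuous_on UNIV (\<lambda>p. G (fst p, snd p))" using G tensor_sum_continuous by auto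
    have *: "\<bar>(\<integral>x. \<integral>y. H x y \<partial>\<mu> \<partial>\<mu>) - (\<integral>x. \<integral>y. K x y \<partial>\<mu> \<partial>\<mu>)\<bar> \<le> e / 2"
      if H: "continuous_on UNIV (\<lambda>p. H (fst p) (snd p))" and K: "continuous_on UNIV (\<lambda>p. K (fst p) (snd p))"
        and HK: "\<And>x y. \<bar>H x y - K x y\<bar> \<le> e / 2" for H K :: "'x \<Rightarrow> 'x \<Rightarrow> real"
    proof -
      note s = continuous_section[OF H] continuous_section[OF K]
      note i = continuous_on_integral[OF H] continuous_on_integral[OF K]
      have inner: "(\<integral>y. H x y \<partial>\<mu>) - (\<integral>y. K x y \<partial>\<mu>) = (\<integral>y. H x y - K x y \<partial>\<mu>)" for x
        by (simp add: s integrable_continuous)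
      have "(\<integral>x. \<integral>y. H x y \<partial>\<mu> \<partial>\<mu>) - (\<integral>x. \<integral>y. K x y \<partial>\<mu> \<partial>\<mu>) = (\<integral>x. (\<integral>y. H x y \<partial>\<mu>) - (\<integral>y. K x y \<partial>\<mu>) \<partial>\<mu>)"
        by (simp add: i integrable_continuous)
      moreover have "norm \<dots> \<le> e / 2"
      proof (rule norm_integral_le)
        show "continuous_on UNIV (\<lambda>x. (\<integral>y. H x y \<partial>\<mu>) - (\<integral>y. K x y \<partial>\<mu>))"
          by (intro continuous_on_diff i)
        show "norm ((\<integral>y. H x y \<partial>\<mu>) - (\<integral>y. K x y \<partial>\<mu>)) \<le> e / 2" for x
          unfolding inner using HK by (intro norm_integral_le continuous_on_diff s) simp
      qed
      ultimately show ?thesis by simp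
    qed
    have "\<bar>(\<integral>x. \<integral>y. F x y \<partial>\<mu> \<partial>\<mu>) - (\<integral>x. \<integral>y. G (x, y) \<partial>\<mu> \<partial>\<mu>)\<bar> \<le> e / 2"
      by (rule *[OF F c FG])
    moreover have "\<bar>(\<integral>y. \<integral>x. F x y \<partial>\<mu> \<partial>\<mu>) - (\<integral>y. \<integral>x. G (x, y) \<partial>\<mu> \<partial>\<mu>)\<bar> \<le> e / 2"
      by (rule *[OF continuous_swap[OF F] continuous_swap[of "\<lambda>x y. G (x, y)", OF c] FG])
    ultimately show ?thesis using integral_swap_tensor_sum[OF G(1)] by linarith
  qed
  then have "\<bar>(\<integral>x. \<integral>y. F x y \<partial>\<mu> \<partial>\<mu>) - (\<integral>y. \<integral>x. F x y \<partial>\<mu> \<partial>\<mu>)\<bar> \<le> 0"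
    by (rule field_le_epsilon) simp
  then show ?thesis by simp
qed

lemma integral_swap:
  fixes F :: "'x \<Rightarrow> 'x \<Rightarrow> complex"
  assumes F: "continuous_on UNIV (\<lambda>p. F (fst p) (snd p))"
  shows "(\<integral>x. \<integral>y. F x y \<partial>\<mu> \<partial>\<mu>) = (\<integral>y. \<integral>x. F x y \<partial>\<mu> \<partial>\<mu>)"
proof -
  note s = continuous_section[OF F]
  note i = continuous_on_integral[OF F] continuous_on_integral[of "\<lambda>y x. F x y", OF continuous_swap[OF F]]
  have "(\<integral>x. \<integral>y. Re (F x y) \<partial>\<mu> \<partial>\<mu>) = (\<integral>y. \<integral>x. Re (F x y) \<partial>\<mu> \<partial>\<mu>)"
    by (rule integral_swap_real) (intro continuous_on_Re F)
  moreover have "(\<integral>x. \<integral>y. Im (F x y) \<partial>\<mu> \<partial>\<mu>) = (\<integral>y. \<integral>x. Im (F x y) \<partial>\<mu> \<partial>\<mu>)"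
    by (rule integral_swap_real) (intro continuous_on_Im F)
  ultimately show ?thesis
    by (simp add: complex_eq_iff s i integrable_continuous flip: integral_Re integral_Im)
qed

text \<open>Integrate f (y - x) in both orders: translation invariance in y gives the integral of f,
  and in x the integral of its reflection.\<close>

lemma integral_minus_arg:
  fixes f :: "'x \<Rightarrow> complex"
  assumes f: "continuous_on UNIV f"
  shows "(\<integral>x. f (- x) \<partial>\<mu>) = (\<integral>x. f x \<partial>\<mu>)"
proof -
  have f': "continuous_on UNIV (\<lambda>x. f (- x))"
    by (intro continuous_on_compose2[OF f] continuous_intros) auto
  have "(\<integral>x. \<integral>y. f (y - x) \<partial>\<mu> \<partial>\<mu>) = (\<integral>y. \<integral>x. f (y - x) \<partial>\<mu> \<partial>\<mu>)"
    by (rule integral_swap) (intro continuous_on_compose2[OF f] continuous_intros; simp)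
  moreover have "(\<integral>y. f (y - x) \<partial>\<mu>) = (\<integral>y. f y \<partial>\<mu>)" for x
    using integral_translate[OF measurable_continuous[OF f], of "- x"] by simp
  moreover have "(\<integral>x. f (y - x) \<partial>\<mu>) = (\<integral>x. f (- x) \<partial>\<mu>)" for y
    using integral_translate[OF measurable_continuous[OF f'], of "- y"] by simp
  ultimately show ?thesis by simp
qed

lemma integral_reflect:
  fixes f :: "'x \<Rightarrow> complex"
  assumes f: "continuous_on UNIV f"
  shows "(\<integral>y. f (x - y) \<partial>\<mu>) = (\<integral>y. f y \<partial>\<mu>)"
proof -
  have f': "continuous_on UNIV (\<lambda>y. f (x + y))"
    by (intro continuous_on_compose2[OF f] continuous_intros) auto
  have "(\<integral>y. f (x - y) \<partial>\<mu>) = (\<integral>y. f (x + y) \<partial>\<mu>)"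
    using integral_minus_arg[OF f'] by simp
  also have "\<dots> = (\<integral>y. f y \<partial>\<mu>)"
    using integral_translate[OF measurable_continuous[OF f], of x] by (simp add: add.commute)
  finally show ?thesis .
qed

text \<open>Finitely many translates of \<open>W\<close> cover the compact group; if
  \<open>W\<close> were null, so would be the whole group.\<close>

lemma open_pos_measure:
  assumes "open W" "W \<noteq> {}"
  shows "measure \<mu> W > 0"
proof (rule ccontr)
  assume "\<not> measure \<mu> W > 0"
  then have W0: "emeasure \<mu> W = 0"
    using measure_nonneg[of \<mu> W] by (simp add: emeasure_eq_measure)
  obtain w where w: "w \<in> W" using assms by blast
  define T where "T a = (\<lambda>x. a + x) ` W" for a
  have T: "T a = (\<lambda>x. x + (- a)) -` W" for a
    by (auto simp: T_def image_iff algebra_simps intro!: bexI[where x = "_ - a"])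
  have T_open: "open (T a)" for a
    unfolding T by (rule open_vimage[OF assms(1) continuous_translate])
  have "UNIV \<subseteq> (\<Union>a. T a)"
  proof
    fix x :: 'x
    have "x \<in> T (x - w)" unfolding T_def using w by force
    then show "x \<in> (\<Union>a. T a)" by blast
  qed
  then obtain C where C: "finite C" "UNIV \<subseteq> (\<Union>a\<in>C. T a)"
    using compactE_image[OF compact_UNIV, of UNIV T] T_open by auto
  have "emeasure \<mu> (T a) = 0" for a
    unfolding T_def using W0 haar assms(1) by (simp add: normalized_haar_measure_def)
  moreover have "T a \<in> sets \<mu>" for a using T_open by simp
  ultimately have "(\<Union>a\<in>C. T a) \<in> null_sets \<mu>"
    using C(1) by (intro null_sets_UN') (auto simp: countable_finite)
  moreover have "(\<Union>a\<in>C. T a) = UNIV" using C(2) by blast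
  ultimately show False by (simp add: null_sets_def)
qed

lemma integral_zero_imp_zero:
  fixes f :: "'x \<Rightarrow> real"
  assumes f: "continuous_on UNIV f" "\<And>x. f x \<ge> 0" and zero: "(\<integral>x. f x \<partial>\<mu>) = 0"
  shows "f x = 0"
proof (rule ccontr)
  assume x: "f x \<noteq> 0"
  define W where "W = f -` {f x / 2<..}"
  have "open W" unfolding W_def by (intro open_vimage f) simp
  moreover have "x \<in> W" using x f(2)[of x] by (simp add: W_def)
  ultimately have pos: "measure \<mu> W > 0" by (intro open_pos_measure) auto
  have W: "W \<in> sets \<mu>" using \<open>open W\<close> by simp
  have "(\<integral>y. f x / 2 * indicator W y \<partial>\<mu>) \<le> (\<integral>y. f y \<partial>\<mu>)"
  proof (rule integral_mono)
    show "integrable \<mu> (\<lambda>y. f x / 2 * indicator W y)"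
      using W by (intro integrable_mult_right integrable_real_indicator) (auto simp: emeasure_eq_measure)
    show "f x / 2 * indicator W y \<le> f y" for y
      using f(2)[of y] by (auto simp: W_def indicator_def)
  qed (rule integrable_continuous[OF f(1)])
  also have "(\<integral>y. f x / 2 * indicator W y \<partial>\<mu>) = f x / 2 * measure \<mu> W" by simp
  finally show False using pos zero x f(2)[of x] by (simp add: mult_le_0_iff)
qed

end

subsection \<open>Convolution\<close>

context haar_group
begin

lemma apply_Bcontfun:
  fixes f :: "'x \<Rightarrow> complex"
  shows "continuous_on UNIV f \<Longrightarrow> apply_bcontfun (Bcontfun f) = f"
  using bounded_range[of f] by (intro Bcontfun_inverse) (simp add: bcontfun_def)

lemma continuous_apply [continuous_intros]:
  fixes f :: "'x \<Rightarrow>\<^sub>C complex"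
  shows "continuous_on S g \<Longrightarrow> continuous_on S (\<lambda>x. f (g x))"
  using continuous_on_compose2[OF continuous_on_apply_bcontfun[of UNIV f]] by blast

lemma continuous_apply' [simp, intro]:
  fixes f :: "'x \<Rightarrow>\<^sub>C complex"
  shows "continuous_on S (\<lambda>x. f x)"
  using continuous_on_apply_bcontfun .

text \<open>Convolution stays inside the bounded continuous functions instead of L2. The uniform
  norm is complete there, and limits of convolution powers can be evaluated at 0. The L2 norm enters
  only through \<open>sqnorm\<close>.\<close>

definition conv :: "('x \<Rightarrow>\<^sub>C complex) \<Rightarrow> ('x \<Rightarrow>\<^sub>C complex) \<Rightarrow> ('x \<Rightarrow>\<^sub>C complex)" (infixl "\<star>" 70) where
  "f \<star> g = Bcontfun (\<lambda>x. \<integral>y. f y * g (x - y) \<partial>\<mu>)"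

definition star :: "('x \<Rightarrow>\<^sub>C complex) \<Rightarrow> ('x \<Rightarrow>\<^sub>C complex)" where
  "star f = Bcontfun (\<lambda>x. cnj (f (- x)))"

definition shift :: "'x \<Rightarrow> ('x \<Rightarrow>\<^sub>C complex) \<Rightarrow> ('x \<Rightarrow>\<^sub>C complex)" where
  "shift a f = Bcontfun (\<lambda>x. f (x + a))"

definition cmult :: "complex \<Rightarrow> ('x \<Rightarrow>\<^sub>C complex) \<Rightarrow> ('x \<Rightarrow>\<^sub>C complex)" where
  "cmult c f = Bcontfun (\<lambda>x. c * f x)"

definition sqnorm :: "('x \<Rightarrow>\<^sub>C complex) \<Rightarrow> real" where
  "sqnorm f = (\<integral>x. (cmod (f x))\<^sup>2 \<partial>\<mu>)"

lemma conv_apply: "(f \<star> g) x = (\<integral>y. f y * g (x - y) \<partial>\<mu>)"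
proof -
  have "continuous_on UNIV (\<lambda>x. \<integral>y. f y * g (x - y) \<partial>\<mu>)"
    by (rule continuous_on_integral) (intro continuous_intros)
  then show ?thesis unfolding conv_def by (subst apply_Bcontfun) auto
qed

lemma star_apply [simp]: "star f x = cnj (f (- x))"
proof -
  have "continuous_on UNIV (\<lambda>x. cnj (f (- x)))" by (intro continuous_intros)
  then show ?thesis unfolding star_def by (subst apply_Bcontfun) auto
qed

lemma shift_apply [simp]: "shift a f x = f (x + a)"
proof -
  have "continuous_on UNIV (\<lambda>x. f (x + a))" by (intro continuous_intros)
  then show ?thesis unfolding shift_def by (subst apply_Bcontfun) auto
qed

lemma cmult_apply [simp]: "cmult c f x = c * f x"
proof -
  have "continuous_on UNIV (\<lambda>x. c * f x)" by (intro continuous_intros continuous_apply')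
  then show ?thesis unfolding cmult_def by (subst apply_Bcontfun) auto
qed

lemma conv_commute: "f \<star> g = g \<star> f"
proof (rule bcontfun_eqI)
  fix x
  have "(\<integral>y. f (x - y) * g (x - (x - y)) \<partial>\<mu>) = (\<integral>y. f y * g (x - y) \<partial>\<mu>)"
    by (rule integral_reflect[of "\<lambda>y. f y * g (x - y)"]) (intro continuous_intros)
  then show "(f \<star> g) x = (g \<star> f) x" by (simp add: conv_apply mult.commute)
qed

lemma conv_assoc: "(f \<star> g) \<star> h = f \<star> (g \<star> h)"
proof (rule bcontfun_eqI)
  fix x
  have inner: "(\<integral>y. g (y - z) * h (x - y) \<partial>\<mu>) = (g \<star> h) (x - z)" for z
  proof -
    have "continuous_on UNIV (\<lambda>y. g y * h (x - z - y))" by (intro continuous_intros)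
    from integral_translate[OF measurable_continuous[OF this], of "- z"]
    show ?thesis by (simp add: conv_apply algebra_simps)
  qed
  have "((f \<star> g) \<star> h) x = (\<integral>y. (\<integral>z. f z * g (y - z) \<partial>\<mu>) * h (x - y) \<partial>\<mu>)"
    by (simp add: conv_apply)
  also have "\<dots> = (\<integral>y. \<integral>z. f z * (g (y - z) * h (x - y)) \<partial>\<mu> \<partial>\<mu>)"
    by (simp flip: integral_mult_left_zero add: mult.assoc)
  also have "\<dots> = (\<integral>z. \<integral>y. f z * (g (y - z) * h (x - y)) \<partial>\<mu> \<partial>\<mu>)"
    by (rule integral_swap) (intro continuous_intros)
  also have "\<dots> = (\<integral>z. f z * (\<integral>y. g (y - z) * h (x - y) \<partial>\<mu>) \<partial>\<mu>)" by simp
  also have "\<dots> = (f \<star> (g \<star> h)) x" by (simp only: inner conv_apply)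
  finally show "((f \<star> g) \<star> h) x = (f \<star> (g \<star> h)) x" .
qed

lemma integrable_conv: "integrable \<mu> (\<lambda>y. f y * g (x - y))" for f g :: "'x \<Rightarrow>\<^sub>C complex"
  by (rule integrable_continuous) (intro continuous_intros)

lemma conv_bounded_bilinear: "bounded_bilinear (\<star>)"
proof
  show "(a + a') \<star> b = a \<star> b + a' \<star> b" for a a' b
    by (rule bcontfun_eqI) (simp add: conv_apply distrib_right integrable_conv)
  show "a \<star> (b + b') = a \<star> b + a \<star> b'" for a b b'
    by (rule bcontfun_eqI) (simp add: conv_apply distrib_left integrable_conv)
  show "(r *\<^sub>R a) \<star> b = r *\<^sub>R (a \<star> b)" for r a b
    by (rule bcontfun_eqI) (simp add: conv_apply)
  show "a \<star> (r *\<^sub>R b) = r *\<^sub>R (a \<star> b)" for r a b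
    by (rule bcontfun_eqI) (simp add: conv_apply)
  have "norm (a \<star> b) \<le> norm a * norm b * 1" for a b
    unfolding mult_1_right
  proof (rule norm_bound)
    show "norm ((a \<star> b) x) \<le> norm a * norm b" for x
      unfolding conv_apply
      by (rule norm_integral_le) (auto intro!: continuous_intros mult_mono norm_bounded simp: norm_mult)
  qed
  then show "\<exists>K. \<forall>a b. norm (a \<star> b) \<le> norm a * norm b * K" by blast
qed

interpretation conv: bounded_bilinear "(\<star>)" by (rule conv_bounded_bilinear)

lemma cmult_conv: "cmult c f \<star> g = cmult c (f \<star> g)"
  by (rule bcontfun_eqI) (simp add: conv_apply mult.assoc)

lemma shift_conv: "shift a f \<star> g = shift a (f \<star> g)"
proof -
  have "f \<star> shift a g = shift a (f \<star> g)" for f g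
    by (rule bcontfun_eqI) (simp add: conv_apply algebra_simps)
  then show ?thesis by (metis conv_commute)
qed

lemma star_conv: "star (f \<star> g) = star f \<star> star g"
proof (rule bcontfun_eqI)
  fix x
  have "continuous_on UNIV (\<lambda>y. cnj (f y) * cnj (g (- x - y)))" by (intro continuous_intros continuous_apply')
  note minus = integral_minus_arg[OF this]
  have "star (f \<star> g) x = (\<integral>y. cnj (f y * g (- x - y)) \<partial>\<mu>)"
    unfolding star_apply conv_apply by (rule Bochner_Integration.integral_cnj[symmetric])
  also have "\<dots> = (\<integral>y. cnj (f (- y)) * cnj (g (- x - - y)) \<partial>\<mu>)"
    unfolding minus by simp
  also have "\<dots> = (star f \<star> star g) x" by (simp add: conv_apply add.commute)
  finally show "star (f \<star> g) x = (star f \<star> star g) x" .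
qed

lemma star_add: "star (f + g) = star f + star g"
  by (rule bcontfun_eqI) simp

lemma star_diff: "star (f - g) = star f - star g"
  by (rule bcontfun_eqI) simp

lemma star_scaleR: "star (r *\<^sub>R f) = r *\<^sub>R star f"
  by (rule bcontfun_eqI) simp

lemma star_star [simp]: "star (star f) = f"
  by (rule bcontfun_eqI) simp

lemma norm_star_le: "norm (star f) \<le> norm f"
  by (rule norm_bound) (simp add: norm_bounded)

lemma tendsto_star:
  assumes "f \<longlonglongrightarrow> l"
  shows "(\<lambda>n. star (f n)) \<longlonglongrightarrow> star l"
proof -
  have "norm (star (f n) - star l) \<le> norm (f n - l) * 1" for n
    using norm_star_le[of "f n - l"] by (simp add: star_diff)
  then have "(\<lambda>n. star (f n) - star l) \<longlonglongrightarrow> 0"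
    by (intro tendsto_0_le[OF LIM_zero[OF assms], of _ 1] always_eventually allI)
  then show ?thesis by (rule LIM_zero_cancel)
qed

lemma tendsto_apply:
  fixes f :: "nat \<Rightarrow> 'x \<Rightarrow>\<^sub>C complex"
  assumes "f \<longlonglongrightarrow> l"
  shows "(\<lambda>n. f n x) \<longlonglongrightarrow> l x"
  using tendsto_uniform_limitI[OF tendsto_bcontfun_uniform_limit[OF assms], of x] by simp

text \<open>Evaluation at 0 is thus a faithful positive trace on the convolution algebra.\<close>

lemma conv_star_zero: "(f \<star> star f) 0 = of_real (sqnorm f)"
proof -
  have "(f \<star> star f) 0 = (\<integral>y. of_real ((cmod (f y))\<^sup>2) \<partial>\<mu>)"
    by (simp add: conv_apply complex_norm_square del: of_real_power)
  then show ?thesis by (simp add: sqnorm_def del: of_real_power)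
qed

lemma sqnorm_nonneg: "sqnorm f \<ge> 0"
  unfolding sqnorm_def by simp

lemma integrable_sq: "integrable \<mu> (\<lambda>x. (cmod (f x))\<^sup>2)" for f :: "'x \<Rightarrow>\<^sub>C complex"
  by (rule integrable_continuous) (intro continuous_intros continuous_apply')

lemma sqnorm_zero_iff: "sqnorm f = 0 \<longleftrightarrow> f = 0"
proof
  assume "sqnorm f = 0"
  then have "(cmod (f x))\<^sup>2 = 0" for x
    unfolding sqnorm_def
    by (intro integral_zero_imp_zero[of "\<lambda>x. (cmod (f x))\<^sup>2"] continuous_intros continuous_apply') auto
  then show "f = 0" by (intro bcontfun_eqI) simp
qed (simp add: sqnorm_def)

lemma sqnorm_le: "sqnorm f \<le> (norm f)\<^sup>2"
proof -
  have "sqnorm f \<le> (\<integral>x. (norm f)\<^sup>2 \<partial>\<mu>)"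
    unfolding sqnorm_def by (intro integral_mono integrable_sq) (auto intro: power_mono norm_bounded)
  then show ?thesis by simp
qed

lemma Cauchy_Schwarz_integral:
  fixes u v :: "'x \<Rightarrow> real"
  assumes "continuous_on UNIV u" "continuous_on UNIV v"
  shows "(\<integral>x. u x * v x \<partial>\<mu>)\<^sup>2 \<le> (\<integral>x. (u x)\<^sup>2 \<partial>\<mu>) * (\<integral>x. (v x)\<^sup>2 \<partial>\<mu>)"
proof -
  define A where "A = (\<integral>x. (u x)\<^sup>2 \<partial>\<mu>)"
  define B where "B = (\<integral>x. u x * v x \<partial>\<mu>)"
  define S where "S = (\<integral>x. (v x)\<^sup>2 \<partial>\<mu>)"
  have int: "integrable \<mu> (\<lambda>x. (u x)\<^sup>2)" "integrable \<mu> (\<lambda>x. u x * v x)" "integrable \<mu> (\<lambda>x. (v x)\<^sup>2)"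
    by (intro integrable_continuous continuous_intros assms)+
  have q: "0 \<le> s\<^sup>2 * A - 2 * s * t * B + t\<^sup>2 * S" for s t
  proof -
    have "0 \<le> (\<integral>x. (s * u x - t * v x)\<^sup>2 \<partial>\<mu>)" by simp
    also have "\<dots> = (\<integral>x. s\<^sup>2 * (u x)\<^sup>2 - (2 * s * t) * (u x * v x) + t\<^sup>2 * (v x)\<^sup>2 \<partial>\<mu>)"
      by (intro Bochner_Integration.integral_cong) (auto simp: power2_eq_square algebra_simps)
    also have "\<dots> = s\<^sup>2 * A - 2 * s * t * B + t\<^sup>2 * S"
      using int by (simp add: A_def B_def S_def)
    finally show ?thesis .
  qed
  have "S \<ge> 0" by (simp add: S_def)
  show ?thesis unfolding A_def[symmetric] B_def[symmetric] S_def[symmetric]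
  proof (cases "S = 0")
    case True
    have "B = 0"
    proof (rule ccontr)
      assume "B \<noteq> 0"
      \<comment> \<open>For S = 0 this choice makes the quadratic form equal to -1.\<close>
      then show False using q[of 1 "(A + 1) / (2 * B)"] True by simp
    qed
    then show "B\<^sup>2 \<le> A * S" using True by simp
  next
    case False
    have "0 \<le> S * (A * S - B\<^sup>2)" using q[of S B] by (simp add: power2_eq_square algebra_simps)
    then show "B\<^sup>2 \<le> A * S" using False \<open>S \<ge> 0\<close> by (simp add: zero_le_mult_iff)
  qed
qed

lemma sqnorm_reflect: 
  fixes g :: "'x \<Rightarrow>\<^sub>C complex"
  shows "(\<integral>y. (cmod (g (x - y)))\<^sup>2 \<partial>\<mu>) = sqnorm g"
proof -
  have "continuous_on UNIV (\<lambda>y. complex_of_real ((cmod (g y))\<^sup>2))"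
    by (intro continuous_intros continuous_apply')
  from integral_reflect[OF this, of x] show ?thesis
    by (simp add: sqnorm_def del: of_real_power)
qed

lemma cmod_conv_le: "(cmod ((f \<star> g) x))\<^sup>2 \<le> sqnorm f * sqnorm g"
proof -
  have "cmod ((f \<star> g) x) \<le> (\<integral>y. cmod (f y * g (x - y)) \<partial>\<mu>)"
    unfolding conv_apply by simp
  then have "(cmod ((f \<star> g) x))\<^sup>2 \<le> (\<integral>y. cmod (f y) * cmod (g (x - y)) \<partial>\<mu>)\<^sup>2"
    by (intro power_mono) (auto simp: norm_mult)
  also have "\<dots> \<le> sqnorm f * (\<integral>y. (cmod (g (x - y)))\<^sup>2 \<partial>\<mu>)"
    unfolding sqnorm_def by (rule Cauchy_Schwarz_integral) (intro continuous_intros continuous_apply')+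
  finally show ?thesis by (simp only: sqnorm_reflect)
qed

text \<open>Convolution turns an L2 estimate into a uniform one. This is what lets L2 convergence of
  the powers below yield a continuous limit.\<close>

lemma norm_conv_le: "(norm (f \<star> g))\<^sup>2 \<le> sqnorm f * sqnorm g"
proof -
  have "norm (f \<star> g) \<le> sqrt (sqnorm f * sqnorm g)"
    by (rule norm_bound) (simp add: cmod_conv_le real_le_rsqrt)
  then have "(norm (f \<star> g))\<^sup>2 \<le> (sqrt (sqnorm f * sqnorm g))\<^sup>2" by (intro power_mono) auto
  then show ?thesis by (simp add: sqnorm_nonneg)
qed

lemma sqnorm_hermitian: "star f = f \<Longrightarrow> (f \<star> f) 0 = of_real (sqnorm f)"
  using conv_star_zero[of f] by simp

lemma norm_square_hermitian_le:
  assumes "star f = f"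
  shows "norm (f \<star> f) \<le> sqnorm f"
  using norm_conv_le[of f f] sqnorm_nonneg[of f] by (simp flip: power2_eq_square add: power2_le_iff_abs_le)

end

subsection \<open>Characters\<close>

typedef (overloaded) 'x character =
  "{\<phi> :: 'x::topological_ab_group_add \<Rightarrow> complex.
    continuous_on UNIV \<phi> \<and> (\<forall>x y. \<phi> (x + y) = \<phi> x * \<phi> y) \<and> (\<forall>x. cmod (\<phi> x) = 1)}"
  morphisms eval Character
  by (intro exI[of _ "\<lambda>_. 1"]) simp

setup_lifting type_definition_character

lemma continuous_eval [continuous_intros]:
  "continuous_on S f \<Longrightarrow> continuous_on S (\<lambda>x. eval c (f x))"
  using eval[of c] continuous_on_compose2[of UNIV "eval c" S f] by auto

lemma eval_arg_add: "eval c (x + y) = eval c x * eval c y"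
  by transfer blast

lemma cmod_eval [simp]: "cmod (eval c x) = 1"
  by transfer blast

lemma eval_nonzero [simp]: "eval c x \<noteq> 0"
  using cmod_eval[of c x] by (metis norm_zero zero_neq_one)

lemma eval_arg_zero [simp]: "eval c 0 = 1"
  using eval_arg_add[of c 0 0] by simp

lemma eval_times_cnj [simp]: "eval c x * cnj (eval c x) = 1" "cnj (eval c x) * eval c x = 1"
  using complex_norm_square[of "eval c x"] by (simp_all add: mult.commute)

lemma eval_arg_minus [simp]: "eval c (- x) = cnj (eval c x)"
proof -
  have "eval c x * eval c (- x) = eval c x * cnj (eval c x)"
    using eval_arg_add[of c x "- x"] by simp
  then show ?thesis using mult_left_cancel[OF eval_nonzero] by blast
qed

lemma eval_arg_diff: "eval c (x - y) = eval c x * cnj (eval c y)"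
  using eval_arg_add[of c x "- y"] by simp

lemma character_eqI: "(\<And>x. eval c x = eval d x) \<Longrightarrow> c = d"
  by transfer auto

text \<open>The dual group is written additively so that it can be the ambient group of
  \<open>group_module\<close>.\<close>

instantiation character :: (topological_ab_group_add) ab_group_add
begin

lift_definition zero_character :: "'a character" is "\<lambda>_. 1" by simp
lift_definition plus_character :: "'a character \<Rightarrow> 'a character \<Rightarrow> 'a character"
  is "\<lambda>c d x. c x * d x" by (auto intro!: continuous_intros simp: norm_mult)
lift_definition uminus_character :: "'a character \<Rightarrow> 'a character"
  is "\<lambda>c x. cnj (c x)" by (auto intro!: continuous_intros)
lift_definition minus_character :: "'a character \<Rightarrow> 'a character \<Rightarrow> 'a character"
  is "\<lambda>c d x. c x * cnj (d x)" by (auto intro!: continuous_intros simp: norm_mult)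

lemma eval_zero [simp]: "eval 0 x = 1"
  by transfer simp

lemma eval_add: "eval (c + d) x = eval c x * eval d x"
  by transfer simp

lemma eval_uminus [simp]: "eval (- c) x = cnj (eval c x)"
  by transfer simp

lemma eval_diff: "eval (c - d) x = eval c x * cnj (eval d x)"
  by transfer simp

instance
  by standard (auto intro!: character_eqI simp: eval_add eval_diff mult_ac)

end

subsection \<open>Completeness of the characters\<close>

text \<open>Log-convexity makes the ratios increase to a limit \<open>\<kappa>\<close>, so the
  normalised sequence b decreases. Were some b m below 1, doubling would force b to decay
  geometrically along the indices n with n + 1 = 2^j (m + 1). But its ratios tend to 1, so it decays
  more slowly than any geometric sequence.\<close>

lemma doubling_sequence_normalisation:
  fixes a :: "nat \<Rightarrow> real"
  assumes pos: "\<And>n. a n > 0" and logconvex: "\<And>n. (a (Suc n))\<^sup>2 \<le> a n * a (Suc (Suc n))"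
    and bounded: "\<And>n. a (Suc n) \<le> S * a n" and double: "\<And>n. a (2 * n + 1) \<le> (a n)\<^sup>2"
  obtains \<kappa> b where "\<kappa> > 0" "(\<lambda>n. a n / \<kappa> ^ Suc n) \<longlonglongrightarrow> b" "b \<ge> 1"
proof -
  define r where "r n = a (Suc n) / a n" for n
  have r_pos: "r n > 0" for n using pos by (simp add: r_def)
  have r_Suc: "r n \<le> r (Suc n)" for n
    using logconvex[of n] pos[of n] pos[of "Suc n"] by (simp add: r_def divide_simps power2_eq_square mult.commute)
  have r_mono: "incseq r" using r_Suc by (rule incseq_SucI)
  have r_bound: "r n \<le> S" for n using bounded[of n] pos[of n] by (simp add: r_def divide_simps)
  obtain \<kappa> where lim: "r \<longlonglongrightarrow> \<kappa>" and r_le: "\<And>n. r n \<le> \<kappa>"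
    using incseq_convergent[OF r_mono] r_bound by blast
  have lam: "\<kappa> > 0" using r_pos[of 0] r_le[of 0] by simp
  define b where "b n = a n / \<kappa> ^ Suc n" for n
  have b_pos: "b n > 0" for n using pos lam by (simp add: b_def)
  have b_Suc: "b (Suc n) = b n * (r n / \<kappa>)" for n
    using pos[of n] lam by (simp add: b_def r_def)
  have b_dec: "decseq b"
  proof (rule decseq_SucI)
    show "b (Suc n) \<le> b n" for n
      unfolding b_Suc using b_pos[of n] r_le[of n] lam by (intro mult_right_le_one_le) (auto simp: r_pos less_imp_le)
  qed
  have b_double: "b (2 * n + 1) \<le> (b n)\<^sup>2" for n
  proof -
    have "b (2 * n + 1) = a (2 * n + 1) / (\<kappa> ^ Suc n)\<^sup>2"
      by (simp add: b_def power2_eq_square flip: power_add) (simp add: mult_2)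
    also have "\<dots> \<le> (a n)\<^sup>2 / (\<kappa> ^ Suc n)\<^sup>2" using double[of n] by (intro divide_right_mono) auto
    finally show ?thesis by (simp add: b_def power_divide)
  qed
  have b_ge: "b m \<ge> 1" for m
  proof (rule ccontr)
    assume "\<not> b m \<ge> 1"
    then have bm: "b m < 1" by simp
    have idx: "\<exists>n. Suc n = 2 ^ j * Suc m \<and> b n \<le> b m ^ 2 ^ j" for j :: nat
    proof (induction j)
      case 0
      then show ?case by auto
    next
      case (Suc j)
      then obtain n where n: "Suc n = 2 ^ j * Suc m" "b n \<le> b m ^ 2 ^ j" by blast
      have "b (2 * n + 1) \<le> (b n)\<^sup>2" by (rule b_double)
      also have "\<dots> \<le> (b m ^ 2 ^ j)\<^sup>2" using n b_pos[of n] by (intro power_mono) auto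
      finally have "b (2 * n + 1) \<le> b m ^ 2 ^ Suc j" by (simp add: power_mult[symmetric] mult.commute)
      moreover have "Suc (2 * n + 1) = 2 ^ Suc j * Suc m" using n(1) by simp
      ultimately show ?case by blast
    qed
    \<comment> \<open>d^(m+1) is the midpoint between b m and 1: decay at rate d is slower than the
      decay forced by doubling but still geometric.\<close>
    define d where "d = root (Suc m) ((b m + 1) / 2)"
    have d: "d ^ Suc m = (b m + 1) / 2" "0 < d" "d < 1"
      unfolding d_def using b_pos[of m] bm by (auto simp: real_root_pow_pos2 simp del: power_Suc)
    have "\<forall>\<^sub>F n in sequentially. r n > \<kappa> * d"
      using order_tendstoD(1)[OF lim, of "\<kappa> * d"] lam d by simp
    then obtain N where N: "\<And>n. n \<ge> N \<Longrightarrow> r n > \<kappa> * d" unfolding eventually_sequentially by blast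
    have lower: "b (N + k) \<ge> b N * d ^ k" for k
    proof (induction k)
      case (Suc k)
      have "b N * d ^ Suc k = (b N * d ^ k) * d" by simp
      also have "\<dots> \<le> b (N + k) * (r (N + k) / \<kappa>)"
        using Suc N[of "N + k"] lam d b_pos by (intro mult_mono) (auto simp: field_simps less_imp_le)
      finally show ?case using b_Suc[of "N + k"] by simp
    qed simp
    have ge: "b n \<ge> b N * d ^ Suc n" if "n \<ge> N" for n
    proof -
      have "d ^ Suc n \<le> d ^ (n - N)" using d by (intro power_decreasing) auto
      then have "b N * d ^ Suc n \<le> b N * d ^ (n - N)" using b_pos[of N] by simp
      then show ?thesis using lower[of "n - N"] that by simp
    qed
    define q where "q = b m / d ^ Suc m"
    have q: "0 < q" "q < 1" unfolding q_def d(1) using b_pos[of m] bm by auto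
    \<comment> \<open>Compare the lower bound by powers of d with the upper bound by powers of b m
      at the index n with n + 1 = 2^j (m + 1).\<close>
    have "b N \<le> q ^ 2 ^ j" if j: "j \<ge> N" for j
    proof -
      obtain n where n: "Suc n = 2 ^ j * Suc m" "b n \<le> b m ^ 2 ^ j" using idx by blast
      have "N < 2 ^ j" using j less_exp le_less_trans by blast
      also have "\<dots> \<le> 2 ^ j * Suc m" by simp
      finally have "n \<ge> N" using n(1) by simp
      then have "b N * d ^ (2 ^ j * Suc m) \<le> b m ^ 2 ^ j" using ge[of n] n by simp
      also have "d ^ (2 ^ j * Suc m) = (d ^ Suc m) ^ 2 ^ j" by (simp only: power_mult mult.commute)
      finally show ?thesis
        unfolding q_def power_divide using d(2) by (subst pos_le_divide_eq) auto
    qed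
    moreover have "q ^ 2 ^ j \<le> q ^ j" for j :: nat
      using q less_exp[of j] by (intro power_decreasing) auto
    ultimately have "\<forall>\<^sub>F j in sequentially. b N \<le> q ^ j"
      unfolding eventually_sequentially by (meson order_trans)
    moreover have "(\<lambda>j. q ^ j) \<longlonglongrightarrow> 0" using q by (intro LIMSEQ_power_zero) auto
    ultimately have "b N \<le> 0" using tendsto_lowerbound by (metis trivial_limit_sequentially)
    then show False using b_pos[of N] by simp
  qed
  obtain B where B: "b \<longlonglongrightarrow> B"
    using decseq_convergent[OF b_dec, of 1] b_ge by blast
  have "B \<ge> 1" by (rule LIMSEQ_le_const[OF B]) (use b_ge in auto)
  then show ?thesis using that[OF lam _ \<open>B \<ge> 1\<close>] B unfolding b_def by blast
qed

context haar_group
begin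

interpretation conv: bounded_bilinear "(\<star>)" by (rule conv_bounded_bilinear)

text \<open>\<open>cpow g n\<close> is the (n + 1)-fold convolution power; counting starts there
  because convolution need not have a unit.\<close>

primrec cpow :: "('x \<Rightarrow>\<^sub>C complex) \<Rightarrow> nat \<Rightarrow> ('x \<Rightarrow>\<^sub>C complex)" where
  "cpow g 0 = g"
| "cpow g (Suc n) = g \<star> cpow g n"

lemma cpow_conv: "cpow g m \<star> cpow g n = cpow g (m + n + 1)"
  by (induction m) (auto simp: conv_assoc)

lemma star_cpow: "star g = g \<Longrightarrow> star (cpow g n) = cpow g n"
  by (induction n) (auto simp: star_conv)

lemma cpow_unit: "g \<star> e = g \<Longrightarrow> cpow g n \<star> e = cpow g n"
  by (induction n) (auto simp: conv_assoc)

text \<open>Convolution with such a function is an orthogonal projection, and its value at 0 is the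
  trace of that projection, the dimension of its range.\<close>

definition projection :: "('x \<Rightarrow>\<^sub>C complex) \<Rightarrow> bool" where
  "projection p \<longleftrightarrow> star p = p \<and> p \<star> p = p"

text \<open>The normalised powers of \<open>g \<star> g\<close> converge to the projection onto its top eigenspace.
  Boundedness of that limit away from zero replaces compactness of the convolution operator: it
  comes from \<open>sqnorm (f \<star> f) \<le> (sqnorm f)\<^sup>2\<close>, which uses that the total mass is one.\<close>

lemma top_eigenprojection:
  assumes g: "star g = g" "g \<noteq> 0"
  obtains \<kappa> p where "\<kappa> > 0" "projection p" "p \<noteq> 0" "(g \<star> g) \<star> p = \<kappa> *\<^sub>R p"
    "\<And>e. g \<star> e = g \<Longrightarrow> p \<star> e = p"
proof -
  define a where "a n = sqnorm (cpow g n)" for n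
  note herm = star_cpow[OF g(1)]
  have a_val: "cpow g (2 * n + 1) 0 = of_real (a n)" for n
    using sqnorm_hermitian[OF herm, of n] by (simp add: a_def cpow_conv mult_2)
  have a_nonneg: "a n \<ge> 0" for n by (simp add: a_def sqnorm_nonneg)
  have logconvex: "(a (Suc n))\<^sup>2 \<le> a n * a (Suc (Suc n))" for n
  proof -
    have "cpow g n \<star> cpow g (Suc (Suc n)) = cpow g (2 * Suc n + 1)"
      unfolding cpow_conv by (rule arg_cong[where f = "cpow g"]) simp
    then have "(cmod (of_real (a (Suc n))))\<^sup>2 \<le> a n * a (Suc (Suc n))"
      using cmod_conv_le[of "cpow g n" "cpow g (Suc (Suc n))" 0] a_val[of "Suc n"] by (simp add: a_def)
    then show ?thesis by simp
  qed
  have a0: "a 0 > 0" using g sqnorm_zero_iff[of g] sqnorm_nonneg[of g] by (simp add: a_def order_less_le)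
  have a1: "a 1 > 0"
  proof -
    have "cpow g 1 0 \<noteq> 0" using a_val[of 0] a0 by simp
    then have "cpow g 1 \<noteq> 0" by auto
    then show ?thesis using sqnorm_zero_iff[of "cpow g 1"] sqnorm_nonneg[of "cpow g 1"]
      unfolding a_def by (simp only: order_less_le) simp
  qed
  have a_Suc_pos: "a (Suc n) > 0" for n
  proof (induction n)
    case (Suc n)
    have "0 < (a (Suc n))\<^sup>2" using Suc by simp
    then have "0 < a n * a (Suc (Suc n))" using logconvex[of n] by linarith
    then show ?case using a_nonneg[of n] a_nonneg[of "Suc (Suc n)"] by (simp add: zero_less_mult_iff)
  qed (use a1 in simp)
  have a_pos: "a n > 0" for n using a0 a_Suc_pos by (cases n) auto
  have bounded: "a (Suc n) \<le> sqnorm g * a n" for n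
    using sqnorm_le[of "cpow g (Suc n)"] norm_conv_le[of g "cpow g n"] by (simp add: a_def)
  have double: "a (2 * n + 1) \<le> (a n)\<^sup>2" for n
  proof -
    have "cpow g n \<star> cpow g n = cpow g (2 * n + 1)" unfolding cpow_conv by (simp add: mult_2)
    then have "norm (cpow g (2 * n + 1)) \<le> a n"
      using norm_square_hermitian_le[OF herm, of n] by (simp add: a_def)
    then have "(norm (cpow g (2 * n + 1)))\<^sup>2 \<le> (a n)\<^sup>2" by (intro power_mono) auto
    then show ?thesis using sqnorm_le[of "cpow g (2 * n + 1)"] unfolding a_def by linarith
  qed
  obtain \<kappa> b where lam: "\<kappa> > 0" and b: "(\<lambda>n. a n / \<kappa> ^ Suc n) \<longlonglongrightarrow> b" "b \<ge> 1"
    using doubling_sequence_normalisation[OF a_pos logconvex bounded double] by blast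
  define \<beta> where "\<beta> n = a n / \<kappa> ^ Suc n" for n
  \<comment> \<open>The (n + 1)-st power of g \<star> g divided by the same power of
    \<open>\<kappa>\<close>, so that the \<open>q n\<close> multiply by adding exponents.\<close>
  define q where "q n = (1 / \<kappa> ^ Suc n) *\<^sub>R cpow g (2 * n + 1)" for n
  have q_conv: "q n \<star> q m = q (n + m + 1)" for n m
  proof -
    have "cpow g (2 * n + 1) \<star> cpow g (2 * m + 1) = cpow g (2 * (n + m + 1) + 1)"
      unfolding cpow_conv by (rule arg_cong[where f = "cpow g"]) simp
    then show ?thesis
      by (simp only: q_def conv.scaleR_left conv.scaleR_right scaleR_scaleR) (simp add: power_add mult_ac)
  qed
  have q_star: "star (q n) = q n" for n unfolding q_def star_scaleR herm ..
  have q_zero: "q n 0 = of_real (\<beta> n)" for n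
    using a_val[of n] by (simp add: q_def \<beta>_def scaleR_conv_of_real)
  have q_sq: "sqnorm (q n - q m) = \<beta> (2 * n + 1) - 2 * \<beta> (n + m + 1) + \<beta> (2 * m + 1)" for n m
  proof -
    have "star (q n - q m) = q n - q m" by (simp add: star_diff q_star)
    then have "of_real (sqnorm (q n - q m)) = ((q n - q m) \<star> (q n - q m)) 0"
      by (rule sqnorm_hermitian[symmetric])
    also have "(q n - q m) \<star> (q n - q m) = q (2 * n + 1) - 2 *\<^sub>R q (n + m + 1) + q (2 * m + 1)"
      by (simp add: conv.diff_left conv.diff_right q_conv algebra_simps mult_2 mult_2_right scaleR_2)
    also have "\<dots> 0 = of_real (\<beta> (2 * n + 1) - 2 * \<beta> (n + m + 1) + \<beta> (2 * m + 1))"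
      by (simp only: plus_bcontfun.rep_eq minus_bcontfun.rep_eq scaleR_bcontfun.rep_eq q_zero)
        (simp add: scaleR_conv_of_real)
    finally show ?thesis by (simp only: of_real_eq_iff)
  qed
  have \<beta>: "\<beta> \<longlonglongrightarrow> b" using b(1) by (simp add: \<beta>_def[abs_def])
  have q0: "sqnorm (q 0) \<ge> 0" by (rule sqnorm_nonneg)
  \<comment> \<open>Convergence of \<open>\<beta>\<close> controls the L2 distances. Convolution
    with \<open>q 0\<close> makes them uniform and shifts the index by one, because
    \<open>q 0 \<star> q n = q (n + 1)\<close>.\<close>
  have "Cauchy (\<lambda>n. q (Suc n))"
  proof (rule CauchyI)
    fix e :: real assume e: "e > 0"
    \<comment> \<open>Values of \<open>\<beta>\<close> within d of b bound the expression in
      \<open>q_sq\<close> by 4 d, and \<open>(sqnorm (q 0) + 1) * (4 * d)\<close> is the square of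
      e.\<close>
    define d where "d = e\<^sup>2 / (4 * (sqnorm (q 0) + 1))"
    have d: "d > 0" using e q0 by (simp add: d_def)
    obtain N where N: "\<And>n. n \<ge> N \<Longrightarrow> \<bar>\<beta> n - b\<bar> < d"
      using LIMSEQ_D[OF \<beta> d] by auto
    have "norm (q (Suc n) - q (Suc m)) < e" if nm: "n \<ge> N" "m \<ge> N" for n m
    proof -
      have "sqnorm (q n - q m) \<le> 4 * d"
        unfolding q_sq using N[of "2 * n + 1"] N[of "2 * m + 1"] N[of "n + m + 1"] nm by linarith
      then have "sqnorm (q 0) * sqnorm (q n - q m) \<le> sqnorm (q 0) * (4 * d)"
        using q0 by (rule mult_left_mono)
      also have "\<dots> < (sqnorm (q 0) + 1) * (4 * d)" using d by simp
      also have "\<dots> = e\<^sup>2"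
      proof -
        have "sqnorm (q 0) + 1 \<noteq> 0" using q0 by linarith
        then show ?thesis by (simp only: d_def) (simp add: divide_simps)
      qed
      finally have "(norm (q 0 \<star> (q n - q m)))\<^sup>2 < e\<^sup>2"
        using norm_conv_le[of "q 0" "q n - q m"] by linarith
      then have "norm (q 0 \<star> (q n - q m)) < e" using e power_less_imp_less_base[of _ 2 e] by simp
      then show ?thesis by (simp add: conv.diff_right q_conv)
    qed
    then show "\<exists>M. \<forall>m\<ge>M. \<forall>n\<ge>M. norm (q (Suc m) - q (Suc n)) < e" by blast
  qed
  then obtain p where p: "(\<lambda>n. q (Suc n)) \<longlonglongrightarrow> p"
    using Cauchy_convergent convergent_def by blast
  then have q_lim: "q \<longlonglongrightarrow> p" by (rule LIMSEQ_imp_Suc)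
  have "star p = p"
    using tendsto_star[OF q_lim] q_lim unfolding q_star by (rule LIMSEQ_unique)
  moreover have "p \<star> p = p"
  proof (rule LIMSEQ_unique)
    show "(\<lambda>n. q n \<star> q n) \<longlonglongrightarrow> p \<star> p" by (intro conv.tendsto q_lim)
    have "strict_mono (\<lambda>n::nat. n + n + 1)" by (auto simp: strict_mono_def)
    from LIMSEQ_subseq_LIMSEQ[OF q_lim this] show "(\<lambda>n. q n \<star> q n) \<longlonglongrightarrow> p" by (simp add: q_conv o_def)
  qed
  moreover have "p \<noteq> 0"
  proof
    assume "p = 0"
    then have "(\<lambda>n. Re (q n 0)) \<longlonglongrightarrow> 0" using tendsto_Re[OF tendsto_apply[OF q_lim, of 0]] by simp
    then have "\<beta> \<longlonglongrightarrow> 0" by (simp add: q_zero)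
    then show False using LIMSEQ_unique[OF \<beta>] b(2) by fastforce
  qed
  moreover have "(g \<star> g) \<star> p = \<kappa> *\<^sub>R p"
  proof -
    have "(\<lambda>n. q 0 \<star> q n) \<longlonglongrightarrow> q 0 \<star> p" by (intro conv.tendsto tendsto_const q_lim)
    then have "q 0 \<star> p = p" using p LIMSEQ_unique by (simp add: q_conv)
    moreover have "q 0 = (1 / \<kappa>) *\<^sub>R (g \<star> g)" by (simp add: q_def)
    ultimately have "(1 / \<kappa>) *\<^sub>R ((g \<star> g) \<star> p) = p" by (simp add: conv.scaleR_left)
    then have "\<kappa> *\<^sub>R ((1 / \<kappa>) *\<^sub>R ((g \<star> g) \<star> p)) = \<kappa> *\<^sub>R p" by simp
    then show ?thesis using lam by simp
  qed
  moreover have "p \<star> e = p" if "g \<star> e = g" for e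
  proof (rule LIMSEQ_unique)
    show "(\<lambda>n. q n \<star> e) \<longlonglongrightarrow> p \<star> e" by (intro conv.tendsto tendsto_const q_lim)
    have "q n \<star> e = q n" for n unfolding q_def conv.scaleR_left cpow_unit[OF that] ..
    then show "(\<lambda>n. q n \<star> e) \<longlonglongrightarrow> p" using q_lim by simp
  qed
  ultimately show ?thesis using that[of \<kappa> p] lam unfolding projection_def by blast
qed

lemma projection_zero: "projection p \<Longrightarrow> p 0 = of_real (sqnorm p)"
  using sqnorm_hermitian[of p] unfolding projection_def by simp

lemma projection_norm: "projection p \<Longrightarrow> cmod (p x) \<le> sqnorm p"
  using norm_square_hermitian_le[of p] norm_bounded[of p x] unfolding projection_def by simp

text \<open>The square of the uniform norm dominates \<open>sqnorm p\<close>, while p = p \<star> p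
  bounds the uniform norm by \<open>sqnorm p\<close>. Hence \<open>sqnorm p\<close> is at most its
  own square.\<close>

lemma projection_sqnorm_ge:
  assumes "projection p" "p \<noteq> 0"
  shows "sqnorm p \<ge> 1"
proof -
  have "norm p \<le> sqnorm p" using norm_square_hermitian_le[of p] assms unfolding projection_def by simp
  then have "(norm p)\<^sup>2 \<le> (sqnorm p)\<^sup>2" by (intro power_mono) auto
  then have "sqnorm p * 1 \<le> sqnorm p * sqnorm p" using sqnorm_le[of p] by (simp add: power2_eq_square)
  moreover have "sqnorm p > 0" using assms sqnorm_zero_iff[of p] sqnorm_nonneg[of p] by simp
  ultimately show ?thesis by simp
qed

text \<open>Orthogonal summands of a projection have traces \<open>p 0 \<ge> 1\<close>, so a nonzero projection of almost
  minimal trace below an eigenspace is indecomposable.\<close>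

lemma minimal_projection:
  assumes "projection p0" "p0 \<noteq> 0" "k \<star> p0 = \<kappa> *\<^sub>R p0"
  obtains p where "projection p" "p \<noteq> 0" "k \<star> p = \<kappa> *\<^sub>R p"
    "\<And>g. star g = g \<Longrightarrow> g \<star> p = g \<Longrightarrow> \<exists>s. g \<star> g = s *\<^sub>R p"
proof -
  define P where "P p \<longleftrightarrow> projection p \<and> p \<noteq> 0 \<and> k \<star> p = \<kappa> *\<^sub>R p" for p
  \<comment> \<open>Taking the floor makes the minimum attained. A proper summand has trace smaller
    by at least 1, hence also a smaller floor.\<close>
  define m where "m p = nat \<lfloor>sqnorm p\<rfloor>" for p
  obtain p where p: "P p" and min: "\<And>q. P q \<Longrightarrow> m p \<le> m q"
    using ex_has_least_nat[of P p0 m] assms unfolding P_def by blast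
  have p': "star p = p" "p \<star> p = p" "p \<noteq> 0" "k \<star> p = \<kappa> *\<^sub>R p"
    using p unfolding P_def projection_def by auto
  have "\<exists>s. g \<star> g = s *\<^sub>R p" if g: "star g = g" "g \<star> p = g" for g
  proof (cases "g = 0")
    case True
    then show ?thesis by (intro exI[of _ 0]) (simp add: conv.zero_left)
  next
    case False
    obtain \<kappa>' q where q: "projection q" "q \<noteq> 0" "(g \<star> g) \<star> q = \<kappa>' *\<^sub>R q" "q \<star> p = q"
      using top_eigenprojection[OF g(1) False] g(2) by metis
    have pq: "p \<star> q = q" using q(4) conv_commute by metis
    have "k \<star> q = (k \<star> p) \<star> q" by (simp add: conv_assoc pq)
    also have "\<dots> = \<kappa> *\<^sub>R q" by (simp add: p' conv.scaleR_left pq)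
    finally have Pq: "P q" unfolding P_def using q by simp
    have "q = p"
    proof (rule ccontr)
      assume "q \<noteq> p"
      have "projection (p - q)"
        using q p' pq unfolding projection_def by (simp add: star_diff conv.diff_left conv.diff_right)
      moreover have "p - q \<noteq> 0" using \<open>q \<noteq> p\<close> by simp
      ultimately have ge: "sqnorm (p - q) \<ge> 1" by (rule projection_sqnorm_ge)
      have "complex_of_real (sqnorm (p - q)) = of_real (sqnorm p - sqnorm q)"
        using projection_zero[OF \<open>projection (p - q)\<close>] projection_zero[OF q(1)] projection_zero[of p] p
        unfolding P_def by (simp add: minus_bcontfun.rep_eq)
      then have "sqnorm (p - q) = sqnorm p - sqnorm q" by (simp only: of_real_eq_iff)
      then have "sqnorm q \<le> sqnorm p - 1" using ge by simp
      then have "m q < m p"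
        unfolding m_def using projection_sqnorm_ge[OF q(1,2)] by (simp add: nat_less_eq_zless) linarith
      then show False using min[OF Pq] by simp
    qed
    then have "g \<star> (g \<star> p) = \<kappa>' *\<^sub>R p" using q(3) by (simp add: conv_assoc)
    then show ?thesis using g(2) by auto
  qed
  then show ?thesis using that[of p] p unfolding P_def by blast
qed

text \<open>Polarisation: h is a quarter of the difference of the squares of h + p and h -
  p.\<close>

lemma minimal_projection_scalar:
  assumes p: "projection p"
    and min: "\<And>g. star g = g \<Longrightarrow> g \<star> p = g \<Longrightarrow> \<exists>s. g \<star> g = s *\<^sub>R p"
    and h: "star h = h" "h \<star> p = h"
  shows "\<exists>s. h = s *\<^sub>R p"
proof -
  have pp: "star p = p" "p \<star> p = p" using p unfolding projection_def by auto
  have ph: "p \<star> h = h" using h(2) conv_commute by metis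
  obtain s where s: "(h + p) \<star> (h + p) = s *\<^sub>R p"
    using min[of "h + p"] h pp by (auto simp: star_add conv.add_left)
  obtain t where t: "(h - p) \<star> (h - p) = t *\<^sub>R p"
    using min[of "h - p"] h pp by (auto simp: star_diff conv.diff_left)
  have "(h + p) \<star> (h + p) - (h - p) \<star> (h - p) = h + h + h + h"
    using h pp ph by (simp add: conv.add_left conv.add_right conv.diff_left conv.diff_right)
  also have "\<dots> = (1 + 1 + 1 + 1 :: real) *\<^sub>R h"
    by (simp only: scaleR_left_distrib scaleR_one)
  finally have "(h + p) \<star> (h + p) - (h - p) \<star> (h - p) = 4 *\<^sub>R h" by simp
  then have "h = (1 / 4) *\<^sub>R ((s - t) *\<^sub>R p)" using s t by (simp add: scaleR_left_diff_distrib)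
  then show ?thesis by (metis scaleR_scaleR)
qed

text \<open>Translates of p are again reproduced by convolution with p. The hermitian combinations u
  and v of the translates by a and -a are therefore real multiples of p, so p is an eigenvector of
  every translation; evaluation at 0 identifies the eigenvalue.\<close>

lemma minimal_projection_character:
  assumes p: "projection p" "p \<noteq> 0"
    and min: "\<And>g. star g = g \<Longrightarrow> g \<star> p = g \<Longrightarrow> \<exists>s. g \<star> g = s *\<^sub>R p"
  shows "p (x + a) * p 0 = p a * p x"
proof -
  have pp: "star p = p" "p \<star> p = p" using p unfolding projection_def by auto
  have star_shift: "star (shift b p) = shift (- b) p" for b :: 'x
  proof (rule bcontfun_eqI)
    fix x
    have "p (x - b) = cnj (p (- (x - b)))" using arg_cong[OF pp(1), of "\<lambda>f. f (x - b)"] by simp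
    then show "star (shift b p) x = shift (- b) p x" by simp
  qed
  define u where "u = shift a p + shift (- a) p"
  define v where "v = cmult \<i> (shift a p - shift (- a) p)"
  have "star u = u" unfolding u_def by (simp add: star_add star_shift add.commute)
  moreover have "u \<star> p = u" unfolding u_def by (simp add: conv.add_left shift_conv pp)
  ultimately obtain s where s: "u = s *\<^sub>R p" using minimal_projection_scalar[OF p(1) min] by blast
  have "star v = v"
  proof (rule bcontfun_eqI)
    have "cnj (p (- y + b)) = p (y - b)" for y b
      using arg_cong[OF star_shift[of b], of "\<lambda>f. f y"] by simp
    from this[of _ a] this[of _ "- a"] show "star v x = v x" for x
      unfolding v_def by (simp add: minus_bcontfun.rep_eq algebra_simps)
  qed
  moreover have "v \<star> p = v" unfolding v_def by (simp add: cmult_conv conv.diff_left shift_conv pp)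
  ultimately obtain t where t: "v = t *\<^sub>R p" using minimal_projection_scalar[OF p(1) min] by blast
  define c where "c = (of_real s - \<i> * of_real t) / 2"
  have c: "p (y + a) = c * p y" for y
  proof -
    have "p (y + a) + p (y - a) = of_real s * p y"
      using arg_cong[OF s, of "\<lambda>f. f y"] unfolding u_def
      by (simp add: plus_bcontfun.rep_eq scaleR_conv_of_real)
    moreover have "\<i> * (p (y + a) - p (y - a)) = of_real t * p y"
      using arg_cong[OF t, of "\<lambda>f. f y"] unfolding v_def
      by (simp add: minus_bcontfun.rep_eq scaleR_conv_of_real)
    then have "p (y + a) - p (y - a) = - \<i> * of_real t * p y"
      by (metis (no_types, opaque_lifting) complex_i_mult_minus minus_mult_left mult.assoc minus_equation_iff)
    moreover have "2 * p (y + a) = (p (y + a) + p (y - a)) + (p (y + a) - p (y - a))" by simp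
    ultimately have "2 * p (y + a) = of_real s * p y + - \<i> * of_real t * p y" by simp
    then have "2 * p (y + a) = (of_real s - \<i> * of_real t) * p y"
      by (simp add: left_diff_distrib)
    then have "p (y + a) = (of_real s - \<i> * of_real t) * p y / 2"
      by (metis nonzero_mult_div_cancel_left zero_neq_numeral)
    then show ?thesis by (simp add: c_def)
  qed
  from c[of x] c[of 0] show ?thesis by simp
qed

text \<open>The character is a minimal projection p inside a nonzero eigenspace of g \<star> g,
  normalised at 0. If f were orthogonal to it, then f \<star> p = 0. As g \<star> g has a factor f,
  its eigenvalue on p would vanish.\<close>

theorem character_not_orthogonal:
  fixes f :: "'x \<Rightarrow>\<^sub>C complex"
  assumes "f \<noteq> 0"
  obtains c where "(\<integral>y. f y * cnj (eval c y) \<partial>\<mu>) \<noteq> 0"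
proof -
  define g where "g = f \<star> star f"
  have g: "star g = g" unfolding g_def by (simp add: star_conv conv_commute)
  have "g 0 \<noteq> 0" unfolding g_def conv_star_zero using assms by (simp add: sqnorm_zero_iff)
  then have "g \<noteq> 0" by auto
  obtain \<kappa> p0 where p0: "\<kappa> > 0" "projection p0" "p0 \<noteq> 0" "(g \<star> g) \<star> p0 = \<kappa> *\<^sub>R p0"
    using top_eigenprojection[OF g \<open>g \<noteq> 0\<close>] by metis
  obtain p where p: "projection p" "p \<noteq> 0" "(g \<star> g) \<star> p = \<kappa> *\<^sub>R p"
    and min: "\<And>g. star g = g \<Longrightarrow> g \<star> p = g \<Longrightarrow> \<exists>s. g \<star> g = s *\<^sub>R p"
    using minimal_projection[OF p0(2-4)] by metis
  have mult: "p (x + y) * p 0 = p x * p y" for x y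
    using minimal_projection_character[OF p(1,2) min, of x y] by (simp add: mult.commute)
  have p00: "p 0 = of_real (sqnorm p)" "sqnorm p \<ge> 1"
    using projection_zero[OF p(1)] projection_sqnorm_ge[OF p(1,2)] by auto
  then have p_ne: "p 0 \<noteq> 0" by auto
  define \<phi> where "\<phi> x = p x / p 0" for x
  have \<phi>_mult: "\<phi> (x + y) = \<phi> x * \<phi> y" for x y
    using mult[of x y] p_ne by (simp add: \<phi>_def field_simps)
  have \<phi>_le: "cmod (\<phi> x) \<le> 1" for x
    using projection_norm[OF p(1), of x] p00 by (simp add: \<phi>_def norm_divide)
  have \<phi>_norm: "cmod (\<phi> x) = 1" for x
  proof -
    have "\<phi> x * \<phi> (- x) = 1" using \<phi>_mult[of x "- x"] p_ne by (simp add: \<phi>_def)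
    then have "cmod (\<phi> x) * cmod (\<phi> (- x)) = 1" by (metis norm_mult norm_one)
    then have "1 \<le> cmod (\<phi> x) * 1" using \<phi>_le[of "- x"] mult_left_mono[OF \<phi>_le[of "- x"], of "cmod (\<phi> x)"] by simp
    then show ?thesis using \<phi>_le[of x] by simp
  qed
  have \<phi>_minus: "\<phi> (- y) = cnj (\<phi> y)" for y
  proof -
    have "\<phi> y * \<phi> (- y) = 1" using \<phi>_mult[of y "- y"] p_ne by (simp add: \<phi>_def)
    moreover have "\<phi> y * cnj (\<phi> y) = 1" using \<phi>_norm[of y] complex_norm_square[of "\<phi> y"] by simp
    ultimately show ?thesis by (metis mult_cancel_left mult_zero_left zero_neq_one)
  qed
  have "continuous_on UNIV \<phi>" unfolding \<phi>_def using p_ne by (intro continuous_intros continuous_apply') auto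
  then have char: "eval (Character \<phi>) = \<phi>" using \<phi>_mult \<phi>_norm by (simp add: Character_inverse)
  have "(\<integral>y. f y * cnj (\<phi> y) \<partial>\<mu>) \<noteq> 0"
  proof
    assume zero: "(\<integral>y. f y * cnj (\<phi> y) \<partial>\<mu>) = 0"
    have p_eq: "p (x - y) = p 0 * \<phi> x * cnj (\<phi> y)" for x y
      using \<phi>_mult[of x "- y"] p_ne unfolding \<phi>_minus by (simp add: \<phi>_def field_simps)
    have "f \<star> p = 0"
    proof (rule bcontfun_eqI)
      fix x
      have "(f \<star> p) x = (\<integral>y. (p 0 * \<phi> x) * (f y * cnj (\<phi> y)) \<partial>\<mu>)"
        unfolding conv_apply p_eq by (simp add: mult_ac)
      also have "\<dots> = 0" using zero by simp
      finally show "(f \<star> p) x = apply_bcontfun 0 x" by simp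
    qed
    have "(g \<star> g) \<star> p = (star f \<star> (f \<star> star f)) \<star> (f \<star> p)"
      unfolding g_def by (metis conv_assoc conv_commute)
    then have "\<kappa> *\<^sub>R p = 0" using p(3) \<open>f \<star> p = 0\<close> by (simp add: conv.zero_right)
    then show False using p0(1) p(2) by simp
  qed
  then show ?thesis using that[of "Character \<phi>"] char by simp
qed

text \<open>A character trivial at x is invariant under translation by x, hence orthogonal to every
  difference of a function and its translate by x. The distance to 0 gives such a difference that
  does not vanish.\<close>

corollary characters_separate_points:
  fixes x :: 'x
  assumes "x \<noteq> 0"
  obtains c where "eval c x \<noteq> 1"
proof -
  define h where "h y = complex_of_real (dist y 0)" for y :: 'x
  have h: "continuous_on UNIV h" unfolding h_def by (intro continuous_intros)
  have h': "continuous_on UNIV (\<lambda>y. h (y + - x))"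
    by (intro continuous_on_compose2[OF h] continuous_intros) auto
  define f where "f = Bcontfun (\<lambda>y. h y - h (y + - x))"
  have f: "f y = h y - h (y + - x)" for y
    unfolding f_def using continuous_on_diff[OF h h'] by (subst apply_Bcontfun) auto
  have "f 0 \<noteq> 0" using assms by (simp add: f h_def)
  then have "f \<noteq> 0" by auto
  then obtain c where c: "(\<integral>y. f y * cnj (eval c y) \<partial>\<mu>) \<noteq> 0"
    by (rule character_not_orthogonal)
  have c_cont: "continuous_on UNIV (\<lambda>y. cnj (eval c y))" by (intro continuous_intros)
  have "eval c x \<noteq> 1"
  proof
    assume x: "eval c x = 1"
    have inv: "eval c y = eval c (y + - x)" for y
      by (simp add: eval_arg_diff x)
    have hc: "continuous_on UNIV (\<lambda>y. h y * cnj (eval c y))" by (intro continuous_on_mult h c_cont)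
    have "(\<integral>y. f y * cnj (eval c y) \<partial>\<mu>) = (\<integral>y. h y * cnj (eval c y) - h (y + - x) * cnj (eval c y) \<partial>\<mu>)"
      by (simp add: f algebra_simps)
    also have "\<dots> = (\<integral>y. h y * cnj (eval c y) \<partial>\<mu>) - (\<integral>y. h (y + - x) * cnj (eval c y) \<partial>\<mu>)"
      by (intro Bochner_Integration.integral_diff integrable_continuous continuous_on_mult h h' c_cont)
    also have "(\<integral>y. h (y + - x) * cnj (eval c y) \<partial>\<mu>) = (\<integral>y. h (y + - x) * cnj (eval c (y + - x)) \<partial>\<mu>)"
      using inv by metis
    also have "\<dots> = (\<integral>y. h y * cnj (eval c y) \<partial>\<mu>)"
      by (rule integral_translate[OF measurable_continuous[OF hc]])
    finally show False using c by simp
  qed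
  then show ?thesis by (rule that)
qed

end

section \<open>Fourier analysis of invariant sets\<close>

subsection \<open>Measures with the same Fourier coefficients\<close>

definition character_subgroup :: "'x::topological_ab_group_add character set \<Rightarrow> bool" where
  "character_subgroup M \<longleftrightarrow> 0 \<in> M \<and> (\<forall>c\<in>M. \<forall>d\<in>M. c + d \<in> M) \<and> (\<forall>c\<in>M. - c \<in> M)"

definition annihilator :: "'x::topological_ab_group_add character set \<Rightarrow> 'x set" where
  "annihilator J = {x. \<forall>c\<in>J. eval c x = 1}"

lemma character_subgroupD:
  assumes "character_subgroup M"
  shows "0 \<in> M" "c \<in> M \<Longrightarrow> d \<in> M \<Longrightarrow> c + d \<in> M" "c \<in> M \<Longrightarrow> - c \<in> M" "c \<in> M \<Longrightarrow> d \<in> M \<Longrightarrow> c - d \<in> M"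
  using assms unfolding character_subgroup_def
  by (auto simp: diff_conv_add_uminus simp del: add_uminus_conv_diff)

lemma annihilator_trivial_separates:
  assumes "annihilator M = {0}" "\<And>c. c \<in> M \<Longrightarrow> eval c x = eval c y"
  shows "x = y"
proof -
  have "x - y \<in> annihilator M"
    unfolding annihilator_def using assms(2) by (auto simp: eval_arg_diff)
  then show ?thesis using assms(1) by simp
qed

text \<open>Real parts suit the real form of Stone-Weierstrass; the complex factor z provides both
  the real and the imaginary part of a character.\<close>

inductive trig_poly :: "'x::topological_ab_group_add character set \<Rightarrow> ('x \<Rightarrow> real) \<Rightarrow> bool" for M where
  trig_poly_base: "c \<in> M \<Longrightarrow> trig_poly M (\<lambda>x. Re (z * eval c x))"
| trig_poly_add: "trig_poly M f \<Longrightarrow> trig_poly M g \<Longrightarrow> trig_poly M (\<lambda>x. f x + g x)"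

lemma trig_poly_continuous: "trig_poly M f \<Longrightarrow> continuous_on UNIV f"
  by (induction rule: trig_poly.induct) (auto intro!: continuous_intros)

text \<open>Re u Re v is half the sum of the real parts of u v and u cnj v, whose spectra are the
  sum and the difference of the characters.\<close>

lemma trig_poly_mult:
  assumes M: "character_subgroup M" and "trig_poly M f" "trig_poly M g"
  shows "trig_poly M (\<lambda>x. f x * g x)"
  using assms(2)
proof (induction rule: trig_poly.induct)
  case (trig_poly_base c z)
  from assms(3) show ?case
  proof (induction rule: trig_poly.induct)
    case (trig_poly_base d w)
    have "trig_poly M (\<lambda>x. Re (z * w / 2 * eval (c + d) x) + Re (z * cnj w / 2 * eval (c - d) x))"
      using \<open>c \<in> M\<close> trig_poly_base character_subgroupD[OF M]
      by (intro trig_poly.trig_poly_add trig_poly.trig_poly_base) auto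
    also have "(\<lambda>x. Re (z * w / 2 * eval (c + d) x) + Re (z * cnj w / 2 * eval (c - d) x))
      = (\<lambda>x. Re (z * eval c x) * Re (w * eval d x))"
    proof
      fix x
      define u v where "u = z * eval c x" and "v = w * eval d x"
      have "Re (z * w / 2 * eval (c + d) x) + Re (z * cnj w / 2 * eval (c - d) x) = Re (u * v / 2) + Re (u * cnj v / 2)"
        by (simp add: u_def v_def eval_add eval_diff mult_ac)
      also have "\<dots> = Re u * Re v" by (simp add: add_divide_distrib diff_divide_distrib)
      finally show "Re (z * w / 2 * eval (c + d) x) + Re (z * cnj w / 2 * eval (c - d) x) = Re (z * eval c x) * Re (w * eval d x)"
        by (simp add: u_def v_def)
    qed
    finally show ?case .
  next
    case (trig_poly_add f g)
    then show ?case using trig_poly.trig_poly_add by (fastforce simp: distrib_left)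
  qed
next
  case (trig_poly_add f g')
  then show ?case using trig_poly.trig_poly_add by (fastforce simp: distrib_right)
qed

lemma trig_poly_dense:
  fixes f :: "'x::{topological_ab_group_add, metric_space} \<Rightarrow> real"
  assumes "compact (UNIV :: 'x set)" and M: "character_subgroup M" "annihilator M = {0}"
    and "continuous_on UNIV f" "e > 0"
  shows "\<exists>g. trig_poly M g \<and> (\<forall>x. \<bar>f x - g x\<bar> < e)"
proof -
  have "\<exists>g. trig_poly M g \<and> (\<forall>x\<in>UNIV. \<bar>f x - g x\<bar> < e)"
    using assms(1)
  proof (rule Stone_Weierstrass_HOL)
    show "trig_poly M (\<lambda>x. r)" for r
      using trig_poly_base[OF character_subgroupD(1)[OF M(1)], of "of_real r"] by simp
    show "\<exists>f. trig_poly M f \<and> f x \<noteq> f y" if xy: "x \<in> UNIV \<and> y \<in> UNIV \<and> x \<noteq> y" for x y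
    proof -
      obtain c where c: "c \<in> M" "eval c x \<noteq> eval c y"
        using annihilator_trivial_separates[OF M(2), of x y] xy by blast
      then consider "Re (1 * eval c x) \<noteq> Re (1 * eval c y)" | "Re (- \<i> * eval c x) \<noteq> Re (- \<i> * eval c y)"
        by (auto simp: complex_eq_iff)
      then show ?thesis
      proof cases
        case 1
        then show ?thesis by (intro exI[of _ "\<lambda>x. Re (1 * eval c x)"] conjI trig_poly_base[OF c(1)])
      next
        case 2
        then show ?thesis by (intro exI[of _ "\<lambda>x. Re (- \<i> * eval c x)"] conjI trig_poly_base[OF c(1)])
      qed
    qed
  qed (use assms(4,5) in \<open>auto intro: trig_poly_continuous trig_poly_add trig_poly_mult[OF M(1)]\<close>)
  then show ?thesis by simp
qed

lemma finite_measure_integrable_continuous: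
  fixes f :: "'x::metric_space \<Rightarrow> 'b::{banach, second_countable_topology}"
  assumes "compact (UNIV :: 'x set)" "finite_measure \<nu>" "sets \<nu> = sets borel" "continuous_on UNIV f"
  shows "integrable \<nu> f"
proof -
  interpret finite_measure \<nu> by fact
  have "bounded (range f)"
    using assms(1,4) compact_continuous_image compact_imp_bounded by blast
  then obtain B where "\<And>x. norm (f x) \<le> B" by (auto simp: bounded_iff)
  moreover have "f \<in> borel_measurable \<nu>"
    using borel_measurable_continuous_onI[OF assms(4)] assms(3) by (simp cong: measurable_cong_sets)
  ultimately show ?thesis by (intro integrable_const_bound[of _ B]) auto
qed

lemma integral_trig_poly_eq:
  fixes \<nu> \<nu>' :: "'x::{topological_ab_group_add, metric_space} measure"
  assumes X: "compact (UNIV :: 'x set)" and "trig_poly M f"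
    and \<nu>: "finite_measure \<nu>" "sets \<nu> = sets borel" and \<nu>': "finite_measure \<nu>'" "sets \<nu>' = sets borel"
    and eq: "\<And>c. c \<in> M \<Longrightarrow> (\<integral>x. eval c x \<partial>\<nu>) = (\<integral>x. eval c x \<partial>\<nu>')"
  shows "(\<integral>x. f x \<partial>\<nu>) = (\<integral>x. f x \<partial>\<nu>')"
  using assms(2)
proof (induction rule: trig_poly.induct)
  case (trig_poly_base c z)
  have int: "integrable \<nu> (\<lambda>x. z * eval c x)" "integrable \<nu>' (\<lambda>x. z * eval c x)"
    by (intro finite_measure_integrable_continuous X \<nu> \<nu>' continuous_intros)+
  have "(\<integral>x. Re (z * eval c x) \<partial>\<nu>) = Re (\<integral>x. z * eval c x \<partial>\<nu>)" by (rule integral_Re[OF int(1)])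
  also have "\<dots> = Re (\<integral>x. z * eval c x \<partial>\<nu>')" using eq[OF trig_poly_base] by simp
  also have "\<dots> = (\<integral>x. Re (z * eval c x) \<partial>\<nu>')" by (rule integral_Re[OF int(2), symmetric])
  finally show ?case .
next
  case (trig_poly_add f g)
  have "integrable \<nu> f" "integrable \<nu> g" "integrable \<nu>' f" "integrable \<nu>' g"
    using trig_poly_add.hyps trig_poly_continuous
    by (intro finite_measure_integrable_continuous X \<nu> \<nu>'; blast)+
  then show ?case using trig_poly_add.IH by simp
qed

text \<open>The indicator of a closed set is a pointwise limit of continuous functions built from
  the distance to it, and closed sets form an intersection-stable generator of the Borel
  sets.\<close>

lemma measure_eq_if_continuous_integrals_eq:
  fixes \<nu> \<nu>' :: "'x::metric_space measure"
  assumes \<nu>: "finite_measure \<nu>" "sets \<nu> = sets borel" and \<nu>': "finite_measure \<nu>'" "sets \<nu>' = sets borel"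
    and eq: "\<And>f :: 'x \<Rightarrow> real. continuous_on UNIV f \<Longrightarrow> (\<integral>x. f x \<partial>\<nu>) = (\<integral>x. f x \<partial>\<nu>')"
  shows "\<nu> = \<nu>'"
proof -
  have sp: "space \<nu> = UNIV" "space \<nu>' = UNIV"
    using sets_eq_imp_space_eq[OF \<nu>(2)] sets_eq_imp_space_eq[OF \<nu>'(2)] by auto
  have closed: "emeasure \<nu> C = emeasure \<nu>' C" if C: "closed C" for C :: "'x set"
  proof (cases "C = {}")
    case False
    define f where "f n x = max 0 (1 - real n * infdist x C)" for n x
    have cont: "continuous_on UNIV (f n)" for n
      unfolding f_def by (intro continuous_intros)
    have f_lim: "(\<lambda>n. f n x) \<longlonglongrightarrow> indicator C x" for x
    proof (cases "x \<in> C")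
      case True
      then show ?thesis by (simp add: f_def)
    next
      case out: False
      then have pos: "infdist x C > 0"
        using in_closed_iff_infdist_zero[OF C False] infdist_nonneg[of x C] by (simp add: order_less_le)
      have "\<forall>\<^sub>F n in sequentially. f n x = 0"
      proof -
        obtain N where N: "1 / infdist x C < real N" using reals_Archimedean2 by blast
        have "f n x = 0" if "n \<ge> N" for n
        proof -
          have "1 / infdist x C \<le> real n" using N that by simp
          then have "1 \<le> real n * infdist x C" using pos by (simp add: divide_le_eq)
          then show ?thesis by (simp add: f_def)
        qed
        then show ?thesis unfolding eventually_sequentially by blast
      qed
      then show ?thesis using out by (simp add: tendsto_eventually)
    qed
    have lim: "(\<lambda>n. \<integral>x. f n x \<partial>\<tau>) \<longlonglongrightarrow> measure \<tau> C"
      if \<tau>: "finite_measure \<tau>" "sets \<tau> = sets borel" "space \<tau> = UNIV" for \<tau> :: "'x measure"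
    proof -
      interpret \<tau>: finite_measure \<tau> by fact
      have Cs: "C \<in> sets \<tau>" using C \<tau> by simp
      have "(\<lambda>n. \<integral>x. f n x \<partial>\<tau>) \<longlonglongrightarrow> (\<integral>x. indicator C x \<partial>\<tau>)"
      proof (rule integral_dominated_convergence[where w = "\<lambda>_. 1"])
        show "f n \<in> borel_measurable \<tau>" for n
          using borel_measurable_continuous_onI[OF cont] \<tau>(2) by (simp cong: measurable_cong_sets)
        show "AE x in \<tau>. norm (f n x) \<le> 1" for n
          by (simp add: f_def infdist_nonneg)
      qed (use f_lim Cs in auto)
      then show ?thesis using Cs \<tau>(3) by simp
    qed
    have "measure \<nu> C = measure \<nu>' C"
      using LIMSEQ_unique[OF lim[OF \<nu> sp(1)]] lim[OF \<nu>' sp(2)] eq[OF cont] by simp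
    then show ?thesis
      using finite_measure.emeasure_eq_measure[OF \<nu>(1)] finite_measure.emeasure_eq_measure[OF \<nu>'(1)] by simp
  qed simp
  show ?thesis
  proof (rule measure_eqI_generator_eq[where E = "{C. closed C}" and \<Omega> = UNIV and A = "\<lambda>_. UNIV"])
    show "Int_stable {C :: 'x set. closed C}" by (auto simp: Int_stable_def)
    show "sets \<nu> = sigma_sets UNIV {C. closed C}" "sets \<nu>' = sigma_sets UNIV {C. closed C}"
      using \<nu>(2) \<nu>'(2) by (simp_all add: borel_eq_closed)
    show "emeasure \<nu> UNIV \<noteq> \<infinity>"
      using finite_measure.emeasure_finite[OF \<nu>(1)] by (simp add: top_unique)
  qed (use closed in auto)
qed

lemma measure_eq_if_coefficients_eq:
  fixes \<nu> \<nu>' :: "'x::{topological_ab_group_add, metric_space} measure"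
  assumes X: "compact (UNIV :: 'x set)" and M: "character_subgroup M" "annihilator M = {0}"
    and \<nu>: "finite_measure \<nu>" "sets \<nu> = sets borel" and \<nu>': "finite_measure \<nu>'" "sets \<nu>' = sets borel"
    and eq: "\<And>c. c \<in> M \<Longrightarrow> (\<integral>x. eval c x \<partial>\<nu>) = (\<integral>x. eval c x \<partial>\<nu>')"
  shows "\<nu> = \<nu>'"
  using \<nu> \<nu>'
proof (rule measure_eq_if_continuous_integrals_eq)
  fix f :: "'x \<Rightarrow> real" assume f: "continuous_on UNIV f"
  define K where "K = measure \<nu> UNIV + measure \<nu>' UNIV"
  have sp: "space \<nu> = UNIV" "space \<nu>' = UNIV"
    using sets_eq_imp_space_eq[OF \<nu>(2)] sets_eq_imp_space_eq[OF \<nu>'(2)] by auto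
  have approx: "\<bar>(\<integral>x. f x \<partial>\<tau>) - (\<integral>x. g x \<partial>\<tau>)\<bar> \<le> e * measure \<tau> UNIV"
    if \<tau>: "finite_measure \<tau>" "sets \<tau> = sets borel" "space \<tau> = UNIV"
      and g: "continuous_on UNIV g" "\<And>x. \<bar>f x - g x\<bar> < e" for \<tau> g e
  proof -
    interpret \<tau>: finite_measure \<tau> by fact
    note int = finite_measure_integrable_continuous[OF X \<tau>(1,2)]
    have "\<bar>\<integral>x. f x - g x \<partial>\<tau>\<bar> \<le> (\<integral>x. \<bar>f x - g x\<bar> \<partial>\<tau>)" by (rule integral_abs_bound)
    also have "\<dots> \<le> (\<integral>x. e \<partial>\<tau>)"
      by (intro integral_mono int continuous_intros f g(1) less_imp_le[OF g(2)])
    also have "\<dots> = e * measure \<tau> UNIV" using \<tau>(3) by simp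
    finally show ?thesis using int[OF f] int[OF g(1)] by simp
  qed
  have "\<bar>(\<integral>x. f x \<partial>\<nu>) - (\<integral>x. f x \<partial>\<nu>')\<bar> \<le> \<epsilon>" if "\<epsilon> > 0" for \<epsilon> :: real
  proof -
    have K: "K \<ge> 0" by (simp add: K_def)
    define e where "e = \<epsilon> / (K + 1)"
    have e: "e > 0" "e * K \<le> \<epsilon>" using that K by (auto simp: e_def field_simps)
    obtain g where g: "trig_poly M g" "\<And>x. \<bar>f x - g x\<bar> < e"
      using trig_poly_dense[OF X M f e(1)] by blast
    have gc: "continuous_on UNIV g" using g(1) trig_poly_continuous by blast
    have "(\<integral>x. g x \<partial>\<nu>) = (\<integral>x. g x \<partial>\<nu>')"
      by (rule integral_trig_poly_eq[OF X g(1) \<nu> \<nu>' eq])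
    then have "\<bar>(\<integral>x. f x \<partial>\<nu>) - (\<integral>x. f x \<partial>\<nu>')\<bar> \<le> e * measure \<nu> UNIV + e * measure \<nu>' UNIV"
      using approx[OF \<nu> sp(1) gc g(2)] approx[OF \<nu>' sp(2) gc g(2)] by linarith
    also have "\<dots> \<le> \<epsilon>" using e(2) by (simp add: K_def distrib_left)
    finally show ?thesis .
  qed
  then have "\<bar>(\<integral>x. f x \<partial>\<nu>) - (\<integral>x. f x \<partial>\<nu>')\<bar> \<le> 0"
    by (rule field_le_epsilon) simp
  then show "(\<integral>x. f x \<partial>\<nu>) = (\<integral>x. f x \<partial>\<nu>')" by simp
qed

context haar_group
begin

lemma integral_eval: "(\<integral>x. eval c x \<partial>\<mu>) = (if c = 0 then 1 else 0)"
proof (cases "c = 0")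
  case False
  then obtain a where a: "eval c a \<noteq> 1" using character_eqI[of c 0] by auto
  have "eval c \<in> borel_measurable \<mu>" by (intro measurable_continuous continuous_intros)
  then have "(\<integral>x. eval c (x + a) \<partial>\<mu>) = (\<integral>x. eval c x \<partial>\<mu>)" by (rule integral_translate)
  then have "(\<integral>x. eval c x \<partial>\<mu>) * eval c a = (\<integral>x. eval c x \<partial>\<mu>)" by (simp add: eval_arg_add)
  then show ?thesis using a False by auto
qed simp

text \<open>If \<open>c \<notin> J\<close> is trivial on the annihilator of \<open>J\<close>, then large powers of a trigonometric polynomial
  \<open>P\<close> with spectrum in \<open>J\<close> concentrate where \<open>c\<close> is close to one, although \<open>P ^ N\<close> is orthogonal to \<open>c\<close>.\<close>

lemma double_annihilator:
  fixes c :: "'x character"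
  assumes J: "character_subgroup J" and triv: "\<And>x. x \<in> annihilator J \<Longrightarrow> eval c x = 1"
  shows "c \<in> J"
proof (rule ccontr)
  assume c: "c \<notin> J"
  define C where "C = {x. Re (eval c x) \<le> 1 / 2}"
  have "closed C" unfolding C_def by (intro closed_Collect_le continuous_intros)
  then have C: "compact C" using compact_Int_closed[OF compact_UNIV, of C] by simp
  have "\<exists>F. finite F \<and> F \<subseteq> J \<and> C \<subseteq> (\<Union>d\<in>F. {x. eval d x \<noteq> 1})"
  proof -
    have "open {x. eval d x \<noteq> 1}" for d :: "'x character"
      by (intro open_Collect_neq continuous_intros)
    moreover have "C \<subseteq> (\<Union>d\<in>J. {x. eval d x \<noteq> 1})"
      using triv unfolding C_def annihilator_def by force
    ultimately show ?thesis using compactE_image[OF C, of J "\<lambda>d. {x. eval d x \<noteq> 1}"] by metis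
  qed
  then obtain F where F: "finite F" "F \<subseteq> J" "C \<subseteq> (\<Union>d\<in>F. {x. eval d x \<noteq> 1})" by blast
  \<comment> \<open>Each factor has values in [0, 1] and equals 1 only where the character d is 1.
    So P is 1 at 0 and below 1 on \<open>C\<close>, where some d in \<open>F\<close> is
    nontrivial.\<close>
  define P where "P x = (\<Prod>d\<in>F. (1 + Re (eval d x)) / 2)" for x
  have fac: "0 \<le> (1 + Re (eval d x)) / 2" "(1 + Re (eval d x)) / 2 \<le> 1" for d :: "'x character" and x
    using abs_Re_le_cmod[of "eval d x"] by (auto simp: abs_le_iff)
  have P_cont: "continuous_on UNIV P" unfolding P_def by (intro continuous_intros) simp
  have P01: "0 \<le> P x" "P x \<le> 1" for x unfolding P_def by (intro prod_nonneg prod_le_1 ballI conjI fac)+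
  have P_C: "P x < 1" if x: "x \<in> C" for x
  proof -
    obtain d where d: "d \<in> F" "eval d x \<noteq> 1" using F(3) x by blast
    have "Re (eval d x) \<noteq> 1"
    proof
      assume "Re (eval d x) = 1"
      moreover from this have "Im (eval d x) = 0"
        using cmod_power2[of "eval d x"] by simp
      ultimately show False using d(2) by (simp add: complex_eq_iff)
    qed
    then have "(1 + Re (eval d x)) / 2 < 1" using fac(2)[of d x] by simp
    moreover have "P x = (1 + Re (eval d x)) / 2 * (\<Prod>d\<in>F - {d}. (1 + Re (eval d x)) / 2)"
      unfolding P_def by (rule prod.remove[OF F(1) d(1)])
    moreover have "(\<Prod>d\<in>F - {d}. (1 + Re (eval d x)) / 2) \<le> 1" by (intro prod_le_1 conjI fac)
    moreover have "0 \<le> (\<Prod>d\<in>F - {d}. (1 + Re (eval d x)) / 2)" by (intro prod_nonneg fac)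
    ultimately show ?thesis
      using mult_left_le[of "\<Prod>d\<in>F - {d}. (1 + Re (eval d x)) / 2" "(1 + Re (eval d x)) / 2"] fac(1)[of d x] by linarith
  qed
  have "\<exists>k<1. 0 \<le> k \<and> (\<forall>x\<in>C. P x \<le> k)"
  proof (cases "C = {}")
    case False
    then obtain x where "x \<in> C" "\<forall>y\<in>C. P y \<le> P x"
      using continuous_attains_sup[OF C False continuous_on_subset[OF P_cont]] by blast
    then show ?thesis using P_C P01 by blast
  qed (auto intro: exI[of _ 0])
  then obtain k where k: "k < 1" "0 \<le> k" "\<And>x. x \<in> C \<Longrightarrow> P x \<le> k" by blast
  \<comment> \<open>A level strictly between the bound k for P on \<open>C\<close> and the value P 0
    = 1, so that \<open>W\<close> is a neighbourhood of 0 disjoint from \<open>C\<close>.\<close>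
  define l where "l = (1 + k) / 2"
  have l: "k < l" "l < 1" "0 < l" using k by (auto simp: l_def)
  define W where "W = {x. l < P x}"
  have "open W" unfolding W_def by (intro open_Collect_less P_cont continuous_on_const)
  moreover have "0 \<in> W" using l by (simp add: W_def P_def)
  ultimately have W: "measure \<mu> W > 0" by (intro open_pos_measure) auto
  have W_sets: "W \<in> sets \<mu>" using \<open>open W\<close> by simp
  have orth: "(\<integral>x. complex_of_real ((P x) ^ N) * eval c x \<partial>\<mu>) = 0" for N
  proof -
    \<comment> \<open>\<open>Q\<close> expresses orthogonality to the whole coset c + J, which a
      factor of P preserves because it only shifts by elements of \<open>J\<close>. The constant 1
      qualifies since 0 is not in the coset.\<close>
    define Q where "Q f \<longleftrightarrow> continuous_on UNIV f \<and> (\<forall>d\<in>J. (\<integral>x. f x * eval (c + d) x \<partial>\<mu>) = 0)" for f :: "'x \<Rightarrow> complex"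
    have Q1: "Q (\<lambda>x. 1)"
    proof -
      have "c + d \<noteq> 0" if "d \<in> J" for d
        using c character_subgroupD(3)[OF J that] by (metis eq_neg_iff_add_eq_0)
      then show ?thesis unfolding Q_def by (simp add: integral_eval)
    qed
    have Q_step: "Q (\<lambda>x. of_real ((1 + Re (eval d x)) / 2) * f x)" if Q: "Q f" and d: "d \<in> J" for f d
    proof -
      have f: "continuous_on UNIV f" using Q by (simp add: Q_def)
      have "(\<integral>x. (of_real ((1 + Re (eval d x)) / 2) * f x) * eval (c + e) x \<partial>\<mu>) = 0" if e: "e \<in> J" for e
      proof -
        have "complex_of_real ((1 + Re (eval d x)) / 2) = 1 / 2 + 1 / 4 * eval d x + 1 / 4 * eval (- d) x" for x
          by (simp add: complex_eq_iff)
        then have "(\<integral>x. (of_real ((1 + Re (eval d x)) / 2) * f x) * eval (c + e) x \<partial>\<mu>)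
          = (\<integral>x. 1 / 2 * (f x * eval (c + e) x) + 1 / 4 * (f x * eval (c + (e + d)) x) + 1 / 4 * (f x * eval (c + (e - d)) x) \<partial>\<mu>)"
          by (intro Bochner_Integration.integral_cong) (auto simp: eval_add eval_diff algebra_simps)
        also have "\<dots> = 1 / 2 * (\<integral>x. f x * eval (c + e) x \<partial>\<mu>) + 1 / 4 * (\<integral>x. f x * eval (c + (e + d)) x \<partial>\<mu>)
            + 1 / 4 * (\<integral>x. f x * eval (c + (e - d)) x \<partial>\<mu>)"
        proof -
          have "integrable \<mu> (\<lambda>x. f x * eval d x)" for d by (intro integrable_continuous continuous_intros f)
          then show ?thesis
            by (subst Bochner_Integration.integral_add | (intro Bochner_Integration.integrable_add integrable_mult_right; fast)
                | subst integral_mult_right_zero)+ simp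
        qed
        also have "\<dots> = 0" using Q e d character_subgroupD[OF J] unfolding Q_def by auto
        finally show ?thesis .
      qed
      then show ?thesis unfolding Q_def by (intro conjI continuous_intros f ballI) auto
    qed
    have Q_prod: "Q (\<lambda>x. of_real (\<Prod>d\<in>F'. (1 + Re (eval d x)) / 2) * f x)" if "Q f" "F' \<subseteq> F" for f F'
    proof -
      have "finite F'" using F(1) that(2) finite_subset by blast
      then show ?thesis using that
      proof (induction F')
        case (insert d F')
        have "Q (\<lambda>x. of_real ((1 + Re (eval d x)) / 2) * (of_real (\<Prod>d\<in>F'. (1 + Re (eval d x)) / 2) * f x))"
          using insert F(2) by (intro Q_step) auto
        then show ?case using insert.hyps by (simp add: mult.assoc)
      qed simp
    qed
    have "Q (\<lambda>x. of_real ((P x) ^ N) * 1)"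
    proof (induction N)
      case (Suc N)
      have "Q (\<lambda>x. of_real (P x) * (of_real ((P x) ^ N) * 1))"
        unfolding P_def by (rule Q_prod[OF Suc[unfolded P_def]]) simp
      then show ?case by simp
    qed (simp add: Q1)
    then show ?thesis using character_subgroupD(1)[OF J] unfolding Q_def by fastforce
  qed
  \<comment> \<open>The integrand is at least l^N / 2 on \<open>W\<close>, at least -k^N on
    \<open>C\<close> and nonnegative elsewhere, while its integral is zero. As k < l, large N gives
    a contradiction.\<close>
  have ineq: "l ^ N * measure \<mu> W / 2 \<le> k ^ N" for N
  proof -
    have "(\<integral>x. l ^ N / 2 * indicator W x - k ^ N \<partial>\<mu>) \<le> (\<integral>x. (P x) ^ N * Re (eval c x) \<partial>\<mu>)"
    proof (rule integral_mono)
      show "integrable \<mu> (\<lambda>x. l ^ N / 2 * indicator W x - k ^ N)"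
        using W_sets by (intro Bochner_Integration.integrable_diff integrable_mult_right integrable_real_indicator)
          (auto simp: emeasure_eq_measure)
      show "integrable \<mu> (\<lambda>x. (P x) ^ N * Re (eval c x))"
        by (intro integrable_continuous continuous_intros P_cont)
      show "l ^ N / 2 * indicator W x - k ^ N \<le> (P x) ^ N * Re (eval c x)" for x
      proof (cases "x \<in> C")
        case True
        then have Px: "P x \<le> k" by (rule k(3))
        then have "x \<notin> W" using l by (simp add: W_def)
        have "- ((P x) ^ N) \<le> (P x) ^ N * Re (eval c x)"
        proof -
          have "(P x) ^ N * (- 1) \<le> (P x) ^ N * Re (eval c x)"
            using abs_Re_le_cmod[of "eval c x"] P01 by (intro mult_left_mono) (auto simp: abs_le_iff)
          then show ?thesis by simp
        qed
        moreover have "(P x) ^ N \<le> k ^ N" using Px P01 by (intro power_mono) auto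
        ultimately show ?thesis using \<open>x \<notin> W\<close> by simp
      next
        case False
        then have half: "1 / 2 \<le> Re (eval c x)" by (simp add: C_def)
        have "l ^ N / 2 * indicator W x \<le> (P x) ^ N * (1 / 2)"
          using l P01[of x] by (auto simp: W_def indicator_def intro!: power_mono)
        also have "\<dots> \<le> (P x) ^ N * Re (eval c x)" using half P01 by (intro mult_left_mono) auto
        finally show ?thesis using k(2) zero_le_power[of k N] by linarith
      qed
    qed
    also have "(\<integral>x. (P x) ^ N * Re (eval c x) \<partial>\<mu>) = 0"
    proof -
      have int: "integrable \<mu> (\<lambda>x. complex_of_real ((P x) ^ N) * eval c x)"
        by (intro integrable_continuous continuous_intros P_cont)
      have "(\<integral>x. Re (complex_of_real ((P x) ^ N) * eval c x) \<partial>\<mu>) = 0"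
        unfolding integral_Re[OF int] orth by simp
      then show ?thesis by simp
    qed
    also have "(\<integral>x. l ^ N / 2 * indicator W x - k ^ N \<partial>\<mu>) = l ^ N / 2 * measure \<mu> W - k ^ N"
      using W_sets by (subst Bochner_Integration.integral_diff) (auto simp: emeasure_eq_measure)
    finally show ?thesis by simp
  qed
  have "measure \<mu> W / 2 \<le> (k / l) ^ N" for N
    using ineq[of N] l by (simp add: power_divide field_simps)
  moreover have "(\<lambda>N. (k / l) ^ N) \<longlonglongrightarrow> 0"
    using k l by (intro LIMSEQ_power_zero) (auto simp: field_simps)
  ultimately have "measure \<mu> W / 2 \<le> 0"
    by (intro LIMSEQ_le_const[of _ 0]) auto
  then show False using W by simp
qed

subsection \<open>Fourier coefficients of sets\<close>

definition coeff :: "'x set \<Rightarrow> 'x character \<Rightarrow> complex" where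
  "coeff E c = (\<integral>x. indicator E x * cnj (eval c x) \<partial>\<mu>)"

lemma integrable_indicator_times:
  fixes f :: "'x \<Rightarrow> complex"
  assumes "E \<in> sets \<mu>" "continuous_on UNIV f"
  shows "integrable \<mu> (\<lambda>x. indicator E x * f x)"
proof -
  have "integrable \<mu> (\<lambda>x. indicator E x *\<^sub>R f x)"
    using assms integrable_continuous integrable_mult_indicator by blast
  moreover have "indicator E x *\<^sub>R f x = indicator E x * f x" for x by (simp add: indicator_def)
  ultimately show ?thesis by simp
qed

lemma coeff_uminus: "coeff E (- c) = cnj (coeff E c)"
proof -
  have "cnj (indicator E x * cnj (eval c x)) = indicator E x * cnj (eval (- c) x)" for x
    by (simp add: indicator_def)
  then show ?thesis unfolding coeff_def by (simp flip: Bochner_Integration.integral_cnj)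
qed

lemma integral_eval_cnj: "(\<integral>x. eval c x * cnj (eval d x) \<partial>\<mu>) = (if c = d then 1 else 0)"
  using integral_eval[of "c - d"] by (simp add: eval_diff)

lemma Bessel_inequality:
  assumes E: "E \<in> sets \<mu>" and S: "finite S"
  shows "(\<Sum>c\<in>S. (cmod (coeff E c))\<^sup>2) \<le> 1"
proof -
  define P where "P x = (\<Sum>c\<in>S. coeff E c * eval c x)" for x
  have P: "continuous_on UNIV P" unfolding P_def by (intro continuous_intros)
  define s where "s = (\<Sum>c\<in>S. (cmod (coeff E c))\<^sup>2)"
  have s: "complex_of_real s = (\<Sum>c\<in>S. coeff E c * cnj (coeff E c))"
    by (simp add: s_def complex_norm_square del: of_real_power)
  have fP: "(\<integral>x. indicator E x * cnj (P x) \<partial>\<mu>) = of_real s"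
  proof -
    have "(\<integral>x. indicator E x * cnj (P x) \<partial>\<mu>) = (\<integral>x. (\<Sum>c\<in>S. cnj (coeff E c) * (indicator E x * cnj (eval c x))) \<partial>\<mu>)"
      by (simp add: P_def sum_distrib_left mult_ac)
    also have "\<dots> = (\<Sum>c\<in>S. (\<integral>x. cnj (coeff E c) * (indicator E x * cnj (eval c x)) \<partial>\<mu>))"
      by (intro Bochner_Integration.integral_sum integrable_mult_right integrable_indicator_times E continuous_intros)
    also have "\<dots> = of_real s" by (simp add: s coeff_def mult.commute)
    finally show ?thesis .
  qed
  have PP: "(\<integral>x. P x * cnj (P x) \<partial>\<mu>) = of_real s"
  proof -
    have "(\<integral>x. P x * cnj (P x) \<partial>\<mu>)
      = (\<integral>x. (\<Sum>c\<in>S. \<Sum>d\<in>S. coeff E c * cnj (coeff E d) * (eval c x * cnj (eval d x))) \<partial>\<mu>)"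
      by (simp add: P_def sum_product mult_ac)
    also have "\<dots> = (\<Sum>c\<in>S. \<Sum>d\<in>S. (\<integral>x. coeff E c * cnj (coeff E d) * (eval c x * cnj (eval d x)) \<partial>\<mu>))"
      by (subst Bochner_Integration.integral_sum, intro integrable_continuous continuous_intros)
        (intro sum.cong refl Bochner_Integration.integral_sum integrable_continuous continuous_intros)
    also have "\<dots> = (\<Sum>c\<in>S. \<Sum>d\<in>S. coeff E c * cnj (coeff E d) * (if c = d then 1 else 0))"
      by (simp add: integral_eval_cnj)
    also have "\<dots> = of_real s" using S by (simp add: s if_distrib cong: if_cong)
    finally show ?thesis .
  qed
  have int: "integrable \<mu> (\<lambda>x. indicator E x * cnj (P x))" "integrable \<mu> (\<lambda>x. P x * cnj (P x))"
    by (intro integrable_indicator_times E continuous_intros P)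
      (intro integrable_continuous continuous_intros P)
  have "0 \<le> (\<integral>x. (cmod (indicator E x - P x))\<^sup>2 \<partial>\<mu>)" by simp
  also have "\<dots> = (\<integral>x. indicator E x - 2 * Re (indicator E x * cnj (P x)) + Re (P x * cnj (P x)) \<partial>\<mu>)"
  proof (rule Bochner_Integration.integral_cong)
    show "(cmod (indicator E x - P x))\<^sup>2 = indicator E x - 2 * Re (indicator E x * cnj (P x)) + Re (P x * cnj (P x))" for x
      unfolding cmod_power2 by (cases "x \<in> E") (auto simp: power2_eq_square algebra_simps)
  qed simp
  also have "\<dots> = measure \<mu> E - 2 * s + s"
  proof -
    have "integrable \<mu> (indicator E :: 'x \<Rightarrow> real)"
      using E by (intro integrable_real_indicator) (auto simp: emeasure_eq_measure)
    moreover define R1 R2 where "R1 x = Re (indicator E x * cnj (P x))" and "R2 x = Re (P x * cnj (P x))" for x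
    have "integrable \<mu> R1" "(\<integral>x. R1 x \<partial>\<mu>) = s" "integrable \<mu> R2" "(\<integral>x. R2 x \<partial>\<mu>) = s"
      unfolding R1_def[abs_def] R2_def[abs_def] integral_Re[OF int(1)] integral_Re[OF int(2)] fP PP
      using int by (simp_all only: integrable_Re Re_complex_of_real)
    ultimately have "(\<integral>x. indicator E x - 2 * R1 x + R2 x \<partial>\<mu>) = measure \<mu> E - 2 * s + s"
      using E by simp
    then show ?thesis by (simp only: R1_def R2_def)
  qed
  finally have "s \<le> measure \<mu> E" by simp
  also have "\<dots> \<le> 1" using bounded_measure[of E] by simp
  finally show ?thesis by (simp add: s_def)
qed

text \<open>By Bessel's inequality a nonzero value z is taken at most 1 / |z|^2 times.\<close>

lemma finite_coeff_level:
  assumes E: "E \<in> sets \<mu>" and z: "z \<noteq> 0"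
  shows "finite {c. coeff E c = z}"
proof (rule ccontr)
  assume inf: "infinite {c. coeff E c = z}"
  obtain n :: nat where n: "1 / (cmod z)\<^sup>2 < real n" using reals_Archimedean2 by blast
  obtain S where S: "finite S" "card S = n" "S \<subseteq> {c. coeff E c = z}"
    using infinite_arbitrarily_large[OF inf] by blast
  have "(\<Sum>c\<in>S. (cmod (coeff E c))\<^sup>2) = (\<Sum>c\<in>S. (cmod z)\<^sup>2)"
    using S(3) by (intro sum.cong) auto
  then have "real n * (cmod z)\<^sup>2 \<le> 1" using Bessel_inequality[OF E S(1)] S(2) by simp
  moreover have "1 < real n * (cmod z)\<^sup>2" using n z by (simp add: divide_less_eq)
  ultimately show False by simp
qed

text \<open>Adding a bound \<open>B\<close> of |h| makes both functions nonnegative. The measures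
  with these densities have equal coefficients, hence coincide, and densities are unique almost
  everywhere.\<close>

lemma AE_eq_if_coefficients_eq:
  fixes h :: "'x \<Rightarrow> real"
  assumes M: "character_subgroup M" "annihilator M = {0}" and E: "E \<in> sets \<mu>" and h: "continuous_on UNIV h"
    and eq: "\<And>c. c \<in> M \<Longrightarrow> coeff E c = (\<integral>x. of_real (h x) * cnj (eval c x) \<partial>\<mu>)"
  shows "AE x in \<mu>. indicator E x = h x"
proof -
  obtain B where B: "\<And>x. \<bar>h x\<bar> \<le> B"
    using bounded_range[OF h] by (auto simp: bounded_iff)
  have B0: "B \<ge> 0" using B[of 0] by simp
  define u where "u x = indicator E x + B" for x
  define v where "v x = h x + B" for x
  have nonneg: "0 \<le> u x" "0 \<le> v x" for x
    using B[of x] B0 by (auto simp: u_def v_def abs_le_iff)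
  have meas: "u \<in> borel_measurable \<mu>" "v \<in> borel_measurable \<mu>"
    unfolding u_def v_def using E measurable_continuous[OF h] by auto
  have bounded: "\<bar>u x\<bar> \<le> B + 1" "\<bar>v x\<bar> \<le> 2 * B" for x
    using B[of x] B0 by (auto simp: u_def v_def indicator_def)
  have int: "integrable \<mu> u" "integrable \<mu> v"
    using bounded
    by (auto intro!: integrable_const_bound[where f = u, of "B + 1"] integrable_const_bound[where f = v, of "2 * B"] meas)
  have fin: "finite_measure (density \<mu> (\<lambda>x. ennreal (w x)))" if "integrable \<mu> w" "\<And>x. 0 \<le> w x" for w
  proof
    have "emeasure (density \<mu> (\<lambda>x. ennreal (w x))) (space (density \<mu> (\<lambda>x. ennreal (w x)))) = (\<integral>\<^sup>+x. ennreal (w x) \<partial>\<mu>)"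
      using that borel_measurable_integrable[OF that(1)] by (subst emeasure_density) auto
    also have "\<dots> \<noteq> \<infinity>" using nn_integral_eq_integral[OF that(1)] that(2) by simp
    finally show "emeasure (density \<mu> (\<lambda>x. ennreal (w x))) (space (density \<mu> (\<lambda>x. ennreal (w x)))) \<noteq> \<infinity>" .
  qed
  have dens: "(\<integral>x. eval c x \<partial>density \<mu> (\<lambda>x. ennreal (w x))) = (\<integral>x. w x *\<^sub>R eval c x \<partial>\<mu>)"
    if "w \<in> borel_measurable \<mu>" "\<And>x. 0 \<le> w x" for w c
  proof -
    have "eval c \<in> borel_measurable \<mu>" by (intro measurable_continuous continuous_intros)
    then show ?thesis using that by (intro integral_density) auto
  qed
  have "density \<mu> (\<lambda>x. ennreal (u x)) = density \<mu> (\<lambda>x. ennreal (v x))"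
  proof (rule measure_eq_if_coefficients_eq[OF compact_UNIV M fin[OF int(1) nonneg(1)] _ fin[OF int(2) nonneg(2)]])
    fix c assume c: "c \<in> M"
    have i1: "integrable \<mu> (\<lambda>x. indicator E x * eval c x)"
      by (intro integrable_indicator_times E continuous_intros)
    have i2: "integrable \<mu> (\<lambda>x. complex_of_real (h x) * eval c x)" "integrable \<mu> (\<lambda>x. complex_of_real B * eval c x)"
      by (intro integrable_continuous continuous_intros h)+
    \<comment> \<open>\<open>coeff\<close> integrates against the conjugate character, so the
      hypothesis is used at \<open>- c\<close>.\<close>
    have "(\<integral>x. indicator E x * eval c x \<partial>\<mu>) = (\<integral>x. of_real (h x) * eval c x \<partial>\<mu>)"
      using eq[OF character_subgroupD(3)[OF M(1) c]] by (simp add: coeff_def)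
    moreover have "u x *\<^sub>R eval c x = indicator E x * eval c x + of_real B * eval c x" for x
      by (simp add: u_def indicator_def scaleR_conv_of_real algebra_simps)
    moreover have "v x *\<^sub>R eval c x = of_real (h x) * eval c x + of_real B * eval c x" for x
      by (simp add: v_def scaleR_conv_of_real algebra_simps)
    ultimately have "(\<integral>x. u x *\<^sub>R eval c x \<partial>\<mu>) = (\<integral>x. v x *\<^sub>R eval c x \<partial>\<mu>)"
      using i1 i2 by simp
    then show "(\<integral>x. eval c x \<partial>density \<mu> (\<lambda>x. ennreal (u x))) = (\<integral>x. eval c x \<partial>density \<mu> (\<lambda>x. ennreal (v x)))"
      by (simp add: dens meas nonneg)
  qed simp_all
  then have "AE x in \<mu>. ennreal (u x) = ennreal (v x)"
    using meas by (subst (asm) density_unique_iff) auto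
  then show ?thesis
  proof eventually_elim
    case (elim x)
    then have "u x = v x" using nonneg[of x] by simp
    then show ?case by (simp add: u_def v_def)
  qed
qed

end

subsection \<open>The dual module of an algebraic action\<close>

lemma eval_nmult: "eval (nmult n c) x = eval c x ^ n"
  by (induction n) (auto simp: eval_add)

lemma eval_arg_nmult: "eval c (nmult n x) = eval c x ^ n"
  by (induction n) (auto simp: eval_arg_add)

locale haar_action = haar_group \<mu> + group G
  for \<mu> :: "'x::{topological_ab_group_add, metric_space} measure" and G :: "('g, 'b) monoid_scheme" (structure) +
  fixes \<alpha> :: "'g \<Rightarrow> 'x \<Rightarrow> 'x"
  assumes action: "algebraic_action G \<alpha>"
begin

lemma alpha_one: "\<alpha> \<one> x = x"
  and alpha_mult: "g \<in> carrier G \<Longrightarrow> h \<in> carrier G \<Longrightarrow> \<alpha> (g \<otimes> h) x = \<alpha> g (\<alpha> h x)"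
  and alpha_add: "g \<in> carrier G \<Longrightarrow> \<alpha> g (x + y) = \<alpha> g x + \<alpha> g y"
  and alpha_continuous: "g \<in> carrier G \<Longrightarrow> continuous_on UNIV (\<alpha> g)"
proof -
  interpret act: group_action G UNIV \<alpha> using action unfolding algebraic_action_def by blast
  show "\<alpha> \<one> x = x" using fun_cong[OF act.id_eq_one, of x] by simp
  show "g \<in> carrier G \<Longrightarrow> h \<in> carrier G \<Longrightarrow> \<alpha> (g \<otimes> h) x = \<alpha> g (\<alpha> h x)"
    using act.composition_rule[of x g h] by simp
  show "g \<in> carrier G \<Longrightarrow> \<alpha> g (x + y) = \<alpha> g x + \<alpha> g y"
    using action unfolding algebraic_action_def by (auto simp: Modules.additive_def)
  show "g \<in> carrier G \<Longrightarrow> continuous_on UNIV (\<alpha> g)"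
    using action unfolding algebraic_action_def by blast
qed

lemma alpha_zero: "g \<in> carrier G \<Longrightarrow> \<alpha> g 0 = 0"
  using alpha_add[of g 0 0] by simp

lemma alpha_inv:
  "g \<in> carrier G \<Longrightarrow> \<alpha> g (\<alpha> (inv g) x) = x" "g \<in> carrier G \<Longrightarrow> \<alpha> (inv g) (\<alpha> g x) = x"
  by (simp_all add: alpha_one flip: alpha_mult)

text \<open>The inverse turns the contragredient action into a left action.\<close>

definition dual :: "'g \<Rightarrow> 'x character \<Rightarrow> 'x character" where
  "dual g c = Character (\<lambda>x. eval c (\<alpha> (inv g) x))"

lemma eval_dual: "g \<in> carrier G \<Longrightarrow> eval (dual g c) x = eval c (\<alpha> (inv g) x)"
  unfolding dual_def
  by (subst Character_inverse) (auto simp: alpha_add eval_arg_add intro!: continuous_intros alpha_continuous)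

sublocale dual: group_module G dual
proof
  show "dual g (a + b) = dual g a + dual g b" if "g \<in> carrier G" for g a b
    using that by (intro character_eqI) (simp add: eval_dual eval_add)
  show "dual (g \<otimes> h) a = dual g (dual h a)" if "g \<in> carrier G" "h \<in> carrier G" for g h a
    using that by (intro character_eqI) (simp add: eval_dual inv_mult_group alpha_mult)
  show "dual \<one> a = a" for a
    by (intro character_eqI) (simp add: eval_dual alpha_one)
qed

lemma character_subgroup_submod: "dual.submod N J \<Longrightarrow> character_subgroup J"
  unfolding character_subgroup_def using dual.submodD by blast

text \<open>Finitely many characters detect the compact set outside the interior of the expansive
  neighbourhood \<open>U\<close>. If x is annihilated by all their translates, its orbit stays in
  \<open>U\<close>, so x = 0.\<close>

lemma expansive_imp_finitely_generated:
  assumes "expansive G \<alpha>"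
  obtains F where "finite F" "annihilator (dual.span (carrier G) F) = {0}"
proof -
  obtain U where U: "0 \<in> interior U" "(\<Inter>g\<in>carrier G. \<alpha> g ` U) = {0}"
    using assms unfolding expansive_def by blast
  have "compact (- interior U)"
    using compact_Int_closed[OF compact_UNIV, of "- interior U"] by (simp add: closed_Compl)
  moreover have "open {x. eval c x \<noteq> 1}" for c :: "'x character"
    by (intro open_Collect_neq continuous_intros)
  moreover have "- interior U \<subseteq> (\<Union>c. {x. eval c x \<noteq> 1})"
  proof
    fix x assume "x \<in> - interior U"
    then have "x \<noteq> 0" using U(1) by blast
    then obtain c :: "'x character" where "eval c x \<noteq> 1" by (rule characters_separate_points)
    then show "x \<in> (\<Union>c. {x. eval c x \<noteq> 1})" by blast
  qed
  ultimately obtain F where F: "finite F" "- interior U \<subseteq> (\<Union>c\<in>F. {x. eval c x \<noteq> 1})"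
    using compactE_image[of "- interior U" UNIV "\<lambda>c. {x. eval c x \<noteq> 1}"] by metis
  let ?M = "dual.span (carrier G) F"
  have "annihilator ?M \<subseteq> {0}"
  proof
    fix x assume x: "x \<in> annihilator ?M"
    have "x \<in> \<alpha> g ` U" if g: "g \<in> carrier G" for g
    proof -
      have "eval c (\<alpha> (inv g) x) = 1" if c: "c \<in> F" for c
      proof -
        have "c \<in> ?M" using dual.span_superset c by blast
        then have "dual g c \<in> ?M" using dual.submodD(5)[OF dual.span_submod g] by blast
        then show ?thesis using x g unfolding annihilator_def by (auto simp: eval_dual)
      qed
      then have "\<alpha> (inv g) x \<in> U" using F(2) interior_subset[of U] by blast
      then show ?thesis using alpha_inv(1)[OF g, of x] by (metis imageI)
    qed
    then show "x \<in> {0}" using U(2) by blast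
  qed
  moreover have "0 \<in> annihilator ?M" by (simp add: annihilator_def)
  ultimately show ?thesis using that F(1) by blast
qed

text \<open>On the annihilator \<open>S\<close> of \<open>J\<close> only finitely many of the maps
  differ, so the expansiveness condition involves a finite intersection \<open>W\<close>, a
  neighbourhood of 0 meeting \<open>S\<close> only in 0. Thus \<open>S\<close> is discrete and
  compact, hence finite. Characters that agree on \<open>S\<close> differ by an element of
  \<open>J\<close>.\<close>

lemma finite_quotient_if_finite_action:
  assumes exp: "expansive G \<alpha>" and M: "dual.submod (carrier G) M" "annihilator M = {0}"
    and J: "dual.submod (carrier G) J" "J \<subseteq> M"
    and R: "finite R" "R \<subseteq> carrier G" "\<And>g. g \<in> carrier G \<Longrightarrow> \<exists>r\<in>R. \<forall>m\<in>M. dual g m - dual r m \<in> J"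
  shows "dual.finite_mod M J"
proof -
  obtain U where U: "0 \<in> interior U" "(\<Inter>g\<in>carrier G. \<alpha> g ` U) = {0}"
    using exp unfolding expansive_def by blast
  define S where "S = annihilator J"
  have finite_action: "\<exists>r\<in>R. \<forall>x\<in>S. \<alpha> (inv g) x = \<alpha> (inv r) x" if g: "g \<in> carrier G" for g
  proof -
    obtain r where r: "r \<in> R" "\<And>m. m \<in> M \<Longrightarrow> dual g m - dual r m \<in> J" using R(3)[OF g] by blast
    have rG: "r \<in> carrier G" using r R by blast
    have "\<alpha> (inv g) x = \<alpha> (inv r) x" if x: "x \<in> S" for x
    proof (rule annihilator_trivial_separates[OF M(2)])
      fix m assume "m \<in> M"
      then have "eval (dual g m - dual r m) x = 1" using r(2) x by (auto simp: S_def annihilator_def)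
      then have "eval m (\<alpha> (inv g) x) * cnj (eval m (\<alpha> (inv r) x)) * eval m (\<alpha> (inv r) x) = eval m (\<alpha> (inv r) x)"
        using g rG by (simp add: eval_diff eval_dual)
      then show "eval m (\<alpha> (inv g) x) = eval m (\<alpha> (inv r) x)" by (simp add: mult.assoc)
    qed
    then show ?thesis using r(1) by blast
  qed
  define W where "W = (\<Inter>r\<in>R. \<alpha> (inv r) -` interior U)"
  have "open W"
    unfolding W_def using R by (intro open_INT ballI open_vimage alpha_continuous) auto
  have W0: "0 \<in> W" unfolding W_def using R(2) U(1) by (auto simp: alpha_zero subset_iff)
  have WS: "x = 0" if x: "x \<in> W" "x \<in> S" for x
  proof -
    have "x \<in> \<alpha> g ` U" if g: "g \<in> carrier G" for g
    proof -
      obtain r where "r \<in> R" "\<alpha> (inv g) x = \<alpha> (inv r) x" using finite_action[OF g] x(2) by blast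
      then have "\<alpha> (inv g) x \<in> U" using x(1) interior_subset[of U] unfolding W_def by auto
      then show ?thesis using alpha_inv(1)[OF g, of x] by (metis imageI)
    qed
    then show ?thesis using U(2) by blast
  qed
  have S_diff: "x - y \<in> S" if "x \<in> S" "y \<in> S" for x y
    using that by (simp add: S_def annihilator_def eval_arg_diff)
  have "closed S"
  proof -
    have "S = (\<Inter>c\<in>J. {x. eval c x = 1})" by (auto simp: S_def annihilator_def)
    then show ?thesis by (auto intro!: closed_INT closed_Collect_eq continuous_intros)
  qed
  then have "compact S" using compact_Int_closed[OF compact_UNIV, of S] by simp
  moreover have "open ((\<lambda>y. y - x) -` W)" for x
    using \<open>open W\<close> by (rule open_vimage) (intro continuous_intros)
  moreover have "S \<subseteq> (\<Union>x\<in>S. (\<lambda>y. y - x) -` W)" using W0 by auto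
  ultimately obtain C where C: "C \<subseteq> S" "finite C" "S \<subseteq> (\<Union>x\<in>C. (\<lambda>y. y - x) -` W)"
    using compactE_image[of S S "\<lambda>x. (\<lambda>y. y - x) -` W"] by metis
  have "S \<subseteq> C"
  proof
    fix y assume y: "y \<in> S"
    then obtain x where x: "x \<in> C" "y - x \<in> W" using C(3) by blast
    then have "y - x = 0" using WS S_diff[OF y] C(1) by blast
    then show "y \<in> C" using x by simp
  qed
  then have S_fin: "finite S" using C(2) finite_subset by blast
  \<comment> \<open>A point of the finite group \<open>S\<close> has finite order, so characters
    take roots of unity there. This leaves finitely many restrictions of characters to
    \<open>S\<close>.\<close>
  have roots: "finite ((\<lambda>c. eval c x) ` M)" if x: "x \<in> S" for x
  proof -
    have "nmult n x \<in> S" for n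
      using x by (simp add: S_def annihilator_def eval_arg_nmult)
    then obtain n where n: "n > 0" "nmult n x = 0" using nmult_torsion[OF S_fin] by blast
    have "eval c x ^ n = 1" for c using eval_arg_nmult[of c n x] n(2) by simp
    then have "(\<lambda>c. eval c x) ` M \<subseteq> {z. z ^ n = 1}" by blast
    moreover have "finite {z :: complex. z ^ n = 1}" using n(1) finite_roots_unity[of n] by simp
    ultimately show ?thesis by (rule finite_subset)
  qed
  define res where "res c = restrict (eval c) S" for c
  have "res ` M \<subseteq> PiE S (\<lambda>x. (\<lambda>c. eval c x) ` M)" unfolding res_def by auto
  then have "finite (res ` M)" by (rule finite_subset) (intro finite_PiE S_fin roots)
  then obtain R' where R': "R' \<subseteq> M" "finite R'" "res ` M = res ` R'"
    using finite_subset_image[of "res ` M" res M] by blast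
  have "\<exists>r\<in>R'. c - r \<in> J" if c: "c \<in> M" for c
  proof -
    obtain r where r: "r \<in> R'" "res c = res r" using R'(3) c by (metis imageE imageI)
    have "c - r \<in> J"
    proof (rule double_annihilator[OF character_subgroup_submod[OF J(1)]])
      fix x assume "x \<in> annihilator J"
      then have "eval c x = eval r x" using fun_cong[OF r(2), of x] by (simp add: res_def S_def)
      then show "eval (c - r) x = 1" by (simp add: eval_diff)
    qed
    then show ?thesis using r(1) by blast
  qed
  then show ?thesis unfolding dual.finite_mod_def using R'(2) by blast
qed

lemma finite_orbit_characters:
  assumes "expansive G \<alpha>" "polycentral G (carrier G)" "finite F"
    and M: "M = dual.span (carrier G) F" "annihilator M = {0}"
  shows "finite (dual.finite_orbits M {0})"
proof (rule ccontr)
  assume "infinite (dual.finite_orbits M {0})"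
  then obtain J R where "dual.submod (carrier G) J" "J \<subseteq> M" "\<not> dual.finite_mod M J"
    "finite R" "R \<subseteq> carrier G" "\<And>g. g \<in> carrier G \<Longrightarrow> \<exists>r\<in>R. \<forall>m\<in>M. dual g m - dual r m \<in> J"
    using dual.infinite_quotient_with_finite_action[OF assms(2,3) M(1)] by blast
  moreover have "dual.submod (carrier G) M" unfolding M(1) by (rule dual.span_submod)
  ultimately show False
    using finite_quotient_if_finite_action[OF assms(1) _ M(2), of J R] by blast
qed

subsection \<open>Invariant sets\<close>

lemma alpha_measurable: "g \<in> carrier G \<Longrightarrow> \<alpha> g \<in> measurable \<mu> \<mu>"
  using measurable_continuous[OF alpha_continuous] by (simp cong: measurable_cong_sets)

text \<open>The Haar integral of a character only depends on whether it is trivial, and an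
  automorphism preserves triviality. Hence the image measure has the coefficients of Haar
  measure.\<close>

lemma distr_alpha:
  fixes M :: "'x character set"
  assumes M: "character_subgroup M" "annihilator M = {0}" and g: "g \<in> carrier G"
  shows "distr \<mu> \<mu> (\<alpha> g) = \<mu>"
proof (rule measure_eq_if_coefficients_eq[OF compact_UNIV M])
  show "finite_measure (distr \<mu> \<mu> (\<alpha> g))" by (rule finite_measure_distr[OF alpha_measurable[OF g]])
  show "finite_measure \<mu>" by (rule finite_measure_axioms)
  fix c :: "'x character"
  have "(\<integral>x. eval c x \<partial>distr \<mu> \<mu> (\<alpha> g)) = (\<integral>x. eval c (\<alpha> g x) \<partial>\<mu>)"
    by (intro integral_distr alpha_measurable g measurable_continuous continuous_intros)
  also have "\<dots> = (\<integral>x. eval (dual (inv g) c) x \<partial>\<mu>)" using g by (simp add: eval_dual)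
  also have "\<dots> = (\<integral>x. eval c x \<partial>\<mu>)"
  proof -
    have "dual (inv g) c = 0 \<longleftrightarrow> c = 0"
      using g dual.act_inv(1)[of g c] by (metis dual.act_zero inv_closed)
    then show ?thesis by (simp add: integral_eval)
  qed
  finally show "(\<integral>x. eval c x \<partial>distr \<mu> \<mu> (\<alpha> g)) = (\<integral>x. eval c x \<partial>\<mu>)" .
qed simp_all

lemma coeff_invariant:
  fixes M :: "'x character set"
  assumes M: "character_subgroup M" "annihilator M = {0}"
    and E: "E \<in> invariant_sets G \<alpha> \<mu>" and g: "g \<in> carrier G"
  shows "coeff E (dual g c) = coeff E c"
proof -
  have Es: "E \<in> sets \<mu>" using E by (simp add: invariant_sets_def)
  have meas: "(\<lambda>x. indicator E x * cnj (eval (dual g c) x)) \<in> borel_measurable \<mu>"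
    by (intro borel_measurable_integrable integrable_indicator_times Es continuous_intros)
  have "coeff E (dual g c) = (\<integral>x. indicator E x * cnj (eval (dual g c) x) \<partial>distr \<mu> \<mu> (\<alpha> g))"
    by (simp add: coeff_def distr_alpha[OF M g])
  also have "\<dots> = (\<integral>x. indicator E (\<alpha> g x) * cnj (eval (dual g c) (\<alpha> g x)) \<partial>\<mu>)"
    by (rule integral_distr[OF alpha_measurable[OF g] meas])
  also have "\<dots> = (\<integral>x. indicator E (\<alpha> g x) * cnj (eval c x) \<partial>\<mu>)"
    using g by (simp add: eval_dual alpha_inv)
  also have "\<dots> = (\<integral>x. indicator E x * cnj (eval c x) \<partial>\<mu>)"
  proof (rule integral_cong_AE)
    have "sym_diff (\<alpha> (inv g) ` E) E \<in> null_sets \<mu>" using E g by (simp add: invariant_sets_def)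
    then have "AE x in \<mu>. x \<notin> sym_diff (\<alpha> (inv g) ` E) E" by (rule AE_not_in)
    then show "AE x in \<mu>. indicator E (\<alpha> g x) * cnj (eval c x) = indicator E x * cnj (eval c x)"
    proof eventually_elim
      case (elim x)
      have "x \<in> \<alpha> (inv g) ` E \<longleftrightarrow> \<alpha> g x \<in> E"
        using alpha_inv[OF g] by (metis image_iff)
      then show ?case using elim by (auto simp: indicator_def)
    qed
    have "(indicator E :: 'x \<Rightarrow> complex) \<in> borel_measurable \<mu>" using Es by simp
    then have "(\<lambda>x. indicator E (\<alpha> g x) :: complex) \<in> borel_measurable \<mu>"
      by (rule measurable_compose[OF alpha_measurable[OF g]])
    then show "(\<lambda>x. indicator E (\<alpha> g x) * cnj (eval c x)) \<in> borel_measurable \<mu>"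
      by (rule borel_measurable_times) (intro measurable_continuous continuous_intros)
    show "(\<lambda>x. indicator E x * cnj (eval c x)) \<in> borel_measurable \<mu>"
      by (intro borel_measurable_integrable integrable_indicator_times Es continuous_intros)
  qed
  finally show ?thesis by (simp add: coeff_def)
qed

lemma coeff_nonzero_imp_finite_orbit:
  fixes M :: "'x character set"
  assumes M: "character_subgroup M" "annihilator M = {0}"
    and E: "E \<in> invariant_sets G \<alpha> \<mu>" and c: "c \<in> M" "coeff E c \<noteq> 0"
  shows "c \<in> dual.finite_orbits M {0}"
proof -
  have "E \<in> sets \<mu>" using E by (simp add: invariant_sets_def)
  moreover have "dual.orbit_of c \<subseteq> {d. coeff E d = coeff E c}"
    unfolding dual.orbit_of_def using coeff_invariant[OF M E] by auto
  ultimately have "finite (dual.orbit_of c)"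
    using finite_coeff_level c(2) finite_subset by blast
  then have "dual.finite_mod (dual.orbit_of c) {0}"
    unfolding dual.finite_mod_def by (intro exI[of _ "dual.orbit_of c"]) auto
  then show ?thesis using c(1) unfolding dual.finite_orbits_def by blast
qed

text \<open>The nonzero coefficients of the indicator on \<open>M\<close> all sit in the finite set
  \<open>B\<close>, so the indicator is almost everywhere a trigonometric polynomial over
  \<open>B\<close>. Its values, and so membership in \<open>E\<close> up to null sets, depend only
  on the characters in \<open>B\<close>.\<close>

lemma invariant_set_AE_eq:
  fixes M :: "'x character set"
  assumes M: "character_subgroup M" "annihilator M = {0}" and E: "E \<in> invariant_sets G \<alpha> \<mu>"
    and B: "B = dual.finite_orbits M {0}" "finite B"
  obtains S where "sym_diff E ((\<lambda>x. restrict (\<lambda>c. eval c x) B) -` S) \<in> null_sets \<mu>"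
    "(\<lambda>x. restrict (\<lambda>c. eval c x) B) -` S \<in> sets \<mu>"
proof -
  have Es: "E \<in> sets \<mu>" using E by (simp add: invariant_sets_def)
  define P where "P x = (\<Sum>c\<in>B. coeff E c * eval c x)" for x
  have P: "continuous_on UNIV P" unfolding P_def by (intro continuous_intros)
  define h where "h x = Re (P x)" for x
  have h: "continuous_on UNIV h" unfolding h_def by (intro continuous_intros P)
  have Pc: "(\<integral>x. P x * cnj (eval c x) \<partial>\<mu>) = coeff E c" if c: "c \<in> M" for c
  proof -
    have "(\<integral>x. P x * cnj (eval c x) \<partial>\<mu>) = (\<integral>x. (\<Sum>d\<in>B. coeff E d * (eval d x * cnj (eval c x))) \<partial>\<mu>)"
      by (simp add: P_def sum_distrib_right mult.assoc)
    also have "\<dots> = (\<Sum>d\<in>B. (\<integral>x. coeff E d * (eval d x * cnj (eval c x)) \<partial>\<mu>))"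
      by (intro Bochner_Integration.integral_sum integrable_continuous continuous_intros)
    also have "\<dots> = (\<Sum>d\<in>B. if d = c then coeff E d else 0)"
      by (intro sum.cong) (auto simp: integral_eval_cnj)
    also have "\<dots> = coeff E c"
      using B(2) coeff_nonzero_imp_finite_orbit[OF M E c] B(1) by (auto simp: sum.delta)
    finally show ?thesis .
  qed
  have AE: "AE x in \<mu>. indicator E x = h x"
  proof (rule AE_eq_if_coefficients_eq[OF M Es h])
    fix c assume c: "c \<in> M"
    have i: "integrable \<mu> (\<lambda>x. P x * cnj (eval c x))" "integrable \<mu> (\<lambda>x. cnj (P x * cnj (eval (- c) x)))"
      by (intro integrable_continuous continuous_intros P)+
    \<comment> \<open>The conjugate half of the real part contributes the conjugate of the
      coefficient at \<open>- c\<close>, which is again the coefficient at c because an indicator is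
      real.\<close>
    have eq: "2 * (of_real (h x) * cnj (eval c x)) = P x * cnj (eval c x) + cnj (P x * cnj (eval (- c) x))" for x
    proof -
      have "2 * of_real (h x) = P x + cnj (P x)" by (simp add: h_def complex_add_cnj)
      then have "2 * of_real (h x) * cnj (eval c x) = (P x + cnj (P x)) * cnj (eval c x)" by (rule arg_cong)
      then show ?thesis by (simp add: distrib_right mult.assoc)
    qed
    have "2 * (\<integral>x. of_real (h x) * cnj (eval c x) \<partial>\<mu>) = (\<integral>x. 2 * (of_real (h x) * cnj (eval c x)) \<partial>\<mu>)"
      by (rule integral_mult_right_zero[symmetric])
    also have "\<dots> = (\<integral>x. P x * cnj (eval c x) \<partial>\<mu>) + (\<integral>x. cnj (P x * cnj (eval (- c) x)) \<partial>\<mu>)"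
      unfolding eq by (rule Bochner_Integration.integral_add[OF i])
    also have "(\<integral>x. cnj (P x * cnj (eval (- c) x)) \<partial>\<mu>) = cnj (coeff E (- c))"
      unfolding Bochner_Integration.integral_cnj Pc[OF character_subgroupD(3)[OF M(1) c]] ..
    also have "cnj (coeff E (- c)) = coeff E c" by (simp add: coeff_uminus)
    finally show "coeff E c = (\<integral>x. of_real (h x) * cnj (eval c x) \<partial>\<mu>)" using Pc[OF c] by simp
  qed
  define S where "S = {\<phi>. Re (\<Sum>c\<in>B. coeff E c * \<phi> c) = 1}"
  have eq: "(\<lambda>x. restrict (\<lambda>c. eval c x) B) -` S = h -` {1}"
  proof -
    have "(\<Sum>c\<in>B. coeff E c * restrict (\<lambda>c. eval c x) B c) = P x" for x
      unfolding P_def by (intro sum.cong) auto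
    then show ?thesis unfolding S_def h_def vimage_def mem_Collect_eq by simp
  qed
  have sets: "h -` {1} \<in> sets \<mu>"
    using measurable_sets[OF measurable_continuous[OF h], of "{1}"] by simp
  from AE have "AE x in \<mu>. x \<notin> sym_diff E (h -` {1})"
    by eventually_elim (auto simp: indicator_def split: if_splits)
  then have "sym_diff E (h -` {1}) \<in> null_sets \<mu>"
    using Es sets by (subst (asm) AE_iff_null_sets[symmetric]) auto
  then show ?thesis using that[of S] sets unfolding eq by blast
qed

end

section \<open>Finiteness of the invariant sets and ergodicity in the connected case\<close>

theorem theorem1p1:
  fixes G :: "('g, 'b) monoid_scheme"
    and \<alpha> :: "'g \<Rightarrow> 'x \<Rightarrow> 'x::{topological_ab_group_add, metric_space}"
    and \<mu> :: "'x measure"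
  assumes "finitely_generated_group G"
    and "nilpotent_group G"
    and "algebraic_action G \<alpha>"
    and "expansive G \<alpha>"
    and "normalized_haar_measure \<mu>"
  shows "finite (invariant_sets_mod_null G \<alpha> \<mu>) \<and>
    (connected (UNIV :: 'x set) \<longrightarrow> ergodic_action G \<alpha> \<mu>)"
proof -
  interpret group G using assms(2) by (simp add: nilpotent_group_def)
  interpret haar_action \<mu> G \<alpha>
    by unfold_locales (use assms(3,5) in \<open>auto simp: algebraic_action_def\<close>)
  have poly: "polycentral G (carrier G)" by (rule nilpotent_imp_polycentral[OF assms(1,2)])
  obtain F where F: "finite F" "annihilator (dual.span (carrier G) F) = {0}"
    using expansive_imp_finitely_generated[OF assms(4)] .
  define M where "M = dual.span (carrier G) F"
  have M: "dual.submod (carrier G) M" "annihilator M = {0}"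
    unfolding M_def using dual.span_submod F(2) by auto
  note M' = character_subgroup_submod[OF M(1)] M(2)
  define B where "B = dual.finite_orbits M {0}"
  have B: "finite B"
    unfolding B_def by (rule finite_orbit_characters[OF assms(4) poly F(1) M_def M(2)])
  define res where "res x = restrict (\<lambda>c. eval c x) B" for x
  have "dual.submod (carrier G) {0}" by (rule dual.submodI) auto
  then have B_sub: "dual.submod (carrier G) B"
    unfolding B_def by (rule dual.submod_finite_orbits[OF M(1)])
  \<comment> \<open>\<open>B\<close> is a finite group, so its members are torsion characters and
    take only roots of unity as values.\<close>
  have roots: "finite (range (eval c))" if c: "c \<in> B" for c
  proof -
    obtain n where n: "n > 0" "nmult n c = 0"
      using nmult_torsion[OF B, of c] dual.nmult_mem[OF B_sub c] by blast
    have "eval c x ^ n = 1" for x using eval_nmult[of n c x] n(2) by simp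
    then have "range (eval c) \<subseteq> {z. z ^ n = 1}" by blast
    moreover have "finite {z :: complex. z ^ n = 1}" using n(1) finite_roots_unity[of n] by simp
    ultimately show ?thesis by (rule finite_subset)
  qed
  have "range res \<subseteq> PiE B (\<lambda>c. range (eval c))" unfolding res_def by auto
  then have res_fin: "finite (range res)" by (rule finite_subset) (intro finite_PiE B roots)
  have AE_eq: "\<exists>S. sym_diff E (res -` S) \<in> null_sets \<mu> \<and> res -` S \<in> sets \<mu>"
    if "E \<in> invariant_sets G \<alpha> \<mu>" for E
    using invariant_set_AE_eq[OF M' that B_def B] unfolding res_def[abs_def] by metis
  have "invariant_sets_mod_null G \<alpha> \<mu> \<subseteq> (\<lambda>S. eq_mod_null \<mu> `` {res -` S}) ` Pow (range res)"
  proof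
    fix K assume "K \<in> invariant_sets_mod_null G \<alpha> \<mu>"
    then obtain E where E: "E \<in> invariant_sets G \<alpha> \<mu>" "K = eq_mod_null \<mu> `` {E}"
      unfolding invariant_sets_mod_null_def by blast
    obtain S where S: "sym_diff E (res -` S) \<in> null_sets \<mu>" "res -` S \<in> sets \<mu>"
      using AE_eq[OF E(1)] by blast
    have "(E, res -` S) \<in> eq_mod_null \<mu>"
      using S E(1) by (simp add: eq_mod_null_def invariant_sets_def)
    then have "K = eq_mod_null \<mu> `` {res -` S}"
      unfolding E(2) by (rule equiv_class_eq[OF equiv_eq_mod_null])
    moreover have *: "res -` (S \<inter> range res) = res -` S" by auto
    ultimately have "K = (\<lambda>S. eq_mod_null \<mu> `` {res -` S}) (S \<inter> range res)" by (simp only: *)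
    then show "K \<in> (\<lambda>S. eq_mod_null \<mu> `` {res -` S}) ` Pow (range res)" by (rule image_eqI) simp
  qed
  then have fin: "finite (invariant_sets_mod_null G \<alpha> \<mu>)"
    by (rule finite_subset) (simp add: res_fin)
  have "ergodic_action G \<alpha> \<mu>" if conn: "connected (UNIV :: 'x set)"
    unfolding ergodic_action_def
  proof
    fix E assume E: "E \<in> invariant_sets G \<alpha> \<mu>"
    obtain S where S: "sym_diff E (res -` S) \<in> null_sets \<mu>" "res -` S \<in> sets \<mu>"
      using AE_eq[OF E] by blast
    have const: "res x = res 0" for x
    proof -
      \<comment> \<open>The range of the character is connected and finite, hence a single
        point.\<close>
      have "eval c x = eval c 0" if c: "c \<in> B" for c
      proof -
        have "connected (range (eval c))"
          by (intro connected_continuous_image continuous_intros conn)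
        then obtain a where "range (eval c) = {a}"
          using connected_finite_iff_sing[of "range (eval c)"] roots[OF c] by auto
        then show ?thesis by (metis rangeI singletonD)
      qed
      then show ?thesis unfolding res_def by (intro restrict_ext) blast
    qed
    have "emeasure \<mu> E = emeasure \<mu> (res -` S)"
    proof (rule emeasure_eq_AE)
      show "AE x in \<mu>. x \<in> E \<longleftrightarrow> x \<in> res -` S"
        using AE_not_in[OF S(1)] by eventually_elim auto
    qed (use E S in \<open>auto simp: invariant_sets_def\<close>)
    moreover have "x \<in> res -` S \<longleftrightarrow> res 0 \<in> S" for x using const[of x] by simp
    then have "res -` S = {} \<or> res -` S = UNIV" by blast
    ultimately show "emeasure \<mu> E = 0 \<or> emeasure \<mu> E = 1" by auto
  qed
  with fin show ?thesis by blast
qed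

end
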